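(* Let $N \in \{1,2,\dots\}$, $\alpha \in (0,N)$ and $p \in (1,\infty)$. Assume that $u \in W^{1,2}(\mathbb{R}^N)\cap L^{\frac{2Np}{N+\alpha}}(\mathbb{R}^N)$ and that $\nabla u \in W^{1,2}_{\mathrm{loc}}(\mathbb{R}^N)\cap L^{\frac{2Np}{N+\alpha}}_{\mathrm{loc}}(\mathbb{R}^N)$. If $\frac1p \le \frac{N-2}{N+\alpha}$ or $\frac1p \ge \frac{N}{N+\alpha}$, and $$-\Delta u + u = (I_\alpha * |u|^p)\,|u|^{p-2}u$$ weakly in $\mathbb{R}^N$, then $u=0$.
   Context: Functions are real-valued. $I_\alpha:\mathbb{R}^N\to\mathbb{R}$ is the Riesz potential $I_\alpha(x)=\frac{\Gamma(\frac{N-\alpha}{2})}{\Gamma(\frac{\alpha}{2})\pi^{N/2}2^{\alpha}|x|^{N-\alpha}}$, where $\Gamma$ is the Gamma function. The equation holds weakly in $\mathbb{R}^N$ if $\int \nabla u\cdot\nabla\varphi+u\varphi=\int (I_\alpha*|u|^p)|u|^{p-2}u\,\varphi$ for every $\varphi\in C_c^\infty(\mathbb{R}^N)$; $|u|^{p-2}u$ is understood as $0$ where $u=0$. *)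

theory Defs
  imports "HOL-Analysis.Analysis"
begin

subsection \<open>Lebesgue spaces\<close>

text \<open>Elements are functions rather than classes of functions equal almost everywhere.\<close>

definition Lp :: "real \<Rightarrow> ('a::euclidean_space \<Rightarrow> 'b::euclidean_space) set" where
  "Lp q = {f \<in> borel_measurable lebesgue. integrable lebesgue (\<lambda>x. norm (f x) powr q)}"

definition Lp_loc :: "real \<Rightarrow> ('a::euclidean_space \<Rightarrow> 'b::euclidean_space) set" where
  "Lp_loc q = {f \<in> borel_measurable lebesgue.
     \<forall>K. compact K \<longrightarrow> set_integrable lebesgue K (\<lambda>x. norm (f x) powr q)}"

subsection \<open>Test functions\<close>

primrec Ck :: "nat \<Rightarrow> ('a::euclidean_space \<Rightarrow> real) \<Rightarrow> bool" where
  "Ck 0 f \<longleftrightarrow> continuous_on UNIV f"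
| "Ck (Suc k) f \<longleftrightarrow> f differentiable_on UNIV \<and>
     (\<forall>b\<in>Basis. Ck k (\<lambda>x. frechet_derivative f (at x) b))"

definition test_functions :: "('a::euclidean_space \<Rightarrow> real) set" where
  "test_functions = {\<phi>. (\<forall>k. Ck k \<phi>) \<and> compact (closure {x. \<phi> x \<noteq> 0})}"

definition grad :: "('a::euclidean_space \<Rightarrow> real) \<Rightarrow> 'a \<Rightarrow> 'a" where
  "grad \<phi> x = (\<Sum>b\<in>Basis. frechet_derivative \<phi> (at x) b *\<^sub>R b)"

subsection \<open>Weak gradients and Sobolev spaces\<close>

definition has_weak_gradient ::
    "('a::euclidean_space \<Rightarrow> real) \<Rightarrow> ('a \<Rightarrow> 'a) \<Rightarrow> bool" where
  "has_weak_gradient u g \<longleftrightarrow> u \<in> Lp_loc 1 \<and> g \<in> Lp_loc 1 \<and>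
     (\<forall>\<phi>\<in>test_functions. \<forall>b\<in>Basis.
        (\<integral>x. u x * (grad \<phi> x \<bullet> b) \<partial>lebesgue) = - (\<integral>x. (g x \<bullet> b) * \<phi> x \<partial>lebesgue))"

definition weakly_differentiable :: "('a::euclidean_space \<Rightarrow> real) \<Rightarrow> bool" where
  "weakly_differentiable u \<longleftrightarrow> (\<exists>g. has_weak_gradient u g)"

text \<open>The weak gradient is unique only up to null sets, so a representative is chosen. It is
  meaningful only for weakly differentiable functions.\<close>

definition weak_grad :: "('a::euclidean_space \<Rightarrow> real) \<Rightarrow> 'a \<Rightarrow> 'a" where
  "weak_grad u = (SOME g. has_weak_gradient u g)"

definition W12 :: "('a::euclidean_space \<Rightarrow> real) set" where
  "W12 = {u. weakly_differentiable u \<and> u \<in> Lp 2 \<and> weak_grad u \<in> Lp 2}"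

definition W12_loc :: "('a::euclidean_space \<Rightarrow> real) set" where
  "W12_loc = {u. weakly_differentiable u \<and> u \<in> Lp_loc 2 \<and> weak_grad u \<in> Lp_loc 2}"

definition W12_loc_field :: "('a::euclidean_space \<Rightarrow> 'a) set" where
  "W12_loc_field = {G. \<forall>b\<in>Basis. (\<lambda>x. G x \<bullet> b) \<in> W12_loc}"

subsection \<open>The Choquard equation\<close>

text \<open>The value at the origin is \<open>0\<close> because division by zero yields zero; this affects
  no integral.\<close>

definition riesz_potential :: "real \<Rightarrow> 'a::euclidean_space \<Rightarrow> real" where
  "riesz_potential \<alpha> x =
     Gamma ((real DIM('a) - \<alpha>) / 2) /
     (Gamma (\<alpha> / 2) * pi powr (real DIM('a) / 2) * 2 powr \<alpha> * norm x powr (real DIM('a) - \<alpha>))"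

definition convolution ::
    "('a::euclidean_space \<Rightarrow> real) \<Rightarrow> ('a \<Rightarrow> real) \<Rightarrow> 'a \<Rightarrow> real" where
  "convolution f g x = (\<integral>y. f (x - y) * g y \<partial>lebesgue)"

text \<open>Weak solutions of \<open>- \<Delta>u + u = (I\<^sub>\<alpha> * |u|\<^sup>p) |u|\<^sup>p\<^sup>-\<^sup>2 u\<close>. For \<open>u\<close> in \<open>W12\<close> and in
  \<open>Lp (2 N p / (N + \<alpha>))\<close> with \<open>0 < \<alpha> < N\<close> and \<open>p > 1\<close>, the convolution integral converges for
  almost every point and all integrands below are integrable (Hardy-Littlewood-Sobolev and
  Hoelder), so the value \<open>0\<close> of a divergent integral plays no role.\<close>

definition choquard_weak_solution ::
    "real \<Rightarrow> real \<Rightarrow> ('a::euclidean_space \<Rightarrow> real) \<Rightarrow> bool" where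
  "choquard_weak_solution \<alpha> p u \<longleftrightarrow>
     (\<forall>\<phi>\<in>test_functions.
        (\<integral>x. weak_grad u x \<bullet> grad \<phi> x + u x * \<phi> x \<partial>lebesgue) =
        (\<integral>x. convolution (riesz_potential \<alpha>) (\<lambda>y. \<bar>u y\<bar> powr p) x
              * (\<bar>u x\<bar> powr (p - 2) * u x) * \<phi> x \<partial>lebesgue))"

end

theory Submission
  imports Defs
begin

text \<open>Testing the equation with \<open>u\<close> gives the energy identity
  \<open>\<integral>|\<nabla>u|\<^sup>2 + \<integral>u\<^sup>2 = D\<close> with \<open>D = \<integral>(I\<^sub>\<alpha> * |u|\<^sup>p)|u|\<^sup>p\<close>, and testing it with a truncation of \<open>x \<bullet> \<nabla>u\<close>
  gives the Pohozaev identity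
  \<open>(N-2)/2 \<integral>|\<nabla>u|\<^sup>2 + N/2 \<integral>u\<^sup>2 = (N+\<alpha>)/(2p) D\<close>. Eliminating \<open>D\<close> leaves a linear relation between
  \<open>\<integral>|\<nabla>u|\<^sup>2\<close> and \<open>\<integral>u\<^sup>2\<close> whose coefficients have the same sign for the excluded exponents. This
  kills \<open>\<integral>u\<^sup>2\<close> or \<open>\<integral>|\<nabla>u|\<^sup>2\<close>; in the second case \<open>2 \<integral>u x \<bullet> \<nabla>u = - N \<integral>u\<^sup>2\<close> still yields \<open>u = 0\<close>.

  The truncated field is \<open>X x = P(x/m) x\<close> with a smooth bump \<open>P\<close>. As \<open>X \<bullet> \<nabla>u\<close> is not a test function, \<open>u\<close> is
  mollified along a sequence so fast that the sum of all local \<open>L\<^sup>q\<close> errors is an integrable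
  majorant; every passage to the limit is then dominated convergence. In the nonlocal term the kernel
  is first regularised, then the double integral is symmetrised, so that only the Lipschitz quotient
  \<open>(x - y) \<bullet> (X x - X y) / |x - y|\<^sup>2\<close> remains. All finiteness comes from the diagonal case of the
  Hardy-Littlewood-Sobolev inequality.\<close>

subsection \<open>Smooth functions and bump functions\<close>

text \<open>The exponent \<open>r = 2 N p / (N + \<alpha>)\<close> puts \<open>|u| powr p\<close> in
  the space with exponent \<open>r / p = 2 N / (N + \<alpha>)\<close>, the diagonal case in which
  the nonlocal energy is finite. The assumptions on the gradient are what the truncated field
  requires. With \<nabla>u locally of class \<open>r\<close>, the function
  \<open>|u| powr (p - 1) * |\<nabla>u|\<close> lies locally in the same space as
  \<open>|u| powr p\<close>, so one inequality controls every nonlocal integral. With \<nabla>u in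
  \<open>W12_loc_field\<close>, the gradient of \<open>X \<bullet> \<nabla>u\<close> can be paired
  with \<nabla>u. The obstacle is the singularity: a derivative of
  \<open>|z| powr - (N - \<alpha>)\<close> is of order \<open>|z| powr - (N - \<alpha> + 1)\<close>,
  which is not locally integrable for \<alpha> \<le> 1, and only the difference
  \<open>X x - X y\<close> recovers the lost power. Two kinds of limit are kept apart. Mollification
  and regularisation are removed for a fixed radius \<open>m\<close>, with majorants that may depend
  on \<open>m\<close>; what goes to infinity with \<open>m\<close> are identities in
  \<open>u\<close> alone, and for these the bounds on the cut-off have to be uniform in
  \<open>m\<close>.\<close>

abbreviation pd :: "'a::euclidean_space \<Rightarrow> ('a \<Rightarrow> real) \<Rightarrow> 'a \<Rightarrow> real" where
  "pd b f x \<equiv> frechet_derivative f (at x) b"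

abbreviation smooth :: "('a::euclidean_space \<Rightarrow> real) \<Rightarrow> bool" where
  "smooth f \<equiv> \<forall>k. Ck k f"

lemma pd_eqI: "(f has_derivative f') (at x) \<Longrightarrow> pd b f x = f' b"
  by (metis frechet_derivative_at)

lemma Ck_Suc_imp: "Ck (Suc k) f \<Longrightarrow> Ck k f"
proof (induction k arbitrary: f)
  case 0
  then show ?case by (auto intro: differentiable_imp_continuous_on)
next
  case (Suc k)
  then show ?case by auto
qed

lemma smooth_pd: "smooth f \<Longrightarrow> b \<in> Basis \<Longrightarrow> smooth (pd b f)"
  by (metis Ck.simps(2))

lemma smooth_differentiable: "smooth f \<Longrightarrow> f differentiable (at x)"
  using Ck.simps(2)[of 0 f] by (auto simp: differentiable_on_def)

lemma smooth_has_derivative: "smooth f \<Longrightarrow> (f has_derivative frechet_derivative f (at x)) (at x)"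
  using smooth_differentiable frechet_derivative_works by blast

lemma smooth_continuous: "smooth f \<Longrightarrow> continuous_on UNIV f"
  using Ck.simps(1)[of f] by blast

lemma linear_Basis_expansion:
  fixes h :: "'a::euclidean_space"
  assumes "bounded_linear (f' :: 'a \<Rightarrow> real)"
  shows "f' h = (\<Sum>b\<in>Basis. (h \<bullet> b) * f' b)"
proof -
  interpret f': bounded_linear f' by fact
  have "f' h = f' (\<Sum>b\<in>Basis. (h \<bullet> b) *\<^sub>R b)" by (simp add: euclidean_representation)
  also have "\<dots> = (\<Sum>b\<in>Basis. (h \<bullet> b) * f' b)"
    by (simp add: f'.sum f'.scaleR)
  finally show ?thesis .
qed

lemma grad_inner: "b \<in> Basis \<Longrightarrow> grad f x \<bullet> b = pd b f x"
  unfolding grad_def by (simp add: inner_sum_left inner_Basis if_distrib sum.If_cases cong: if_cong)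

lemma Ck_const: "Ck k (\<lambda>x. c)"
proof (induction k arbitrary: c)
  case (Suc k)
  have "pd b (\<lambda>x. c) = (\<lambda>x. 0)" for b :: 'a
    by (rule ext) (rule pd_eqI[where f'="\<lambda>_. 0"], simp)
  then show ?case using Suc by simp
qed simp

lemma Ck_inner: "Ck k (\<lambda>x. x \<bullet> a)"
proof (cases k)
  case 0 then show ?thesis by (auto intro!: continuous_intros)
next
  case (Suc m)
  have "((\<lambda>x. x \<bullet> a) has_derivative (\<lambda>h. h \<bullet> a)) (at x)" for x
    by (auto intro!: derivative_eq_intros)
  then have "pd b (\<lambda>x. x \<bullet> a) = (\<lambda>x. b \<bullet> a)" and "(\<lambda>x. x \<bullet> a) differentiable_on UNIV" for b
    by (auto intro!: pd_eqI ext simp: differentiable_on_def differentiable_def)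
  moreover have "Ck m (\<lambda>x::'a. b \<bullet> a)" for b by (rule Ck_const)
  ultimately show ?thesis using Suc by simp
qed

lemma Ck_add: "Ck k f \<Longrightarrow> Ck k g \<Longrightarrow> Ck k (\<lambda>x. f x + g x)"
proof (induction k arbitrary: f g)
  case 0 then show ?case by (auto intro!: continuous_intros)
next
  case (Suc k)
  then have d: "(f has_derivative frechet_derivative f (at x)) (at x)"
       "(g has_derivative frechet_derivative g (at x)) (at x)" for x
    by (auto simp: differentiable_on_def frechet_derivative_works)
  have e: "((\<lambda>x. f x + g x) has_derivative (\<lambda>h. pd h f x + pd h g x)) (at x)" for x
    by (rule has_derivative_add[OF d])
  have "pd b (\<lambda>x. f x + g x) = (\<lambda>x. pd b f x + pd b g x)" for b
    by (rule ext) (rule pd_eqI[OF e])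
  then show ?case using Suc by (auto simp: differentiable_on_def)
qed

lemma Ck_mult: "Ck k f \<Longrightarrow> Ck k g \<Longrightarrow> Ck k (\<lambda>x. f x * g x)"
proof (induction k arbitrary: f g)
  case 0 then show ?case by (auto intro!: continuous_intros)
next
  case (Suc k)
  then have d: "(f has_derivative frechet_derivative f (at x)) (at x)"
       "(g has_derivative frechet_derivative g (at x)) (at x)" for x
    by (auto simp: differentiable_on_def frechet_derivative_works)
  have e: "((\<lambda>x. f x * g x) has_derivative (\<lambda>h. f x * pd h g x + pd h f x * g x)) (at x)" for x
    by (rule has_derivative_mult[OF d])
  have "pd b (\<lambda>x. f x * g x) = (\<lambda>x. f x * pd b g x + pd b f x * g x)" for b
    by (rule ext) (rule pd_eqI[OF e])
  moreover have "Ck k (\<lambda>x. f x * pd b g x + pd b f x * g x)" if "b \<in> Basis" for b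
    using Suc.prems Ck_Suc_imp[of k f] Ck_Suc_imp[of k g] that by (intro Ck_add Suc.IH) auto
  moreover have "(\<lambda>x. f x * g x) differentiable_on UNIV"
    using e unfolding differentiable_on_def differentiable_def by blast
  ultimately show ?case by simp
qed

lemma Ck_sum: "(\<And>i. i \<in> A \<Longrightarrow> Ck k (f i)) \<Longrightarrow> Ck k (\<lambda>x. \<Sum>i\<in>A. f i x)"
  by (induction A rule: infinite_finite_induct) (auto intro: Ck_const Ck_add)

lemma Ck_reflect: "Ck k f \<Longrightarrow> Ck k (\<lambda>y. f (a - y))"
proof (induction k arbitrary: f)
  case 0 then show ?case
    by (auto intro!: continuous_intros continuous_on_compose2[of UNIV f])
next
  case (Suc k)
  then have d: "(f has_derivative frechet_derivative f (at x)) (at x)" for x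
    by (auto simp: differentiable_on_def frechet_derivative_works)
  have e: "((\<lambda>y. f (a - y)) has_derivative (\<lambda>h. pd (- h) f (a - y))) (at y)" for y
    by (rule has_derivative_compose[where f="\<lambda>y. a - y" and g=f, OF _ d])
      (auto intro!: derivative_eq_intros)
  have "pd b (\<lambda>y. f (a - y)) = (\<lambda>y. (-1) * pd b f (a - y))" for b
    by (rule ext, subst pd_eqI[OF e]) (simp add: linear_neg[OF has_derivative_linear[OF d]])
  moreover have "Ck k (\<lambda>y. (-1) * pd b f (a - y))" if "b \<in> Basis" for b
    using Suc.prems that by (intro Ck_mult Ck_const Suc.IH) auto
  moreover have "(\<lambda>y. f (a - y)) differentiable_on UNIV"
    using e unfolding differentiable_on_def differentiable_def by blast
  ultimately show ?case by simp
qed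

lemma pd_reflect:
  assumes "smooth f"
  shows "pd b (\<lambda>y. f (a - y)) y = - pd b f (a - y)"
proof -
  note d = smooth_has_derivative[OF assms]
  have e: "((\<lambda>y. f (a - y)) has_derivative (\<lambda>h. pd (- h) f (a - y))) (at y)"
    by (rule has_derivative_compose[where f="\<lambda>y. a - y" and g=f, OF _ d])
      (auto intro!: derivative_eq_intros)
  show ?thesis by (subst pd_eqI[OF e]) (simp add: linear_neg[OF has_derivative_linear[OF d]])
qed

text \<open>The family \<open>t\<^sup>-\<^sup>k exp (-1/t)\<close> is closed under differentiation up to linear combinations, which
  makes the smoothness of \<open>exp (-1/t)\<close> an induction.\<close>

definition flat :: "nat \<Rightarrow> real \<Rightarrow> real" where
  "flat k t = (if t > 0 then exp (- 1 / t) / t ^ k else 0)"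

lemma flat_nonneg: "0 \<le> flat k t"
  by (simp add: flat_def)

lemma power_le_fact_exp:
  assumes "0 \<le> (x::real)" shows "x ^ n \<le> fact n * exp x"
proof -
  have "x ^ n / fact n \<le> exp x"
    using sum_le_suminf[OF summable_exp_generic[of x], of "{n}"] assms
    by (simp add: exp_def divide_inverse mult.commute)
  then show ?thesis by (simp add: field_simps)
qed

text \<open>Put \<open>1 / t\<close> into \<open>power_le_fact_exp\<close> with exponent
  \<open>k + m\<close>. The case \<open>m = 2\<close> gives the derivative at 0, the case
  \<open>m = 0\<close> the uniform bounds for the cut-offs.\<close>

lemma flat_le: "flat k t \<le> fact (k + m) * \<bar>t\<bar> ^ m"
proof (cases "t > 0")
  case True
  have "(1 / t) ^ (k + m) \<le> fact (k + m) * exp (1 / t)"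
    using True by (intro power_le_fact_exp) simp
  moreover have "(1 / t) ^ (k + m) = 1 / (t ^ k * t ^ m)"
    by (simp add: power_add power_divide)
  ultimately have "1 / (t ^ k * t ^ m) * exp (- 1 / t) \<le> fact (k + m) * exp (1 / t) * exp (- 1 / t)"
    by (intro mult_right_mono) auto
  also have "\<dots> = fact (k + m)" by (simp add: mult.assoc flip: exp_add)
  finally show ?thesis using True by (simp add: flat_def field_simps)
qed (simp add: flat_def)

lemma flat_deriv:
  "(flat k has_real_derivative flat (k + 2) t - k * flat (k + 1) t) (at t)"
proof -
  consider "t > 0" | "t < 0" | "t = 0" by linarith
  then show ?thesis
  proof cases
    case 1
    have "((\<lambda>t. exp (- 1 / t) * inverse t ^ k) has_real_derivative
        exp (- 1 / t) * inverse t ^ 2 * inverse t ^ k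
        + exp (- 1 / t) * (real k * inverse t ^ (k - 1) * - (inverse t ^ 2))) (at t)"
      using 1 by (auto intro!: derivative_eq_intros simp: power2_eq_square divide_inverse)
    also have "exp (- 1 / t) * inverse t ^ 2 * inverse t ^ k
        + exp (- 1 / t) * (real k * inverse t ^ (k - 1) * - (inverse t ^ 2))
        = flat (k + 2) t - k * flat (k + 1) t"
      using 1 by (cases k) (auto simp: flat_def power2_eq_square divide_inverse power_inverse algebra_simps)
    finally show ?thesis
      by (rule has_field_derivative_transform_within_open[where S="{0<..}"]) (use 1 in \<open>auto simp: flat_def divide_inverse power_inverse\<close>)
  next
    case 2
    have "((\<lambda>t. 0) has_real_derivative 0) (at t)" by simp
    then have "(flat k has_real_derivative 0) (at t)"
      by (rule has_field_derivative_transform_within_open[where S="{..<0}"]) (use 2 in \<open>auto simp: flat_def\<close>)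
    then show ?thesis using 2 by (simp add: flat_def)
  next
    case 3
    \<comment> \<open>The difference quotient at 0 is \<open>flat k h / h\<close>, and the quadratic
      bound on \<open>flat k h\<close> leaves one factor \<open>\<bar>h\<bar>\<close>; both terms of
      the claimed derivative are 0 there.\<close>
    have "((\<lambda>h. flat k h / h) \<longlongrightarrow> 0) (at 0)"
    proof (rule Lim_null_comparison)
      show "\<forall>\<^sub>F h in at 0. norm (flat k h / h) \<le> fact (k + 2) * \<bar>h\<bar>"
        unfolding eventually_at_filter
      proof (intro always_eventually allI impI)
        fix h :: real assume "h \<noteq> 0"
        then show "norm (flat k h / h) \<le> fact (k + 2) * \<bar>h\<bar>"
          using flat_le[of k h 2] flat_nonneg[of k h]
          by (simp add: abs_mult pos_divide_le_eq power2_eq_square mult.assoc)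
      qed
      show "((\<lambda>h. fact (k + 2) * \<bar>h\<bar>) \<longlongrightarrow> 0) (at (0::real))"
        by (auto intro!: tendsto_eq_intros)
    qed
    moreover have "flat k 0 = 0" "flat (k + 2) 0 = 0" "flat (k + 1) 0 = 0" by (simp_all add: flat_def)
    ultimately show ?thesis using 3 unfolding DERIV_def by simp
  qed
qed

lemma flat_continuous: "continuous_on UNIV (flat k)"
  by (rule DERIV_continuous_on) (rule has_field_derivative_at_within[OF flat_deriv])

text \<open>For positive \<kappa> the support is the ball of radius
  \<open>1 / sqrt \<kappa>\<close>. The index \<open>j\<close> is a parameter because
  differentiation raises it by 1 and 2, so that smoothness is an induction over all \<open>j\<close>
  at once.\<close>

definition bump :: "nat \<Rightarrow> real \<Rightarrow> 'a::euclidean_space \<Rightarrow> real" where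
  "bump j \<kappa> x = flat j (1 - \<kappa> * (x \<bullet> x))"

lemma bump_has_derivative:
  "(bump j \<kappa> has_derivative
     (\<lambda>h. (bump (j + 2) \<kappa> x - j * bump (j + 1) \<kappa> x) * (- 2 * \<kappa> * (x \<bullet> h)))) (at x)"
proof -
  have "((\<lambda>x. 1 - \<kappa> * (x \<bullet> x)) has_derivative (\<lambda>h. - 2 * \<kappa> * (x \<bullet> h))) (at x)"
    by (auto intro!: derivative_eq_intros simp: inner_commute)
  from DERIV_compose_FDERIV[OF flat_deriv this]
  show ?thesis unfolding bump_def by (rule has_derivative_eq_rhs) (rule ext, simp)
qed

lemma pd_bump: "pd b (bump j \<kappa>) x = (bump (j + 2) \<kappa> x - j * bump (j + 1) \<kappa> x) * (- 2 * \<kappa> * (x \<bullet> b))"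
  by (rule pd_eqI[OF bump_has_derivative])

lemma Ck_bump: "Ck k (bump j \<kappa>)"
proof (induction k arbitrary: j)
  case 0
  show ?case unfolding bump_def Ck.simps
    by (rule continuous_on_compose2[OF flat_continuous]) (auto intro!: continuous_intros)
next
  case (Suc k)
  have "pd b (bump j \<kappa>) = (\<lambda>x. (bump (j + 2) \<kappa> x + (- real j) * bump (j + 1) \<kappa> x) * ((- 2 * \<kappa>) * (x \<bullet> b)))"
    for b :: 'a by (auto simp: pd_bump)
  moreover have "Ck k (\<lambda>x::'a. (bump (j + 2) \<kappa> x + (- real j) * bump (j + 1) \<kappa> x) * ((- 2 * \<kappa>) * (x \<bullet> b)))" for b
    by (intro Ck_mult Ck_add Ck_const Ck_inner Suc)
  moreover have "bump j \<kappa> differentiable_on (UNIV :: 'a set)"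
    using bump_has_derivative unfolding differentiable_on_def differentiable_def by blast
  ultimately show ?case by simp
qed

text \<open>The second derivatives are computed explicitly and the result is symmetric in
  \<open>b\<close> and \<open>c\<close>. Mollified functions inherit this symmetry, on which
  \<open>pd_vtest\<close> relies.\<close>

lemma pd_pd_bump_commute: "pd c (pd b (bump 0 \<kappa>)) x = pd b (pd c (bump 0 \<kappa>)) x"
proof -
  have *: "pd c (pd b (bump 0 \<kappa>)) x = bump 2 \<kappa> x * (- 2 * \<kappa> * (c \<bullet> b)) +
      (bump 4 \<kappa> x - 2 * bump 3 \<kappa> x) * (- 2 * \<kappa> * (x \<bullet> c)) * (- 2 * \<kappa> * (x \<bullet> b))" for b c :: 'a
  proof -
    have eq: "pd b (bump 0 \<kappa>) = (\<lambda>x. bump 2 \<kappa> x * (- 2 * \<kappa> * (x \<bullet> b)))"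
      by (auto simp: pd_bump numeral_2_eq_2)
    have "((\<lambda>x. bump 2 \<kappa> x * (- 2 * \<kappa> * (x \<bullet> b))) has_derivative
        (\<lambda>h. bump 2 \<kappa> x * (- 2 * \<kappa> * (h \<bullet> b)) +
          (bump (2+2) \<kappa> x - real 2 * bump (2+1) \<kappa> x) * (- 2 * \<kappa> * (x \<bullet> h)) * (- 2 * \<kappa> * (x \<bullet> b)))) (at x)"
      by (rule has_derivative_mult[OF bump_has_derivative]) (auto intro!: derivative_eq_intros)
    then show ?thesis unfolding eq by (subst pd_eqI, assumption) simp
  qed
  show ?thesis by (simp add: * inner_commute)
qed

lemma bump_eq_0: "0 < \<kappa> \<Longrightarrow> 1 \<le> \<kappa> * (x \<bullet> x) \<Longrightarrow> bump j \<kappa> x = 0"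
  by (simp add: bump_def flat_def)

lemma bump_nonneg: "0 \<le> bump j \<kappa> x"
  by (simp add: bump_def flat_nonneg)

section \<open>Test functions and bounds for functions of compact support\<close>

lemma test_functionsI:
  assumes "smooth f" "\<And>x. norm x > R \<Longrightarrow> f x = 0"
  shows "f \<in> test_functions"
proof -
  have "{x. f x \<noteq> 0} \<subseteq> cball 0 R" using assms(2) by (force simp: not_less[symmetric])
  then have "bounded {x. f x \<noteq> 0}" using bounded_subset bounded_cball by blast
  then show ?thesis using assms by (simp add: test_functions_def)
qed

lemma pd_eq_0_outside:
  assumes "\<And>x. norm x > R \<Longrightarrow> f x = 0" "norm x > R"
  shows "pd b f x = 0"
proof -
  have "((\<lambda>x. 0) has_derivative (\<lambda>h. 0)) (at x)" by simp
  then have "(f has_derivative (\<lambda>h. 0)) (at x)"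
    by (rule has_derivative_transform_within_open[of _ _ _ _ "- cball 0 R"])
      (use assms in \<open>auto simp: dist_norm\<close>)
  then show ?thesis by (rule pd_eqI)
qed

lemma bounded_continuous_compact_support:
  fixes f :: "'a::euclidean_space \<Rightarrow> real"
  assumes "continuous_on UNIV f" "\<And>x. norm x > R \<Longrightarrow> f x = 0"
  obtains M where "0 \<le> M" "\<And>x. \<bar>f x\<bar> \<le> M"
proof -
  have "compact (f ` cball 0 R)"
    by (intro compact_continuous_image continuous_on_subset[OF assms(1)]) auto
  then obtain M where M: "\<And>x. x \<in> cball 0 R \<Longrightarrow> \<bar>f x\<bar> \<le> M"
    using compact_imp_bounded bounded_iff by (metis image_eqI real_norm_def)
  show ?thesis
  proof (rule that[of "max M 0"])
    fix x show "\<bar>f x\<bar> \<le> max M 0"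
      using M[of x] assms(2)[of x] by (cases "norm x > R") auto
  qed simp
qed

text \<open>Each partial derivative is continuous with compact support, hence bounded;
  \<open>L\<close> is the sum of these bounds, and the mean value inequality makes it a Lipschitz
  constant.\<close>

lemma smooth_lipschitz:
  fixes f :: "'a::euclidean_space \<Rightarrow> real"
  assumes "smooth f" "\<And>x. norm x > R \<Longrightarrow> f x = 0"
  obtains L where "0 \<le> L" "\<And>x h. \<bar>frechet_derivative f (at x) h\<bar> \<le> L * norm h"
    "\<And>x y. \<bar>f x - f y\<bar> \<le> L * norm (x - y)"
proof -
  have "\<exists>M\<ge>0. \<forall>x. \<bar>pd b f x\<bar> \<le> M" if "b \<in> Basis" for b
    using bounded_continuous_compact_support[of "pd b f" R] smooth_continuous[OF smooth_pd[OF assms(1) that]]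
      pd_eq_0_outside[of R f, OF assms(2)] by metis
  then obtain M where M: "\<And>b. b \<in> Basis \<Longrightarrow> M b \<ge> 0" "\<And>b x. b \<in> Basis \<Longrightarrow> \<bar>pd b f x\<bar> \<le> M b"
    by metis
  define L where "L = sum M Basis"
  have L: "\<bar>frechet_derivative f (at x) h\<bar> \<le> L * norm h" for x h
  proof -
    have "frechet_derivative f (at x) h = (\<Sum>b\<in>Basis. (h \<bullet> b) * pd b f x)"
      by (rule linear_Basis_expansion[OF has_derivative_bounded_linear[OF smooth_has_derivative[OF assms(1)]]])
    also have "\<bar>\<dots>\<bar> \<le> (\<Sum>b\<in>Basis. \<bar>(h \<bullet> b) * pd b f x\<bar>)" by (rule sum_abs)
    also have "\<dots> \<le> (\<Sum>b\<in>Basis. norm h * M b)"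
      using M by (intro sum_mono) (auto simp: abs_mult Basis_le_norm intro!: mult_mono)
    finally show ?thesis by (simp add: L_def sum_distrib_left mult.commute)
  qed
  have "\<bar>f x - f y\<bar> \<le> L * norm (x - y)" for x y
  proof -
    have "onorm (frechet_derivative f (at x)) \<le> L" for x
      by (rule onorm_le) (use L in auto)
    then show ?thesis
      using differentiable_bound[of UNIV f "\<lambda>x. frechet_derivative f (at x)" L x y]
        smooth_has_derivative[OF assms(1)] by auto
  qed
  then show ?thesis using that[of L] L M by (simp add: L_def sum_nonneg)
qed

subsection \<open>Convolution with test functions\<close>

text \<open>The Borel counterpart of \<open>convolution\<close>, for which measurability in both
  variables and Tonelli's theorem are at hand.\<close>

definition conv :: "('a::euclidean_space \<Rightarrow> real) \<Rightarrow> ('a \<Rightarrow> real) \<Rightarrow> 'a \<Rightarrow> real" where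
  "conv \<psi> f x = (LBINT y. \<psi> (x - y) * f y)"

definition locint :: "('a::euclidean_space \<Rightarrow> real) \<Rightarrow> bool" where
  "locint f \<longleftrightarrow> f \<in> borel_measurable borel \<and>
     (\<forall>R. integrable lborel (\<lambda>y. indicator (cball 0 R) y * f y))"

lemma locint_measurable: "locint f \<Longrightarrow> f \<in> borel_measurable borel"
  by (simp add: locint_def)

lemma locint_mult:
  assumes "locint f" and [measurable]: "\<phi> \<in> borel_measurable borel"
    and "\<And>y. \<bar>\<phi> y\<bar> \<le> M" "\<And>y. norm y > R \<Longrightarrow> \<phi> y = 0"
  shows "integrable lborel (\<lambda>y. \<phi> y * f y)"
proof (rule Bochner_Integration.integrable_bound)
  show "integrable lborel (\<lambda>y. M * (indicator (cball 0 R) y * f y))"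
    using assms(1) unfolding locint_def by auto
  show "(\<lambda>y. \<phi> y * f y) \<in> borel_measurable lborel"
    using locint_measurable[OF assms(1)] by simp
  show "AE y in lborel. norm (\<phi> y * f y) \<le> norm (M * (indicator (cball 0 R) y * f y))"
  proof (rule AE_I2)
    fix y
    have "0 \<le> M" using assms(3)[of y] by linarith
    then show "norm (\<phi> y * f y) \<le> norm (M * (indicator (cball 0 R) y * f y))"
      using assms(3)[of y] assms(4)[of y]
      by (cases "norm y > R") (auto simp: abs_mult indicator_def intro!: mult_right_mono)
  qed
qed

lemma integrable_indicator_cball:
  "integrable lborel (indicator (cball 0 R) :: 'a::euclidean_space \<Rightarrow> real)"
  using emeasure_lborel_cball_finite[of "0::'a" R] by (intro integrable_real_indicator) auto

lemma continuous_compact_support_integrable: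
  fixes f :: "'a::euclidean_space \<Rightarrow> real"
  assumes "continuous_on UNIV f" "\<And>x. norm x > R \<Longrightarrow> f x = 0"
  shows "integrable lborel f"
proof -
  obtain M where M: "0 \<le> M" "\<And>x. \<bar>f x\<bar> \<le> M"
    using bounded_continuous_compact_support[OF assms] by blast
  have [measurable]: "f \<in> borel_measurable borel"
    using assms(1) by (rule borel_measurable_continuous_onI)
  show ?thesis
  proof (rule Bochner_Integration.integrable_bound)
    show "integrable lborel (\<lambda>x::'a. M * indicator (cball 0 R) x)"
      by (intro integrable_mult_right integrable_indicator_cball)
    show "AE y in lborel. norm (f y) \<le> norm (M * indicator (cball 0 R) y)"
      using M assms(2) by (intro AE_I2) (auto simp: indicator_def not_less[symmetric])
  qed auto
qed

section \<open>Reflection and translation invariance of Lebesgue measure\<close>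

lemma distr_reflect: "distr lborel borel (\<lambda>y. a - y) = (lborel :: 'a::euclidean_space measure)"
  by (subst lborel_affine[of "-1" a]) (auto simp: density_1 one_ennreal_def[symmetric])

lemma nn_integral_reflect:
  fixes f :: "'a::euclidean_space \<Rightarrow> ennreal"
  assumes [measurable]: "f \<in> borel_measurable borel"
  shows "(\<integral>\<^sup>+y. f (a - y) \<partial>lborel) = (\<integral>\<^sup>+y. f y \<partial>lborel)"
  by (subst (2) distr_reflect[of a, symmetric]) (simp add: nn_integral_distr)

lemma integral_reflect:
  fixes f :: "'a::euclidean_space \<Rightarrow> real"
  assumes [measurable]: "f \<in> borel_measurable borel"
  shows "(LBINT y. f (a - y)) = (LBINT y. f y)"
  by (subst (2) distr_reflect[of a, symmetric]) (simp add: integral_distr)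

lemma integrable_reflect:
  fixes f :: "'a::euclidean_space \<Rightarrow> real"
  assumes "integrable lborel f"
  shows "integrable lborel (\<lambda>y. f (a - y))"
proof -
  have [measurable]: "f \<in> borel_measurable borel" using assms by auto
  have "integrable (distr lborel borel (\<lambda>y. a - y)) f" using assms by (simp add: distr_reflect)
  then show ?thesis by (simp add: integrable_distr_eq)
qed

lemma integral_translate:
  fixes f :: "'a::euclidean_space \<Rightarrow> real"
  assumes [measurable]: "f \<in> borel_measurable borel"
  shows "(LBINT y. f (y + a)) = (LBINT y. f y)"
  by (subst (2) lborel_distr_plus[of a, symmetric]) (simp add: integral_distr add.commute)

lemma smooth_measurable: "smooth f \<Longrightarrow> f \<in> borel_measurable borel"
  using smooth_continuous borel_measurable_continuous_onI by blast

section \<open>Derivatives of convolutions, and the divergence theorem\<close>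

lemma conv_integrable:
  assumes "locint f" "continuous_on UNIV \<psi>" "\<And>x. norm x > R \<Longrightarrow> \<psi> x = 0"
  shows "integrable lborel (\<lambda>y. \<psi> (x - y) * f y)"
proof -
  obtain M where M: "0 \<le> M" "\<And>x. \<bar>\<psi> x\<bar> \<le> M"
    using bounded_continuous_compact_support[OF assms(2,3)] by blast
  have [measurable]: "\<psi> \<in> borel_measurable borel"
    using assms(2) by (rule borel_measurable_continuous_onI)
  show ?thesis
  proof (rule locint_mult[OF assms(1)])
    show "\<bar>\<psi> (x - y)\<bar> \<le> M" for y using M by blast
    show "\<psi> (x - y) = 0" if "norm y > norm x + R" for y
      using that norm_triangle_ineq2[of y x] by (intro assms(3)) (simp add: norm_minus_commute)
  qed simp
qed

text \<open>Differentiation under the integral sign. The remainder of \<psi> divided by the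
  increment is at most \<open>2 * L\<close> and vanishes outside one bounded set as long as the
  increments stay bounded, so local integrability of \<open>f\<close> supplies a majorant.\<close>

lemma conv_has_derivative:
  assumes f: "locint f" and \<psi>: "smooth \<psi>" and R: "\<And>x. norm x > R \<Longrightarrow> \<psi> x = 0"
  shows "(conv \<psi> f has_derivative (\<lambda>h. \<Sum>b\<in>Basis. (h \<bullet> b) * conv (pd b \<psi>) f x)) (at x)"
proof -
  obtain L where L: "0 \<le> L" "\<And>x h. \<bar>frechet_derivative \<psi> (at x) h\<bar> \<le> L * norm h"
    "\<And>x y. \<bar>\<psi> x - \<psi> y\<bar> \<le> L * norm (x - y)"
    using smooth_lipschitz[OF \<psi> R] by blast
  note d\<psi> = smooth_has_derivative[OF \<psi>]
  define P where "P b = pd b \<psi>" for b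
  note [measurable] = locint_measurable[OF f] smooth_measurable[OF \<psi>]
  have [measurable]: "P b \<in> borel_measurable borel" if "b \<in> Basis" for b
    unfolding P_def using smooth_measurable[OF smooth_pd[OF \<psi> that]] .
  have ci: "integrable lborel (\<lambda>y. \<psi> (z - y) * f y)" for z
    by (rule conv_integrable[OF f smooth_continuous[OF \<psi>] R])
  have cib: "integrable lborel (\<lambda>y. P b (z - y) * f y)" if "b \<in> Basis" for b z
    unfolding P_def by (rule conv_integrable[OF f smooth_continuous[OF smooth_pd[OF \<psi> that]] pd_eq_0_outside[of R, OF R]])
  have dexp: "frechet_derivative \<psi> (at z) h = (\<Sum>b\<in>Basis. (h \<bullet> b) * P b z)" for z h
    unfolding P_def by (rule linear_Basis_expansion[OF has_derivative_bounded_linear[OF d\<psi>]])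
  have cid: "integrable lborel (\<lambda>y. frechet_derivative \<psi> (at (x - y)) h * f y)" for h
    unfolding dexp sum_distrib_right mult.assoc
    by (intro Bochner_Integration.integrable_sum integrable_mult_right cib)
  have Fd: "(\<Sum>b\<in>Basis. (h \<bullet> b) * conv (P b) f x) = (LBINT y. frechet_derivative \<psi> (at (x - y)) h * f y)" for h
    unfolding dexp sum_distrib_right conv_def mult.assoc using cib
    by (subst Bochner_Integration.integral_sum) auto
  show ?thesis
    unfolding has_derivative_within P_def[symmetric]
  proof (intro conjI bounded_linear_sum bounded_linear_mult_left
      bounded_linear_compose[OF bounded_linear_mult_left] bounded_linear_inner_left)
    let ?q = "\<lambda>z y. (1 / norm (z - x)) *\<^sub>R (\<psi> (z - y) - (\<psi> (x - y) + frechet_derivative \<psi> (at (x - y)) (z - x)))"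
    have eq: "(1 / norm (z - x)) *\<^sub>R (conv \<psi> f z - (conv \<psi> f x + (\<Sum>b\<in>Basis. ((z - x) \<bullet> b) * conv (P b) f x)))
       = (LBINT y. ?q z y * f y)" for z
      unfolding Fd unfolding conv_def real_scaleR_def mult.assoc
      using ci cid by (simp add: algebra_simps)
    show "((\<lambda>z. (1 / norm (z - x)) *\<^sub>R (conv \<psi> f z - (conv \<psi> f x + (\<Sum>b\<in>Basis. ((z - x) \<bullet> b) * conv (P b) f x)))) \<longlongrightarrow> 0) (at x)"
      unfolding eq tendsto_at_iff_sequentially o_def
    proof (intro allI impI)
      fix Z :: "nat \<Rightarrow> 'a" assume Z: "\<forall>i. Z i \<in> UNIV - {x}" "Z \<longlonglongrightarrow> x"
      \<comment> \<open>Dominated convergence works along a sequence; a bound for it confines all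
        supports to the ball of radius \<open>B + R\<close>.\<close>
      from Z(2) have "Bseq Z" by (simp add: convergentI convergent_imp_Bseq)
      then obtain B where B: "\<And>i. norm (Z i) \<le> B" by (auto simp: Bseq_def)
      have xB: "norm x \<le> B" using LIMSEQ_le_const2[OF tendsto_norm[OF Z(2)]] B by blast
      have "(\<lambda>i. LBINT y. ?q (Z i) y * f y) \<longlonglongrightarrow> (\<integral>y. 0 \<partial>(lborel :: 'a measure))"
      proof (rule integral_dominated_convergence)
        show "integrable lborel (\<lambda>y. 2 * L * \<bar>indicator (cball 0 (B + R)) y * f y\<bar>)"
          using f unfolding locint_def by auto
        show "(\<lambda>y. ?q (Z i) y * f y) \<in> borel_measurable lborel" for i
          unfolding dexp by simp
        show "AE y in lborel. norm (?q (Z i) y * f y) \<le> 2 * L * \<bar>indicator (cball 0 (B + R)) y * f y\<bar>" for i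
        proof (rule AE_I2)
          fix y
          have nz: "norm (Z i - x) > 0" using Z(1) by simp
          have "norm (?q (Z i) y) \<le> 2 * L"
          proof -
            have "\<bar>\<psi> (Z i - y) - \<psi> (x - y)\<bar> \<le> L * norm (Z i - x)"
              using L(3)[of "Z i - y" "x - y"] by simp
            then have "\<bar>\<psi> (Z i - y) - (\<psi> (x - y) + frechet_derivative \<psi> (at (x - y)) (Z i - x))\<bar>
                \<le> 2 * L * norm (Z i - x)"
              using L(2)[of "x - y" "Z i - x"] by (simp add: abs_le_iff)
            then show ?thesis using nz by (simp add: pos_divide_le_eq)
          qed
          moreover have "?q (Z i) y = 0" if "norm y > B + R"
          proof -
            have "norm (Z i - y) > R" "norm (x - y) > R"
              using that B[of i] xB norm_triangle_ineq2[of y x] norm_triangle_ineq2[of y "Z i"]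
              by (auto simp: norm_minus_commute)
            then show ?thesis
              unfolding dexp using R pd_eq_0_outside[of R \<psi>, OF R] by (simp add: P_def)
          qed
          moreover have "norm (c * f y) \<le> 2 * L * \<bar>indicator (cball 0 (B + R)) y * f y\<bar>"
            if "norm c \<le> 2 * L" "norm y > B + R \<Longrightarrow> c = 0" for c :: real
            using that by (cases "norm y > B + R") (auto simp: abs_mult mult_right_mono)
          ultimately show "norm (?q (Z i) y * f y) \<le> 2 * L * \<bar>indicator (cball 0 (B + R)) y * f y\<bar>"
            by blast
        qed
        show "AE y in lborel. (\<lambda>i. ?q (Z i) y * f y) \<longlonglongrightarrow> 0"
        proof (rule AE_I2)
          fix y
          have "((\<lambda>w. (1 / norm (w - (x - y))) *\<^sub>R (\<psi> w - (\<psi> (x - y) + frechet_derivative \<psi> (at (x - y)) (w - (x - y))))) \<longlongrightarrow> 0) (at (x - y))"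
            using d\<psi>[of "x - y"] unfolding has_derivative_within by blast
          moreover have "(\<lambda>i. Z i - y) \<longlonglongrightarrow> x - y" using Z(2) by (intro tendsto_intros)
          moreover have "\<forall>i. Z i - y \<in> UNIV - {x - y}" using Z(1) by auto
          ultimately have "(\<lambda>i. ?q (Z i) y) \<longlonglongrightarrow> 0"
            unfolding tendsto_at_iff_sequentially o_def by force
          then show "(\<lambda>i. ?q (Z i) y * f y) \<longlonglongrightarrow> 0" by (rule tendsto_mult_left_zero)
        qed
      qed auto
      then show "(\<lambda>i. LBINT y. ?q (Z i) y * f y) \<longlonglongrightarrow> 0" by simp
    qed
  qed
qed

lemma pd_conv:
  assumes "locint f" "smooth \<psi>" "\<And>x. norm x > R \<Longrightarrow> \<psi> x = 0" "b \<in> Basis"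
  shows "pd b (conv \<psi> f) = conv (pd b \<psi>) f"
proof
  fix x
  have "pd b (conv \<psi> f) x = (\<Sum>c\<in>Basis. (b \<bullet> c) * conv (pd c \<psi>) f x)"
    by (rule pd_eqI[OF conv_has_derivative[OF assms(1-3)]])
  also have "\<dots> = (\<Sum>c\<in>Basis. if c = b then conv (pd b \<psi>) f x else 0)"
    using assms(4) by (intro sum.cong) (auto simp: inner_Basis)
  finally show "pd b (conv \<psi> f) x = conv (pd b \<psi>) f x"
    using assms(4) by simp
qed

lemma Ck_conv:
  assumes "locint f" "smooth \<psi>" "\<And>x. norm x > R \<Longrightarrow> \<psi> x = 0"
  shows "Ck k (conv \<psi> f)"
  using assms(2,3)
proof (induction k arbitrary: \<psi>)
  case 0
  have "conv \<psi> f differentiable (at x)" for x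
    using conv_has_derivative[OF assms(1) 0] differentiableI by blast
  then show ?case by (simp add: differentiable_imp_continuous_on differentiable_on_def)
next
  case (Suc k)
  have "conv \<psi> f differentiable (at x)" for x
    using conv_has_derivative[OF assms(1) Suc.prems] differentiableI by blast
  moreover have "Ck k (conv (pd b \<psi>) f)" if "b \<in> Basis" for b
    by (rule Suc.IH[OF smooth_pd[OF Suc.prems(1) that] pd_eq_0_outside[of R, OF Suc.prems(2)]])
  ultimately show ?case
    using pd_conv[OF assms(1) Suc.prems] by (simp add: differentiable_on_def)
qed

text \<open>As a function of \<open>y\<close>, the reflected kernel \<open>\<psi> (x - y)\<close> is
  itself a test function. The sign from differentiating the reflection cancels the sign in the weak
  derivative.\<close>

lemma conv_weak_derivative:
  assumes w: "\<And>\<phi>. \<phi> \<in> test_functions \<Longrightarrow> (LBINT x. u x * pd b \<phi> x) = - (LBINT x. g x * \<phi> x)"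
    and "smooth \<psi>" "\<And>x. norm x > R \<Longrightarrow> \<psi> x = 0"
  shows "conv (pd b \<psi>) u x = conv \<psi> g x"
proof -
  have "(\<lambda>y. \<psi> (x - y)) \<in> test_functions"
  proof (rule test_functionsI[where R="norm x + R"])
    show "smooth (\<lambda>y. \<psi> (x - y))" using assms(2) Ck_reflect by blast
    show "\<psi> (x - y) = 0" if "norm y > norm x + R" for y
      using that norm_triangle_ineq2[of y x] by (intro assms(3)) (simp add: norm_minus_commute)
  qed
  from w[OF this] show ?thesis
    unfolding pd_reflect[OF assms(2)] conv_def by (simp add: mult.commute)
qed

text \<open>The difference quotients in direction \<open>b\<close> have integral 0 by translation
  invariance, and dominated convergence passes this on to the derivative. It serves as the
  divergence theorem.\<close>

lemma integral_directional_derivative_eq_0: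
  fixes f :: "'a::euclidean_space \<Rightarrow> real"
  assumes d: "\<And>x. (f has_derivative f' x) (at x)" and c: "continuous_on UNIV (\<lambda>x. f' x b)"
    and R: "\<And>x. norm x > R \<Longrightarrow> f x = 0"
  shows "(LBINT x. f' x b) = 0"
proof -
  have fc: "continuous_on UNIV f"
    by (intro continuous_at_imp_continuous_on ballI) (rule has_derivative_continuous[OF d])
  note [measurable] = borel_measurable_continuous_onI[OF fc] borel_measurable_continuous_onI[OF c]
  have fi: "integrable lborel f" by (rule continuous_compact_support_integrable[OF fc R])
  have fti: "integrable lborel (\<lambda>x. f (x + a))" for a
    using integrable_reflect[OF integrable_reflect[OF fi, of "a"], of 0] by (simp add: add.commute)
  have f'0: "f' x b = 0" if "norm x > R" for x
  proof -
    have "pd b f x = 0" by (rule pd_eq_0_outside[of R, OF R that])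
    then show ?thesis using pd_eqI[OF d] by metis
  qed
  obtain M where M: "0 \<le> M" "\<And>x. \<bar>f' x b\<bar> \<le> M"
    using bounded_continuous_compact_support[OF c f'0] by blast
  have dl: "((\<lambda>t. f (x + t *\<^sub>R b)) has_real_derivative f' (x + t *\<^sub>R b) b) (at t)" for x t
  proof -
    have "((\<lambda>t. x + t *\<^sub>R b) has_vector_derivative b) (at t)"
      by (auto intro!: derivative_eq_intros)
    then have "((\<lambda>t. f (x + t *\<^sub>R b)) has_derivative (\<lambda>h. f' (x + t *\<^sub>R b) (h *\<^sub>R b))) (at t)"
      by (intro has_derivative_compose[where f="\<lambda>t. x + t *\<^sub>R b" and g=f, OF _ d]) (auto intro!: derivative_eq_intros)
    moreover have "f' (x + t *\<^sub>R b) (h *\<^sub>R b) = f' (x + t *\<^sub>R b) b * h" for h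
      using linear_scale[OF has_derivative_linear[OF d]] by (simp add: mult.commute)
    ultimately show ?thesis by (simp add: has_field_derivative_def)
  qed
  define h where "h n = 1 / real (Suc n)" for n
  have h: "0 < h n" "h n \<le> 1" for n by (auto simp: h_def)
  define q where "q n x = (f (x + h n *\<^sub>R b) - f x) / h n" for n x
  have "(\<lambda>n. LBINT x. q n x) \<longlonglongrightarrow> (LBINT x. f' x b)"
  proof (rule integral_dominated_convergence)
    show "integrable lborel (\<lambda>x::'a. M * indicator (cball 0 (R + norm b)) x)"
      by (intro integrable_mult_right integrable_indicator_cball)
    show "AE x in lborel. (\<lambda>n. q n x) \<longlonglongrightarrow> f' x b"
    proof (rule AE_I2)
      fix x
      have "((\<lambda>t. (f (x + t *\<^sub>R b) - f x) / t) \<longlongrightarrow> f' x b) (at 0)"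
        using dl[of x 0] by (simp add: DERIV_def)
      moreover have "h \<longlonglongrightarrow> 0" unfolding h_def using LIMSEQ_inverse_real_of_nat by (simp add: inverse_eq_divide)
      moreover have "h n \<noteq> 0" for n using h(1)[of n] by simp
      ultimately show "(\<lambda>n. q n x) \<longlonglongrightarrow> f' x b"
        unfolding tendsto_at_iff_sequentially o_def q_def by simp
    qed
    show "AE x in lborel. norm (q n x) \<le> M * indicator (cball 0 (R + norm b)) x" for n
    proof (rule AE_I2)
      fix x
      \<comment> \<open>The mean value theorem bounds all quotients by the bound \<open>M\<close> on
        the derivative; steps of length at most \<open>norm b\<close> enlarge the support to radius
        \<open>R + norm b\<close>.\<close>
      obtain z where "f (x + h n *\<^sub>R b) - f (x + 0 *\<^sub>R b) = (h n - 0) * f' (x + z *\<^sub>R b) b"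
        using MVT2[OF h(1)[of n], of "\<lambda>t. f (x + t *\<^sub>R b)" "\<lambda>t. f' (x + t *\<^sub>R b) b"] dl by blast
      then have "\<bar>q n x\<bar> \<le> M" using M(2) h(1)[of n] by (simp add: q_def)
      moreover have "q n x = 0" if "norm x > R + norm b"
      proof -
        have "norm (h n *\<^sub>R b) \<le> norm b" using h[of n] by (simp add: mult_left_le_one_le)
        then have "norm (x + h n *\<^sub>R b) > R" using that norm_diff_ineq[of x "h n *\<^sub>R b"] by linarith
        moreover have "norm x > R" using that norm_ge_zero[of b] by linarith
        ultimately show ?thesis using R by (simp add: q_def)
      qed
      ultimately show "norm (q n x) \<le> M * indicator (cball 0 (R + norm b)) x"
        by (cases "norm x > R + norm b") (auto simp: indicator_def)
    qed
  qed (auto simp: q_def)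
  moreover have "(LBINT x. q n x) = 0" for n
    unfolding q_def using fi fti by (simp add: integral_translate)
  ultimately show ?thesis by (simp add: LIMSEQ_const_iff)
qed

subsection \<open>Mollification in local Lebesgue spaces\<close>

text \<open>The radius is \<open>1 / (n + 1)\<close>, since the scale is
  \<open>(n + 1)\<^sup>2\<close>. The shift by 1 admits \<open>n = 0\<close> and keeps every radius
  at most 1.\<close>

definition moll :: "nat \<Rightarrow> 'a::euclidean_space \<Rightarrow> real" where
  "moll n x = bump 0 ((real n + 1)\<^sup>2) x / (LBINT y. bump 0 ((real n + 1)\<^sup>2) (y::'a))"

lemma bump_continuous: "continuous_on UNIV (bump j \<kappa>)"
  using Ck_bump[of 0] by (simp only: Ck.simps)

lemma bump_measurable [measurable]: "bump j \<kappa> \<in> borel_measurable borel"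
  by (rule borel_measurable_continuous_onI[OF bump_continuous])

lemma bump_support:
  assumes "0 < r" "norm x \<ge> 1 / r" shows "bump j (r\<^sup>2) x = 0"
proof (rule bump_eq_0)
  have "1 \<le> r * norm x" using assms by (simp add: field_simps)
  then have "1 \<le> (r * norm x)\<^sup>2" by (simp add: one_le_power)
  then show "1 \<le> r\<^sup>2 * (x \<bullet> x)" by (simp add: power_mult_distrib power2_norm_eq_inner)
qed (use assms in simp)

lemma bump_integrable:
  assumes "0 < r" shows "integrable lborel (bump j (r\<^sup>2))"
  by (rule continuous_compact_support_integrable[OF bump_continuous, of "1 / r"])
     (rule bump_support[OF assms], simp)

lemma bump_integral_pos:
  assumes "0 < r" shows "0 < (LBINT y. bump j (r\<^sup>2) (y::'a::euclidean_space))"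
proof -
  have "(LBINT y. bump j (r\<^sup>2) (y::'a)) \<noteq> 0"
  proof
    assume "(LBINT y. bump j (r\<^sup>2) (y::'a)) = 0"
    then have "AE y in lborel. bump j (r\<^sup>2) (y::'a) = 0"
      by (subst (asm) integral_nonneg_eq_0_iff_AE[OF bump_integrable[OF assms]]) (auto simp: bump_nonneg)
    moreover have "bump j (r\<^sup>2) y \<noteq> 0" if "y \<in> ball 0 (1 / r)" for y :: 'a
    proof -
      have "r * norm y < 1" using that assms by (simp add: field_simps)
      then have "(r * norm y)\<^sup>2 < 1" using assms by (simp add: power_less_one_iff abs_square_less_1)
      then show ?thesis by (simp add: power_mult_distrib power2_norm_eq_inner bump_def flat_def)
    qed
    ultimately have "AE y in lborel. (y::'a) \<notin> ball 0 (1 / r)" by auto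
    then have "emeasure lborel (ball (0::'a) (1 / r)) = 0"
      by (subst (asm) AE_iff_measurable[of "ball 0 (1 / r)"]) auto
    moreover have "emeasure lborel (ball (0::'a) (1 / r)) \<noteq> 0"
      using assms content_ball_pos[of "1 / r" "0::'a"] by (auto simp: measure_def)
    ultimately show False by simp
  qed
  then show ?thesis
    using integral_nonneg_AE[OF AE_I2, of lborel "bump j (r\<^sup>2) :: 'a \<Rightarrow> real"] by (auto simp: bump_nonneg less_le)
qed

lemma smooth_moll: "smooth (moll n)"
proof
  fix k
  have "Ck k (\<lambda>x::'a. (1 / (LBINT y. bump 0 ((real n + 1)\<^sup>2) (y::'a))) * bump 0 ((real n + 1)\<^sup>2) x)"
    by (intro Ck_mult Ck_const Ck_bump)
  then show "Ck k (moll n :: 'a \<Rightarrow> real)" by (simp add: moll_def[abs_def])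
qed

lemma moll_support: "norm x > 1 / (real n + 1) \<Longrightarrow> moll n x = 0"
  using bump_support[of "real n + 1" x 0] by (simp add: moll_def)

lemma moll_nonneg: "0 \<le> moll n x"
  unfolding moll_def by (intro divide_nonneg_nonneg bump_nonneg integral_nonneg_AE AE_I2)

lemma moll_measurable [measurable]: "moll n \<in> borel_measurable borel"
  by (rule smooth_measurable[OF smooth_moll])

lemma moll_conv_integrable: "locint f \<Longrightarrow> integrable lborel (\<lambda>y. moll n (x - y) * f y)"
  by (rule conv_integrable[OF _ smooth_continuous[OF smooth_moll], of _ "1 / (real n + 1)"])
     (auto intro: moll_support)

lemma moll_integrable: "integrable lborel (moll n)"
  unfolding moll_def using bump_integrable[of "real n + 1"] by auto

lemma moll_integral: "(LBINT x. moll n (x::'a::euclidean_space)) = 1"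
  unfolding moll_def using bump_integral_pos[of "real n + 1" 0, where 'a='a] by simp

lemma pd_pd_moll_commute:
  assumes "b \<in> Basis" "c \<in> Basis"
  shows "pd c (pd b (moll n)) x = pd b (pd c (moll n)) x"
proof -
  define C where "C = (LBINT y. bump 0 ((real n + 1)\<^sup>2) (y::'a))"
  have C: "C \<noteq> 0" unfolding C_def using bump_integral_pos[of "real n + 1" 0, where 'a='a] by simp
  have cm: "pd b (\<lambda>x. f x / C) x = pd b f x / C" if "smooth f" for b x and f :: "'a \<Rightarrow> real"
  proof -
    have "((\<lambda>x. f x / C) has_derivative (\<lambda>h. frechet_derivative f (at x) h / C)) (at x)"
      by (rule bounded_linear.has_derivative[OF bounded_linear_divide smooth_has_derivative[OF that]])
    then show "pd b (\<lambda>x. f x / C) x = pd b f x / C" by (rule pd_eqI)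
  qed
  have sb: "smooth (bump 0 ((real n + 1)\<^sup>2) :: 'a \<Rightarrow> real)" using Ck_bump by blast
  have m: "moll n = (\<lambda>x::'a. bump 0 ((real n + 1)\<^sup>2) x / C)" by (simp add: moll_def C_def fun_eq_iff)
  have *: "pd c (pd b (moll n)) x = pd c (pd b (bump 0 ((real n + 1)\<^sup>2))) x / C" if "b \<in> Basis" for b c
    unfolding m cm[OF sb] cm[OF smooth_pd[OF sb that]] ..
  show ?thesis by (simp add: *[OF assms(1)] *[OF assms(2)] pd_pd_bump_commute)
qed

text \<open>The convex function \<open>t powr q\<close> lies above its tangent at \<open>s\<close>.
  For positive arguments this is Young's inequality with weights \<open>1 / q\<close> and
  \<open>1 - 1 / q\<close>, rearranged; zero arguments are checked separately.\<close>

lemma powr_tangent: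
  fixes s t q :: real
  assumes "1 < q" "0 \<le> s" "0 \<le> t"
  shows "s powr q + q * s powr (q - 1) * (t - s) \<le> t powr q"
proof (cases "s = 0 \<or> t = 0")
  case True
  have "s powr q = s powr (q - 1) * s"
    using assms by (cases "s = 0") (auto simp flip: powr_add powr_mult_base simp: powr_diff)
  moreover have "s powr (q - 1) * s \<ge> 0" using assms by simp
  ultimately show ?thesis using True assms
    using mult_right_mono[of 1 q "s powr (q - 1) * s"] by (auto simp: algebra_simps)
next
  case False
  then have "t * s powr (q - 1) \<le> 1 / q * t powr q + (1 - 1 / q) * s powr q"
    using Youngs_inequality_0[of "1 / q" "1 - 1 / q" "t powr q" "s powr q"] assms
    by (simp add: powr_powr right_diff_distrib)
  then have "q * (t * s powr (q - 1)) \<le> q * (1 / q * t powr q + (1 - 1 / q) * s powr q)"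
    using assms by (intro mult_left_mono) auto
  also have "\<dots> = t powr q + (q - 1) * s powr q" using assms by (simp add: field_simps)
  finally have "q * (t * s powr (q - 1)) \<le> t powr q + (q - 1) * s powr q" .
  moreover have "s powr q = s powr (q - 1) * s"
    using False assms by (simp add: powr_diff)
  ultimately show ?thesis by (simp add: algebra_simps)
qed

text \<open>The sum is at most three times the largest term. Two-term versions arise by setting one
  summand to 0.\<close>

lemma powr_sum3:
  fixes q :: real
  assumes "0 \<le> q"
  shows "\<bar>a + b + c\<bar> powr q \<le> 3 powr q * (\<bar>a\<bar> powr q + \<bar>b\<bar> powr q + \<bar>c\<bar> powr q)"
proof -
  define m where "m = max \<bar>a\<bar> (max \<bar>b\<bar> \<bar>c\<bar>)"
  have "\<bar>a + b + c\<bar> powr q \<le> (3 * m) powr q"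
    using assms by (intro powr_mono2) (auto simp: m_def)
  also have "\<dots> = 3 powr q * m powr q" by (simp add: powr_mult m_def)
  also have "m powr q \<le> \<bar>a\<bar> powr q + \<bar>b\<bar> powr q + \<bar>c\<bar> powr q"
    unfolding m_def by (auto simp: max_def add_increasing add_increasing2)
  finally show ?thesis by simp
qed

lemma le_1_powr: "0 \<le> (t::real) \<Longrightarrow> 1 \<le> q \<Longrightarrow> t \<le> 1 + t powr q"
  using powr_mono[of 1 q t] by (cases "t \<le> 1") (auto simp: add_increasing2)

text \<open>Integrate the tangent inequality at \<open>s\<close>, the weighted mean of
  \<open>\<bar>f\<bar>\<close>: its linear term has integral 0.\<close>

lemma jensen_powr:
  fixes w f :: "'a \<Rightarrow> real" and q :: real
  assumes q: "1 < q" and w: "\<And>x. 0 \<le> w x" "integrable M w" "(\<integral>x. w x \<partial>M) = 1"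
    and wf: "integrable M (\<lambda>x. w x * f x)" and wq: "integrable M (\<lambda>x. w x * \<bar>f x\<bar> powr q)"
  shows "\<bar>\<integral>x. w x * f x \<partial>M\<bar> powr q \<le> (\<integral>x. w x * \<bar>f x\<bar> powr q \<partial>M)"
proof -
  have wa: "integrable M (\<lambda>x. w x * \<bar>f x\<bar>)"
    using integrable_abs[OF wf] w(1) by (simp add: abs_mult)
  define s where "s = (\<integral>x. w x * \<bar>f x\<bar> \<partial>M)"
  have s: "0 \<le> s" unfolding s_def using w(1) by (intro integral_nonneg_AE) auto
  have "\<bar>\<integral>x. w x * f x \<partial>M\<bar> \<le> s"
    unfolding s_def using integral_abs_bound[of M "\<lambda>x. w x * f x"] w(1) by (simp add: abs_mult)
  then have "\<bar>\<integral>x. w x * f x \<partial>M\<bar> powr q \<le> s powr q" using q by (intro powr_mono2) auto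
  also have "\<dots> = (\<integral>x. s powr q * w x + q * s powr (q - 1) * (w x * \<bar>f x\<bar> - s * w x) \<partial>M)"
    using w wa by (simp add: s_def[symmetric])
  also have "\<dots> \<le> (\<integral>x. w x * \<bar>f x\<bar> powr q \<partial>M)"
  proof (rule integral_mono)
    fix x
    show "s powr q * w x + q * s powr (q - 1) * (w x * \<bar>f x\<bar> - s * w x) \<le> w x * \<bar>f x\<bar> powr q"
      using mult_left_mono[OF powr_tangent[OF q s, of "\<bar>f x\<bar>"] w(1)[of x]] by (simp add: algebra_simps)
  qed (use w wa wq in auto)
  finally show ?thesis .
qed

section \<open>Contraction and convergence of mollifiers in Lebesgue spaces\<close>

lemma integrable_measurable_ennreal:
  fixes f :: "'a \<Rightarrow> real"
  shows "integrable M f \<Longrightarrow> (\<lambda>x. ennreal (f x)) \<in> borel_measurable M"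
  by (rule measurable_compose[OF borel_measurable_integrable measurable_ennreal])

lemma integrable_indicator_mult:
  fixes f :: "'a::euclidean_space \<Rightarrow> real"
  assumes "integrable lborel f"
  shows "integrable lborel (\<lambda>x. indicator (cball 0 R) x * f x)"
  using integrable_real_mult_indicator[OF _ assms, of "cball 0 R"] by (simp add: mult.commute)

lemma locint_of_powr:
  fixes f :: "'a::euclidean_space \<Rightarrow> real" and q :: real
  assumes [measurable]: "f \<in> borel_measurable borel" and "1 \<le> q"
    and "\<And>R. integrable lborel (\<lambda>x. indicator (cball 0 R) x * \<bar>f x\<bar> powr q)"
  shows "locint f"
  unfolding locint_def
proof (intro conjI allI)
  fix R
  show "integrable lborel (\<lambda>y. indicator (cball 0 R) y * f y)"
  proof (rule Bochner_Integration.integrable_bound)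
    show "integrable lborel (\<lambda>x. indicator (cball 0 R) x + indicator (cball 0 R) x * \<bar>f x\<bar> powr q)"
      by (intro Bochner_Integration.integrable_add assms(3) integrable_indicator_cball)
    show "AE x in lborel. norm (indicator (cball 0 R) x * f x)
        \<le> norm (indicator (cball 0 R) x + indicator (cball 0 R) x * \<bar>f x\<bar> powr q)"
      using le_1_powr[OF _ assms(2)] by (intro AE_I2) (auto simp: indicator_def)
  qed (simp, intro borel_measurable_times borel_measurable_indicator assms(1), simp)
qed fact

lemma nn_integral_translate:
  fixes f :: "'a::euclidean_space \<Rightarrow> ennreal"
  assumes [measurable]: "f \<in> borel_measurable borel"
  shows "(\<integral>\<^sup>+y. f (y + a) \<partial>lborel) = (\<integral>\<^sup>+y. f y \<partial>lborel)"
  by (subst (2) lborel_distr_plus[of a, symmetric]) (simp add: nn_integral_distr add.commute)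

text \<open>Jensen's inequality for the probability density \<open>moll n (x - y)\<close> in
  \<open>y\<close>, then Tonelli, because that density has mass 1 in \<open>x\<close> as
  well.\<close>

lemma conv_moll_Lq_le:
  fixes f :: "'a::euclidean_space \<Rightarrow> real"
  assumes [measurable]: "f \<in> borel_measurable borel" and q: "1 < q"
    and fq: "integrable lborel (\<lambda>x. \<bar>f x\<bar> powr q)"
  shows "(\<integral>\<^sup>+x. \<bar>conv (moll n) f x\<bar> powr q \<partial>lborel) \<le> (\<integral>\<^sup>+x. \<bar>f x\<bar> powr q \<partial>lborel)"
proof -
  have lf: "locint f" by (rule locint_of_powr[of f q]) (use q integrable_indicator_mult[OF fq] in auto)
  have lfq: "locint (\<lambda>x. \<bar>f x\<bar> powr q)"
    unfolding locint_def using integrable_indicator_mult[OF fq] by auto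
  have "(\<integral>\<^sup>+x. \<bar>conv (moll n) f x\<bar> powr q \<partial>lborel) \<le> (\<integral>\<^sup>+x. \<integral>\<^sup>+y. moll n (x - y) * \<bar>f y\<bar> powr q \<partial>lborel \<partial>lborel)"
  proof (rule nn_integral_mono)
    fix x
    have "\<bar>conv (moll n) f x\<bar> powr q \<le> (LBINT y. moll n (x - y) * \<bar>f y\<bar> powr q)"
      unfolding conv_def
      by (rule jensen_powr[OF q moll_nonneg integrable_reflect[OF moll_integrable] _
          moll_conv_integrable[OF lf] moll_conv_integrable[OF lfq]])
         (auto simp: integral_reflect moll_integral)
    also have "ennreal \<dots> = (\<integral>\<^sup>+y. moll n (x - y) * \<bar>f y\<bar> powr q \<partial>lborel)"
      by (rule nn_integral_eq_integral[symmetric, OF moll_conv_integrable[OF lfq]])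
         (intro AE_I2 mult_nonneg_nonneg moll_nonneg, simp)
    finally show "ennreal (\<bar>conv (moll n) f x\<bar> powr q) \<le> \<dots>" by (simp add: ennreal_leI)
  qed
  also have "\<dots> = (\<integral>\<^sup>+y. \<integral>\<^sup>+x. moll n (x - y) * \<bar>f y\<bar> powr q \<partial>lborel \<partial>lborel)"
    by (rule lborel_pair.Fubini') measurable
  also have "\<dots> = (\<integral>\<^sup>+y. \<bar>f y\<bar> powr q \<partial>lborel)"
  proof (rule nn_integral_cong)
    fix y
    have "(\<integral>\<^sup>+x. moll n (x - y) * \<bar>f y\<bar> powr q \<partial>lborel) = (\<integral>\<^sup>+x. ennreal (moll n (x - y)) \<partial>lborel) * \<bar>f y\<bar> powr q"
      by (simp add: ennreal_mult' moll_nonneg nn_integral_multc)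
    also have "(\<integral>\<^sup>+x. ennreal (moll n (x - y)) \<partial>lborel) = (\<integral>\<^sup>+x. ennreal (moll n (x::'a)) \<partial>lborel)"
      using nn_integral_translate[of "\<lambda>x. ennreal (moll n x)" "- y"] by simp
    also have "\<dots> = 1"
      by (subst nn_integral_eq_integral[OF moll_integrable]) (auto simp: moll_nonneg moll_integral)
    finally show "(\<integral>\<^sup>+x. moll n (x - y) * \<bar>f y\<bar> powr q \<partial>lborel) = \<bar>f y\<bar> powr q" by simp
  qed
  finally show ?thesis .
qed

text \<open>Used with \<open>a = g x\<close> for boundedness and pointwise convergence, and with
  \<open>a = 0\<close>, \<open>M = 0\<close> to locate the support of the mollified
  function.\<close>

lemma conv_moll_abs_le:
  fixes g :: "'a::euclidean_space \<Rightarrow> real"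
  assumes "locint g" and M: "\<And>y. norm (x - y) \<le> 1 / (real n + 1) \<Longrightarrow> \<bar>g y - a\<bar> \<le> M"
  shows "\<bar>conv (moll n) g x - a\<bar> \<le> M"
proof -
  note i1 = moll_conv_integrable[OF assms(1), where n=n and x=x]
  note i2 = integrable_reflect[OF moll_integrable, where a=x and n1=n]
  have m1: "(LBINT y. moll n (x - y)) = 1" by (simp add: integral_reflect moll_integral)
  have "conv (moll n) g x - a = (LBINT y. moll n (x - y) * g y - a * moll n (x - y))"
    unfolding conv_def using i1 i2 m1 by simp
  also have "\<bar>\<dots>\<bar> \<le> (LBINT y. M * moll n (x - y))"
  proof (rule integral_abs_bound_integral)
    fix y
    show "\<bar>moll n (x - y) * g y - a * moll n (x - y)\<bar> \<le> M * moll n (x - y)"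
    proof (cases "norm (x - y) \<le> 1 / (real n + 1)")
      case True
      have "\<bar>moll n (x - y) * g y - a * moll n (x - y)\<bar> = \<bar>g y - a\<bar> * moll n (x - y)"
      proof -
        have "moll n (x - y) * g y - a * moll n (x - y) = (g y - a) * moll n (x - y)"
          by (simp add: algebra_simps)
        then show ?thesis using moll_nonneg[of n "x - y"] by (simp add: abs_mult)
      qed
      then show ?thesis using M[OF True] by (simp add: mult_right_mono moll_nonneg)
    qed (simp add: moll_support)
  qed (use i1 i2 in auto)
  also have "\<dots> = M" using m1 by simp
  finally show ?thesis .
qed

lemma conv_measurable [measurable]:
  assumes [measurable]: "\<psi> \<in> borel_measurable borel" "f \<in> borel_measurable borel"
  shows "conv \<psi> f \<in> borel_measurable borel"
  unfolding conv_def[abs_def] by measurable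

lemma conv_diff:
  assumes "locint f" "locint g"
  shows "conv (moll n) (\<lambda>x. f x - g x) x = conv (moll n) f x - conv (moll n) g x"
  unfolding conv_def right_diff_distrib
  by (intro Bochner_Integration.integral_diff moll_conv_integrable assms)

lemma conv_moll_continuous_tendsto:
  fixes g :: "'a::euclidean_space \<Rightarrow> real"
  assumes g: "continuous_on UNIV g" and R: "\<And>x. norm x > R \<Longrightarrow> g x = 0" and q: "1 < q"
  shows "(\<lambda>n. \<integral>\<^sup>+x. \<bar>conv (moll n) g x - g x\<bar> powr q \<partial>lborel) \<longlonglongrightarrow> 0"
proof -
  note [measurable] = borel_measurable_continuous_onI[OF g]
  have lg: "locint g"
    unfolding locint_def using integrable_indicator_mult[OF continuous_compact_support_integrable[OF g R]] by auto
  obtain M where M: "0 \<le> M" "\<And>x. \<bar>g x\<bar> \<le> M"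
    using bounded_continuous_compact_support[OF g R] by blast
  have "(\<lambda>n. \<integral>\<^sup>+x. \<bar>conv (moll n) g x - g x\<bar> powr q \<partial>lborel) \<longlonglongrightarrow> (\<integral>\<^sup>+x. 0 \<partial>(lborel :: 'a measure))"
  proof (rule nn_integral_dominated_convergence)
    let ?w = "\<lambda>x. (2 * M) powr q * indicator (cball (0::'a) (R + 1)) x"
    have "integrable lborel ?w" by (intro integrable_mult_right integrable_indicator_cball)
    then show "(\<integral>\<^sup>+x. ennreal (?w x) \<partial>lborel) < \<infinity>"
      using nn_integral_eq_integral[of lborel ?w] by simp
    show "AE x in lborel. ennreal (\<bar>conv (moll n) g x - g x\<bar> powr q) \<le> ennreal (?w x)" for n
    proof (intro AE_I2 ennreal_leI)
      fix x
      show "\<bar>conv (moll n) g x - g x\<bar> powr q \<le> ?w x"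
      proof (cases "norm x > R + 1")
        case True
        have "\<bar>conv (moll n) g x - 0\<bar> \<le> 0"
        proof (rule conv_moll_abs_le[OF lg])
          fix y assume "norm (x - y) \<le> 1 / (real n + 1)"
          also have "\<dots> \<le> 1" by simp
          finally have "norm y > R" using True norm_triangle_ineq2[of x y] by linarith
          then show "\<bar>g y - 0\<bar> \<le> 0" using R by simp
        qed
        then show ?thesis using True R[of x] by simp
      next
        case False
        have "\<bar>conv (moll n) g x - g x\<bar> \<le> 2 * M"
          by (rule conv_moll_abs_le[OF lg]) (use M(2)[of x] M(2) in \<open>smt (verit)\<close>)
        then show ?thesis using False q by (auto intro: powr_mono2)
      qed
    qed
    show "AE x in lborel. (\<lambda>n. ennreal (\<bar>conv (moll n) g x - g x\<bar> powr q)) \<longlonglongrightarrow> 0"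
    proof (rule AE_I2)
      fix x
      have "(\<lambda>n. conv (moll n) g x) \<longlonglongrightarrow> g x"
      proof (rule LIMSEQ_I)
        fix e :: real assume "0 < e"
        then obtain d where d: "0 < d" "\<And>y. dist y x < d \<Longrightarrow> dist (g y) (g x) < e / 2"
          using g by (metis continuous_on_eq_continuous_at half_gt_zero continuous_at_eps_delta open_UNIV UNIV_I)
        obtain k where k: "1 / real (Suc k) < d" using nat_approx_posE[OF d(1)] by blast
        have "norm (conv (moll n) g x - g x) < e" if "n \<ge> k" for n
        proof -
          have "1 / (real n + 1) \<le> 1 / real (Suc k)" using that by (intro divide_left_mono) auto
          then have "norm (x - y) \<le> 1 / (real n + 1) \<Longrightarrow> \<bar>g y - g x\<bar> < e / 2" for y
            using d(2)[of y] k by (simp add: dist_norm norm_minus_commute)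
          then have "\<bar>conv (moll n) g x - g x\<bar> \<le> e / 2"
            by (intro conv_moll_abs_le[OF lg]) (simp add: less_imp_le)
          then show ?thesis using \<open>0 < e\<close> by simp
        qed
        then show "\<exists>k. \<forall>n\<ge>k. norm (conv (moll n) g x - g x) < e" by blast
      qed
      then have "(\<lambda>n. \<bar>conv (moll n) g x - g x\<bar> powr q) \<longlonglongrightarrow> 0"
        using q by (intro tendsto_zero_powrI[where b=q]) (auto intro: tendsto_rabs_zero LIM_zero)
      then show "(\<lambda>n. ennreal (\<bar>conv (moll n) g x - g x\<bar> powr q)) \<longlonglongrightarrow> 0"
        using tendsto_ennrealI by fastforce
    qed
    show "(\<lambda>x. ennreal (\<bar>conv (moll n) g x - g x\<bar> powr q)) \<in> borel_measurable lborel" for n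
      by simp
    show "(\<lambda>x. ennreal (?w x)) \<in> borel_measurable lborel"
      by (rule integrable_measurable_ennreal) (intro integrable_mult_right integrable_indicator_cball)
  qed simp_all
  then show ?thesis by simp
qed

text \<open>Truncating \<open>f\<close> in value and in space gives bounded functions of bounded
  support. These are almost everywhere limits of continuous functions, which are clamped to the same
  range and cut off so that a majorant exists.\<close>

lemma Lq_approx_continuous:
  fixes f :: "'a::euclidean_space \<Rightarrow> real"
  assumes [measurable]: "f \<in> borel_measurable borel" and q: "1 < q"
    and fq: "integrable lborel (\<lambda>x. \<bar>f x\<bar> powr q)" and e: "0 < (e::real)"
  obtains g R where "continuous_on UNIV g" "\<And>x. norm x > R \<Longrightarrow> g x = 0"
    "(\<integral>\<^sup>+x. \<bar>f x - g x\<bar> powr q \<partial>lborel) < ennreal e"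
proof -
  have fqf: "(\<integral>\<^sup>+x. ennreal (\<bar>f x\<bar> powr q) \<partial>lborel) < \<infinity>"
    using nn_integral_eq_integral[OF fq] by simp
  \<comment> \<open>Two errors are added below, and \<open>powr_sum3\<close> costs the factor
    \<open>3 powr q\<close>.\<close>
  define e' where "e' = e / (2 * 3 powr q)"
  have e': "0 < e'" using e by (simp add: e'_def)
  define T where "T k x = (if norm x \<le> real k then max (- real k) (min (real k) (f x)) else 0)" for k x
  have Tm[measurable]: "T k \<in> borel_measurable borel" for k unfolding T_def by measurable
  have "(\<lambda>k. \<integral>\<^sup>+x. \<bar>f x - T k x\<bar> powr q \<partial>lborel) \<longlonglongrightarrow> (\<integral>\<^sup>+x. 0 \<partial>(lborel :: 'a measure))"
  proof (rule nn_integral_dominated_convergence)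
    show "(\<integral>\<^sup>+x. ennreal (\<bar>f x\<bar> powr q) \<partial>lborel) < \<infinity>" by fact
    show "AE x in lborel. ennreal (\<bar>f x - T k x\<bar> powr q) \<le> ennreal (\<bar>f x\<bar> powr q)" for k
      using q by (intro AE_I2 ennreal_leI powr_mono2) (auto simp: T_def)
    show "AE x in lborel. (\<lambda>k. ennreal (\<bar>f x - T k x\<bar> powr q)) \<longlonglongrightarrow> 0"
    proof (rule AE_I2)
      fix x
      obtain m where m: "max (norm x) \<bar>f x\<bar> \<le> real m" using real_arch_simple by blast
      have "\<forall>\<^sub>F k in sequentially. 0 = ennreal (\<bar>f x - T k x\<bar> powr q)"
        using eventually_ge_at_top[of m]
      proof eventually_elim
        case (elim k)
        then have "real m \<le> real k" by simp
        then have "T k x = f x" using m unfolding T_def by auto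
        then show ?case by simp
      qed
      then show "(\<lambda>k. ennreal (\<bar>f x - T k x\<bar> powr q)) \<longlonglongrightarrow> 0"
        by (rule Lim_transform_eventually[OF tendsto_const])
    qed
  qed measurable
  then have "\<forall>\<^sub>F k in sequentially. (\<integral>\<^sup>+x. \<bar>f x - T k x\<bar> powr q \<partial>lborel) < ennreal e'"
    using e' by (intro order_tendstoD) auto
  then obtain k where k: "(\<integral>\<^sup>+x. \<bar>f x - T k x\<bar> powr q \<partial>lborel) < ennreal e'"
    using eventually_sequentially by auto
  have "T k \<in> borel_measurable lebesgue" by (intro measurable_completion) simp
  then have "T k measurable_on UNIV" by (rule lebesgue_measurable_imp_measurable_on) simp
  then obtain N c where N: "negligible N" and c: "\<And>n. continuous_on UNIV (c n)"
    "\<And>x. x \<notin> N \<Longrightarrow> (\<lambda>n. c n x) \<longlonglongrightarrow> T k x"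
    unfolding measurable_on_def by auto
  \<comment> \<open>Equal to 1 on the ball of radius \<open>k\<close> that carries
    \<open>T k\<close>, so multiplication by it does not change the limit.\<close>
  define cut where "cut x = max 0 (min 1 (real k + 1 - norm x))" for x :: 'a
  define d where "d n x = max (- real k) (min (real k) (c n x)) * cut x" for n x
  have dc: "continuous_on UNIV (d n)" for n
    unfolding d_def cut_def using c(1)[of n] by (intro continuous_intros)
  then have [measurable]: "d n \<in> borel_measurable borel" for n by (rule borel_measurable_continuous_onI)
  have d0: "d n x = 0" if "norm x > real k + 1" for n x using that by (simp add: d_def cut_def)
  have "(\<lambda>n. \<integral>\<^sup>+x. \<bar>T k x - d n x\<bar> powr q \<partial>lborel) \<longlonglongrightarrow> (\<integral>\<^sup>+x. 0 \<partial>(lborel :: 'a measure))"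
  proof (rule nn_integral_dominated_convergence)
    let ?w = "\<lambda>x. (2 * real k) powr q * indicator (cball (0::'a) (real k + 1)) x"
    have "integrable lborel ?w" by (intro integrable_mult_right integrable_indicator_cball)
    then show "(\<integral>\<^sup>+x. ennreal (?w x) \<partial>lborel) < \<infinity>"
      using nn_integral_eq_integral[of lborel ?w] by simp
    show "AE x in lborel. ennreal (\<bar>T k x - d n x\<bar> powr q) \<le> ennreal (?w x)" for n
    proof (intro AE_I2 ennreal_leI)
      fix x
      have "\<bar>d n x\<bar> \<le> real k * 1"
        unfolding d_def abs_mult by (rule mult_mono) (auto simp: cut_def)
      moreover have "\<bar>T k x\<bar> \<le> real k" by (auto simp: T_def)
      ultimately have "\<bar>T k x - d n x\<bar> \<le> 2 * real k" by linarith
      moreover have "T k x - d n x = 0" if "norm x > real k + 1"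
        using that d0 by (simp add: T_def)
      ultimately show "\<bar>T k x - d n x\<bar> powr q \<le> ?w x"
        using q by (cases "norm x > real k + 1") (auto intro: powr_mono2)
    qed
    have "AE x in lebesgue. x \<notin> N" using N by (simp add: AE_not_in negligible_iff_null_sets)
    then have "AE x in lborel. x \<notin> N" by (simp add: AE_completion_iff)
    then show "AE x in lborel. (\<lambda>n. ennreal (\<bar>T k x - d n x\<bar> powr q)) \<longlonglongrightarrow> 0"
    proof eventually_elim
      case (elim x)
      have "(\<lambda>n. d n x) \<longlonglongrightarrow> max (- real k) (min (real k) (T k x)) * cut x"
        unfolding d_def using c(2)[OF elim] by (intro tendsto_intros)
      moreover have "max (- real k) (min (real k) (T k x)) * cut x = T k x"
        by (auto simp: T_def cut_def)
      ultimately have "(\<lambda>n. d n x) \<longlonglongrightarrow> T k x" by simp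
      then have "(\<lambda>n. T k x - d n x) \<longlonglongrightarrow> T k x - T k x" by (intro tendsto_diff tendsto_const)
      then have "(\<lambda>n. T k x - d n x) \<longlonglongrightarrow> 0" by simp
      then have "(\<lambda>n. \<bar>T k x - d n x\<bar> powr q) \<longlonglongrightarrow> 0"
        using q by (intro tendsto_zero_powrI[where b=q]) (auto intro: tendsto_rabs_zero)
      then show ?case using tendsto_ennrealI by fastforce
    qed
    show "(\<lambda>x. ennreal (?w x)) \<in> borel_measurable lborel"
      by (rule integrable_measurable_ennreal) (intro integrable_mult_right integrable_indicator_cball)
  qed measurable
  then have "\<forall>\<^sub>F n in sequentially. (\<integral>\<^sup>+x. \<bar>T k x - d n x\<bar> powr q \<partial>lborel) < ennreal e'"
    using e' by (intro order_tendstoD) auto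
  then obtain n where n: "(\<integral>\<^sup>+x. \<bar>T k x - d n x\<bar> powr q \<partial>lborel) < ennreal e'"
    using eventually_sequentially by auto
  have "(\<integral>\<^sup>+x. \<bar>f x - d n x\<bar> powr q \<partial>lborel)
      \<le> (\<integral>\<^sup>+x. ennreal (3 powr q) * (ennreal (\<bar>f x - T k x\<bar> powr q) + ennreal (\<bar>T k x - d n x\<bar> powr q)) \<partial>lborel)"
  proof (rule nn_integral_mono)
    fix x
    have "\<bar>f x - d n x\<bar> powr q \<le> 3 powr q * (\<bar>f x - T k x\<bar> powr q + \<bar>T k x - d n x\<bar> powr q)"
      using powr_sum3[of q "f x - T k x" "T k x - d n x" 0] q by simp
    then show "ennreal (\<bar>f x - d n x\<bar> powr q)
      \<le> ennreal (3 powr q) * (ennreal (\<bar>f x - T k x\<bar> powr q) + ennreal (\<bar>T k x - d n x\<bar> powr q))"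
      by (simp add: ennreal_mult'[symmetric] ennreal_plus[symmetric] ennreal_leI del: ennreal_plus)
  qed
  also have "\<dots> = ennreal (3 powr q) * ((\<integral>\<^sup>+x. \<bar>f x - T k x\<bar> powr q \<partial>lborel) + (\<integral>\<^sup>+x. \<bar>T k x - d n x\<bar> powr q \<partial>lborel))"
    by (simp add: nn_integral_cmult nn_integral_add)
  also have "\<dots> < ennreal (3 powr q) * ennreal (e' + e')"
    using k n by (intro ennreal_mult_strict_left_mono add_mono_ennreal) auto
  also have "\<dots> = ennreal e"
    using e' by (simp add: ennreal_mult'[symmetric] del: ennreal_plus) (simp add: e'_def)
  finally show ?thesis using that[OF dc d0] by blast
qed

lemma tendsto_0_ennrealI:
  fixes F :: "'a \<Rightarrow> ennreal"
  assumes "\<And>e. 0 < (e::real) \<Longrightarrow> eventually (\<lambda>n. F n \<le> ennreal e) net"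
  shows "(F \<longlongrightarrow> 0) net"
proof (rule order_tendstoI)
  fix a :: ennreal assume "0 < a"
  then obtain b where b: "0 < b" "b < a" using dense by blast
  then have bt: "b < top" by (metis top.not_eq_extremum less_trans not_less_iff_gr_or_eq)
  then have "b = ennreal (enn2real b)" by simp
  moreover have "0 < enn2real b" using b bt by (simp add: enn2real_positive_iff)
  ultimately have "eventually (\<lambda>n. F n \<le> b) net" using assms[of "enn2real b"] by simp
  then show "eventually (\<lambda>n. F n < a) net" by eventually_elim (use b in auto)
qed simp

lemma indicator_cball_measurable: "(indicator (cball 0 R) :: 'a::euclidean_space \<Rightarrow> real) \<in> borel_measurable borel"
  by (intro borel_measurable_indicator) simp

text \<open>Approximate \<open>f\<close> by a continuous \<open>g\<close>. Of the three errors, the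
  contraction property controls the mollification of \<open>f - g\<close>, the continuous case
  controls \<open>conv (moll n) g - g\<close>, and \<open>f - g\<close> is small by choice; hence
  the 3 in \<open>d\<close> besides \<open>3 powr q\<close>.\<close>

lemma conv_moll_Lq_tendsto:
  fixes f :: "'a::euclidean_space \<Rightarrow> real"
  assumes fm[measurable]: "f \<in> borel_measurable borel" and q: "1 < q"
    and fq: "integrable lborel (\<lambda>x. \<bar>f x\<bar> powr q)"
  shows "(\<lambda>n. \<integral>\<^sup>+x. \<bar>conv (moll n) f x - f x\<bar> powr q \<partial>lborel) \<longlonglongrightarrow> 0"
proof (rule tendsto_0_ennrealI)
  fix e :: real assume e: "0 < e"
  define d where "d = e / (3 powr q * 3)"
  have d: "0 < d" using e by (simp add: d_def)
  obtain g R where g: "continuous_on UNIV g" "\<And>x. norm x > R \<Longrightarrow> g x = 0"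
    and fg: "(\<integral>\<^sup>+x. \<bar>f x - g x\<bar> powr q \<partial>lborel) < ennreal d"
    using Lq_approx_continuous[OF fm q fq d] by metis
  note gm[measurable] = borel_measurable_continuous_onI[OF g(1)]
  have fgm[measurable]: "(\<lambda>x. f x - g x) \<in> borel_measurable borel" by simp
  have fgi: "integrable lborel (\<lambda>x. \<bar>f x - g x\<bar> powr q)"
    by (rule integrableI_bounded) (use order_less_trans[OF fg ennreal_less_top] in auto)
  have gi: "integrable lborel g" by (rule continuous_compact_support_integrable[OF g])
  have lg: "locint g" unfolding locint_def using integrable_indicator_mult[OF gi] gm by auto
  have lf: "locint f" by (rule locint_of_powr[of f q]) (use q integrable_indicator_mult[OF fq] in auto)
  have "\<forall>\<^sub>F n in sequentially. (\<integral>\<^sup>+x. \<bar>conv (moll n) g x - g x\<bar> powr q \<partial>lborel) < ennreal d"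
    using d by (intro order_tendstoD[OF conv_moll_continuous_tendsto[OF g q]]) auto
  then show "\<forall>\<^sub>F n in sequentially. (\<integral>\<^sup>+x. \<bar>conv (moll n) f x - f x\<bar> powr q \<partial>lborel) \<le> ennreal e"
  proof eventually_elim
    case (elim n)
    let ?a = "\<lambda>x. \<bar>conv (moll n) (\<lambda>x. f x - g x) x\<bar> powr q"
    let ?b = "\<lambda>x. \<bar>conv (moll n) g x - g x\<bar> powr q"
    let ?c = "\<lambda>x. \<bar>f x - g x\<bar> powr q"
    have "(\<integral>\<^sup>+x. \<bar>conv (moll n) f x - f x\<bar> powr q \<partial>lborel)
        \<le> (\<integral>\<^sup>+x. ennreal (3 powr q) * (ennreal (?a x) + (ennreal (?b x) + ennreal (?c x))) \<partial>lborel)"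
    proof (rule nn_integral_mono)
      fix x
      have "\<bar>conv (moll n) f x - f x\<bar> powr q \<le> 3 powr q * (?a x + ?b x + ?c x)"
        using powr_sum3[of q "conv (moll n) (\<lambda>x. f x - g x) x" "conv (moll n) g x - g x" "g x - f x"] q
        by (simp add: conv_diff[OF lf lg] abs_minus_commute)
      then show "ennreal (\<bar>conv (moll n) f x - f x\<bar> powr q)
          \<le> ennreal (3 powr q) * (ennreal (?a x) + (ennreal (?b x) + ennreal (?c x)))"
        by (simp add: ennreal_mult'[symmetric] ennreal_plus[symmetric] ennreal_leI add.assoc del: ennreal_plus)
    qed
    also have "\<dots> = ennreal (3 powr q) * ((\<integral>\<^sup>+x. ?a x \<partial>lborel) + ((\<integral>\<^sup>+x. ?b x \<partial>lborel) + (\<integral>\<^sup>+x. ?c x \<partial>lborel)))"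
      by (simp add: nn_integral_cmult nn_integral_add)
    also have "\<dots> \<le> ennreal (3 powr q) * (ennreal d + (ennreal d + ennreal d))"
      using elim fg conv_moll_Lq_le[OF fgm q fgi, of n]
      by (intro mult_left_mono add_mono) auto
    also have "\<dots> = ennreal e"
      using d by (simp add: ennreal_plus[symmetric] ennreal_mult'[symmetric] del: ennreal_plus) (simp add: d_def)
    finally show ?case .
  qed
qed

text \<open>Mollifiers have radius at most 1, so on the ball of radius \<open>R\<close> only values
  in the ball of radius \<open>R + 1\<close> enter, and \<open>f\<close> may be cut off
  there.\<close>

lemma conv_moll_Lq_loc_tendsto:
  fixes f :: "'a::euclidean_space \<Rightarrow> real"
  assumes fm[measurable]: "f \<in> borel_measurable borel" and q: "1 < q"
    and fq: "\<And>R. integrable lborel (\<lambda>x. indicator (cball 0 R) x * \<bar>f x\<bar> powr q)"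
  shows "(\<lambda>n. \<integral>\<^sup>+x. indicator (cball 0 R) x * \<bar>conv (moll n) f x - f x\<bar> powr q \<partial>lborel) \<longlonglongrightarrow> 0"
proof (rule tendsto_sandwich[OF _ _ tendsto_const])
  define f0 where "f0 x = indicator (cball 0 (R + 1)) x * f x" for x
  have f0m: "f0 \<in> borel_measurable borel"
    unfolding f0_def[abs_def] by (intro borel_measurable_times indicator_cball_measurable fm)
  have "(\<lambda>x. \<bar>f0 x\<bar> powr q) = (\<lambda>x. indicator (cball 0 (R + 1)) x * \<bar>f x\<bar> powr q)"
    by (auto simp: f0_def indicator_def)
  then have "integrable lborel (\<lambda>x. \<bar>f0 x\<bar> powr q)" using fq by simp
  then show "(\<lambda>n. \<integral>\<^sup>+x. \<bar>conv (moll n) f0 x - f0 x\<bar> powr q \<partial>lborel) \<longlonglongrightarrow> 0"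
    by (rule conv_moll_Lq_tendsto[OF f0m q])
  show "\<forall>\<^sub>F n in sequentially. (\<integral>\<^sup>+x. indicator (cball 0 R) x * \<bar>conv (moll n) f x - f x\<bar> powr q \<partial>lborel)
      \<le> (\<integral>\<^sup>+x. \<bar>conv (moll n) f0 x - f0 x\<bar> powr q \<partial>lborel)"
  proof (intro always_eventually allI nn_integral_mono)
    fix n x
    show "ennreal (indicator (cball 0 R) x * \<bar>conv (moll n) f x - f x\<bar> powr q)
      \<le> ennreal (\<bar>conv (moll n) f0 x - f0 x\<bar> powr q)"
    proof (cases "norm x \<le> R")
      case True
      have "moll n (x - y) * f y = moll n (x - y) * f0 y" for y
      proof (cases "norm y \<le> R + 1")
        case False
        have "1 / (real n + 1) \<le> 1" by simp
        moreover have "norm y - norm x \<le> norm (x - y)" by (metis norm_minus_commute norm_triangle_ineq2)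
        ultimately have "1 / (real n + 1) < norm (x - y)" using True False by linarith
        then show ?thesis by (simp add: moll_support)
      qed (simp add: f0_def)
      then have "conv (moll n) f x = conv (moll n) f0 x"
        unfolding conv_def by (intro Bochner_Integration.integral_cong refl)
      then show ?thesis using True by (simp add: f0_def)
    qed simp
  qed
qed simp

text \<open>The majorant is the sum over \<open>n\<close> of the errors \<open>|f\<^sub>n - f|\<^sup>q\<close>, whose integrals are at most
  \<open>2\<^sup>-\<^sup>n\<close>; its finiteness almost everywhere also gives pointwise convergence.\<close>

lemma fast_mollifier_sequence:
  fixes f :: "'i \<Rightarrow> 'a::euclidean_space \<Rightarrow> real" and q :: "'i \<Rightarrow> real"
  assumes fin: "finite I" and fm: "\<And>i. i \<in> I \<Longrightarrow> f i \<in> borel_measurable borel"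
    and q: "\<And>i. i \<in> I \<Longrightarrow> 1 < q i"
    and fq: "\<And>i R. i \<in> I \<Longrightarrow> integrable lborel (\<lambda>x. indicator (cball 0 R) x * \<bar>f i x\<bar> powr q i)"
  obtains k H where "integrable lborel H" "\<And>x. 0 \<le> H x"
    "AE x in lborel. norm x \<le> R \<longrightarrow> (\<forall>i\<in>I. (\<forall>n. \<bar>conv (moll (k n)) (f i) x\<bar> powr q i \<le> H x) \<and>
       \<bar>f i x\<bar> powr q i \<le> H x \<and> (\<lambda>n. conv (moll (k n)) (f i) x) \<longlonglongrightarrow> f i x)"
proof -
  define d where "d n i x = indicator (cball 0 R) x * \<bar>conv (moll n) (f i) x - f i x\<bar> powr q i" for n i x
  have dm: "d n i \<in> borel_measurable borel" if "i \<in> I" for n i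
  proof -
    note [measurable] = fm[OF that]
    have "(\<lambda>x. \<bar>conv (moll n) (f i) x - f i x\<bar> powr q i) \<in> borel_measurable borel" by measurable
    then show ?thesis
      unfolding d_def[abs_def] by (intro borel_measurable_times indicator_cball_measurable)
  qed
  have d0: "0 \<le> d n i x" for n i x by (simp add: d_def)
  have "(\<lambda>n. \<Sum>i\<in>I. \<integral>\<^sup>+x. d n i x \<partial>lborel) \<longlonglongrightarrow> (\<Sum>i\<in>I. 0)"
    unfolding d_def by (intro tendsto_sum conv_moll_Lq_loc_tendsto fm q fq)
  then have "\<forall>\<^sub>F m in sequentially. (\<Sum>i\<in>I. \<integral>\<^sup>+x. d m i x \<partial>lborel) < ennreal ((1/2)^n)" for n
    by (intro order_tendstoD) auto
  then have "\<exists>m. (\<Sum>i\<in>I. \<integral>\<^sup>+x. d m i x \<partial>lborel) < ennreal ((1/2)^n)" for n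
    by (rule eventually_happens'[OF sequentially_bot])
  then obtain k where k: "\<And>n. (\<Sum>i\<in>I. \<integral>\<^sup>+x. d (k n) i x \<partial>lborel) < ennreal ((1/2)^n)" by metis
  define D where "D n x = (\<Sum>i\<in>I. d (k n) i x)" for n x
  have Dm[measurable]: "D n \<in> borel_measurable borel" for n
    unfolding D_def[abs_def] by (intro borel_measurable_sum dm)
  have D0: "0 \<le> D n x" for n x unfolding D_def by (intro sum_nonneg d0)
  have Dint: "(\<integral>\<^sup>+x. D n x \<partial>lborel) \<le> ennreal ((1/2)^n)" for n
  proof -
    have "(\<integral>\<^sup>+x. D n x \<partial>lborel) = (\<integral>\<^sup>+x. (\<Sum>i\<in>I. ennreal (d (k n) i x)) \<partial>lborel)"
      unfolding D_def by (simp add: sum_ennreal d0)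
    also have "\<dots> = (\<Sum>i\<in>I. \<integral>\<^sup>+x. d (k n) i x \<partial>lborel)"
      by (intro nn_integral_sum measurable_compose[OF _ measurable_ennreal]) (simp add: dm)
    finally show ?thesis using k[of n] by simp
  qed
  define S where "S x = (\<Sum>n. ennreal (D n x))" for x
  have Sm[measurable]: "S \<in> borel_measurable borel" unfolding S_def[abs_def] by measurable
  have "(\<integral>\<^sup>+x. S x \<partial>lborel) = (\<Sum>n. \<integral>\<^sup>+x. D n x \<partial>lborel)"
    unfolding S_def by (rule nn_integral_suminf) simp
  also have "\<dots> \<le> (\<Sum>n. ennreal ((1/2)^n))" by (intro suminf_le Dint) auto
  also have "\<dots> = ennreal (\<Sum>n. (1/2)^n)"
    by (rule suminf_ennreal2) (auto intro: summable_geometric)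
  also have "\<dots> < \<infinity>" by simp
  finally have Sfin: "(\<integral>\<^sup>+x. S x \<partial>lborel) < \<infinity>" .
  then have Sae: "AE x in lborel. S x \<noteq> \<infinity>"
    by (intro nn_integral_PInf_AE) auto
  have Si: "integrable lborel (\<lambda>x. enn2real (S x))"
  proof (rule integrableI_bounded)
    have "(\<integral>\<^sup>+x. ennreal (norm (enn2real (S x))) \<partial>lborel) \<le> (\<integral>\<^sup>+x. S x \<partial>lborel)"
      by (intro nn_integral_mono) (simp add: ennreal_enn2real_if)
    then show "(\<integral>\<^sup>+x. ennreal (norm (enn2real (S x))) \<partial>lborel) < \<infinity>" using Sfin by (rule le_less_trans)
  qed simp
  define C where "C = (\<Sum>i\<in>I. 3 powr q i)"
  define E where "E x = (\<Sum>i\<in>I. indicator (cball 0 R) x * \<bar>f i x\<bar> powr q i)" for x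
  have E0: "0 \<le> E x" for x unfolding E_def by (intro sum_nonneg) auto
  have C0: "0 \<le> C" unfolding C_def by (intro sum_nonneg) auto
  define H where "H x = (1 + C) * (enn2real (S x) + E x)" for x
  show thesis
  proof (rule that[of H k])
    show "integrable lborel H" unfolding H_def E_def
      by (intro integrable_mult_right Bochner_Integration.integrable_add Si Bochner_Integration.integrable_sum fq)
    show "0 \<le> H x" for x unfolding H_def using C0 E0 by simp
    show "AE x in lborel. norm x \<le> R \<longrightarrow> (\<forall>i\<in>I. (\<forall>n. \<bar>conv (moll (k n)) (f i) x\<bar> powr q i \<le> H x) \<and>
       \<bar>f i x\<bar> powr q i \<le> H x \<and> (\<lambda>n. conv (moll (k n)) (f i) x) \<longlonglongrightarrow> f i x)"
      using Sae
    proof eventually_elim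
      case (elim x)
      show ?case
      proof (intro impI ballI)
        fix i assume x: "norm x \<le> R" and i: "i \<in> I"
        have "(\<Sum>n. ennreal (D n x)) \<noteq> top" using elim unfolding S_def by simp
        then have sm: "summable (\<lambda>n. D n x)" by (rule summable_suminf_not_top[OF D0])
        have Sx: "enn2real (S x) = (\<Sum>n. D n x)"
          unfolding S_def by (subst suminf_ennreal2[OF D0 sm]) (simp add: suminf_nonneg[OF sm D0])
        have dD: "\<bar>conv (moll (k n)) (f i) x - f i x\<bar> powr q i \<le> D n x" for n
          unfolding D_def using member_le_sum[OF i _ fin, of "\<lambda>i. d (k n) i x"] d0 x by (simp add: d_def)
        have DS: "D n x \<le> enn2real (S x)" for n
          unfolding Sx using sum_le_suminf[OF sm, of "{n}"] D0 by simp
        have fE: "\<bar>f i x\<bar> powr q i \<le> E x"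
          unfolding E_def using member_le_sum[OF i _ fin, of "\<lambda>i. indicator (cball 0 R) x * \<bar>f i x\<bar> powr q i"] x by simp
        have qC: "3 powr q i \<le> C" unfolding C_def using member_le_sum[OF i _ fin, of "\<lambda>i. 3 powr q i"] by simp
        have "\<bar>conv (moll (k n)) (f i) x\<bar> powr q i \<le> H x" for n
        proof -
          have "\<bar>conv (moll (k n)) (f i) x\<bar> powr q i
              \<le> 3 powr q i * (\<bar>conv (moll (k n)) (f i) x - f i x\<bar> powr q i + \<bar>f i x\<bar> powr q i)"
            using powr_sum3[of "q i" "conv (moll (k n)) (f i) x - f i x" "f i x" 0] q[OF i] by simp
          also have "\<dots> \<le> (1 + C) * (enn2real (S x) + E x)"
            using order_trans[OF dD DS] fE qC C0 by (intro mult_mono add_mono) auto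
          finally show ?thesis by (simp add: H_def)
        qed
        moreover have "\<bar>f i x\<bar> powr q i \<le> H x"
        proof -
          have "1 * \<bar>f i x\<bar> powr q i \<le> (1 + C) * (enn2real (S x) + E x)"
            using fE C0 by (intro mult_mono) (auto intro: add_increasing)
          then show ?thesis by (simp add: H_def)
        qed
        moreover have "(\<lambda>n. conv (moll (k n)) (f i) x) \<longlonglongrightarrow> f i x"
        proof -
          have "(\<lambda>n. \<bar>conv (moll (k n)) (f i) x - f i x\<bar> powr q i) \<longlonglongrightarrow> 0"
            by (rule tendsto_sandwich[OF _ _ tendsto_const summable_LIMSEQ_zero[OF sm]]) (auto simp: dD)
          then have "(\<lambda>n. (\<bar>conv (moll (k n)) (f i) x - f i x\<bar> powr q i) powr (1 / q i)) \<longlonglongrightarrow> 0"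
            using q[OF i] by (intro tendsto_zero_powrI[where
              f="\<lambda>n. \<bar>conv (moll (k n)) (f i) x - f i x\<bar> powr q i" and b="1 / q i"]) auto
          then have "(\<lambda>n. \<bar>conv (moll (k n)) (f i) x - f i x\<bar>) \<longlonglongrightarrow> 0"
            using q[OF i] by (simp add: powr_powr)
          then show ?thesis by (simp add: tendsto_rabs_zero_iff LIM_zero_iff)
        qed
        ultimately show "(\<forall>n. \<bar>conv (moll (k n)) (f i) x\<bar> powr q i \<le> H x) \<and>
          \<bar>f i x\<bar> powr q i \<le> H x \<and> (\<lambda>n. conv (moll (k n)) (f i) x) \<longlonglongrightarrow> f i x" by blast
      qed
    qed
  qed
qed

subsection \<open>The Hardy-Littlewood-Sobolev inequality on the diagonal\<close>

text \<open>A way to integrate powers of the norm without polar coordinates: the integrand is at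
  most the sum of \<open>c k\<close> times the indicator of the ball of radius \<open>r k\<close>,
  and the hypothesis \<open>g\<close> makes the integrals of these terms a geometric series.\<close>

lemma nn_integral_dyadic_le:
  fixes f :: "'a::euclidean_space \<Rightarrow> ennreal" and c r :: "nat \<Rightarrow> real"
  assumes c: "\<And>k. 0 \<le> c k" and r: "\<And>k. 0 \<le> r k"
    and f: "\<And>z. f z \<noteq> 0 \<Longrightarrow> \<exists>k. norm z < r k \<and> f z \<le> ennreal (c k)"
    and g: "\<And>k. c k * (unit_ball_vol (real DIM('a)) * r k ^ DIM('a)) = C * x ^ k" and x: "0 \<le> x" "x < 1"
  shows "(\<integral>\<^sup>+z. f z \<partial>lborel) \<le> ennreal (C / (1 - x))"
proof -
  have "0 \<le> c 0 * (unit_ball_vol (real DIM('a)) * r 0 ^ DIM('a))"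
    by (intro mult_nonneg_nonneg zero_le_power c r unit_ball_vol_nonneg) simp
  then have C0: "0 \<le> C" unfolding g by simp
  have tm: "F k \<le> (\<Sum>k. F k)" for F :: "nat \<Rightarrow> ennreal" and k
    using sum_le_suminf[of F "{k}"] by simp
  have "(\<integral>\<^sup>+z. f z \<partial>lborel) \<le> (\<integral>\<^sup>+z. (\<Sum>k. ennreal (c k) * indicator (ball 0 (r k)) (z::'a)) \<partial>lborel)"
  proof (rule nn_integral_mono)
    fix z
    show "f z \<le> (\<Sum>k. ennreal (c k) * indicator (ball 0 (r k)) z)"
    proof (cases "f z = 0")
      case False
      then obtain k where k: "norm z < r k" "f z \<le> ennreal (c k)" using f by blast
      have "f z \<le> ennreal (c k) * indicator (ball 0 (r k)) z" using k by simp
      also have "\<dots> \<le> (\<Sum>k. ennreal (c k) * indicator (ball 0 (r k)) z)"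
        by (rule tm)
      finally show ?thesis .
    qed simp
  qed
  also have "\<dots> = (\<Sum>k. \<integral>\<^sup>+z. ennreal (c k) * indicator (ball 0 (r k)) (z::'a) \<partial>lborel)"
    by (rule nn_integral_suminf) (intro borel_measurable_times_ennreal borel_measurable_indicator; simp)
  also have "\<dots> = (\<Sum>k. ennreal (C * x ^ k))"
    by (simp add: nn_integral_cmult_indicator emeasure_ball r c ennreal_mult'[symmetric] g flip: g)
  also have "\<dots> = ennreal (\<Sum>k. C * x ^ k)"
    using C0 x by (intro suminf_ennreal2) (auto intro!: summable_mult summable_geometric)
  also have "(\<Sum>k. C * x ^ k) = C / (1 - x)"
    using x by (simp add: suminf_mult summable_geometric suminf_geometric)
  finally show ?thesis .
qed

text \<open>On the shell between \<open>R / 2 ^ Suc k\<close> and \<open>R / 2 ^ k\<close> the power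
  is at most its value at the inner radius. Against the volume of the outer ball this gives a
  geometric series of ratio \<open>2 powr - (N - \<beta>)\<close>, below 1 because \<beta> is below
  the dimension.\<close>

lemma nn_integral_powr_near:
  fixes \<beta> :: real
  assumes "0 < \<beta>" "\<beta> < DIM('a::euclidean_space)"
  obtains C where "0 \<le> C"
    "\<And>R. 0 < R \<Longrightarrow> (\<integral>\<^sup>+z. ennreal (indicator {z. norm z < R} z * norm (z::'a) powr (- \<beta>)) \<partial>lborel)
        \<le> ennreal (C * R powr (DIM('a) - \<beta>))"
proof -
  let ?N = "real DIM('a)"
  define x where "x = 2 powr (- (?N - \<beta>))"
  have x: "0 \<le> x" "x < 1" using assms by (auto simp: x_def powr_less_one)
  define V where "V = unit_ball_vol ?N"
  have V: "0 \<le> V" by (simp add: V_def)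
  show thesis
  proof (rule that[of "V * 2 powr \<beta> / (1 - x)"])
    show "0 \<le> V * 2 powr \<beta> / (1 - x)" using V x by simp
    fix R :: real assume R: "0 < R"
    have "(\<integral>\<^sup>+z. ennreal (indicator {z. norm z < R} z * norm (z::'a) powr (- \<beta>)) \<partial>lborel)
        \<le> ennreal (V * 2 powr \<beta> * R powr (?N - \<beta>) / (1 - x))"
    proof (rule nn_integral_dyadic_le[where c="\<lambda>k. (R / 2 ^ Suc k) powr (- \<beta>)" and r="\<lambda>k. R / 2 ^ k" and x=x])
      fix z :: 'a assume "ennreal (indicator {z. norm z < R} z * norm z powr (- \<beta>)) \<noteq> 0"
      \<comment> \<open>At the origin the integrand is 0 because \<open>0 powr (- \<beta>)\<close>
        is 0, so every point to be covered lies in some dyadic shell.\<close>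
      then have z: "norm z < R" "0 < norm z" by (auto simp: indicator_def split: if_splits)
      obtain m where m: "R / norm z < 2 ^ m" using real_arch_pow[of 2 "R / norm z"] by auto
      then have ex: "R / 2 ^ m < norm z" using z by (simp add: field_simps)
      define k where "k = (LEAST k. R / 2 ^ Suc k \<le> norm z)"
      have "R / 2 ^ Suc m \<le> R / 2 ^ m" using R by (simp add: field_simps)
      then have "R / 2 ^ Suc m \<le> norm z" using ex by linarith
      then have k: "R / 2 ^ Suc k \<le> norm z"
        unfolding k_def by (rule LeastI[of "\<lambda>k. R / 2 ^ Suc k \<le> norm z"])
      have "norm z < R / 2 ^ k"
      proof (cases k)
        case (Suc j)
        then have "j < (LEAST k. R / 2 ^ Suc k \<le> norm z)" unfolding k_def by simp
        from not_less_Least[OF this] have "\<not> R / 2 ^ Suc j \<le> norm z" .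
        then show ?thesis using Suc by simp
      qed (use z in simp)
      moreover have "norm z powr (- \<beta>) \<le> (R / 2 ^ Suc k) powr (- \<beta>)"
        using assms R k by (intro powr_mono2') auto
      ultimately show "\<exists>k. norm z < R / 2 ^ k \<and>
          ennreal (indicator {z. norm z < R} z * norm z powr (- \<beta>)) \<le> ennreal ((R / 2 ^ Suc k) powr (- \<beta>))"
        using z by (intro exI[of _ k]) (auto intro: ennreal_leI)
    next
      fix k
      have p: "(2::real) ^ n = 2 powr real n" for n by (simp add: powr_realpow)
      have A1: "(R / 2 ^ Suc k) powr (- \<beta>) = R powr (- \<beta>) * 2 powr (real (Suc k) * \<beta>)"
      proof -
        have "R / 2 ^ Suc k = R * 2 powr (- real (Suc k))" unfolding p by (simp only: powr_minus divide_inverse)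
        then show ?thesis using R by (simp only: powr_mult powr_powr) (simp add: algebra_simps)
      qed
      have A2: "(R / 2 ^ k) ^ DIM('a) = R powr ?N * 2 powr (- (real k * ?N))"
      proof -
        have "R / 2 ^ k = R * 2 powr (- real k)" unfolding p by (simp only: powr_minus divide_inverse)
        moreover have "(R * 2 powr (- real k)) ^ DIM('a) = (R * 2 powr (- real k)) powr ?N"
          using R by (intro powr_realpow[symmetric]) simp
        ultimately show ?thesis using R by (simp only: powr_mult powr_powr) simp
      qed
      have A3: "x ^ k = 2 powr (- (?N - \<beta>) * real k)"
        by (simp add: x_def powr_power mult.commute)
      have B1: "R powr (- \<beta>) * R powr ?N = R powr (?N - \<beta>)" by (simp flip: powr_add)
      have B2: "2 powr (real (Suc k) * \<beta>) * 2 powr (- (real k * ?N)) = 2 powr \<beta> * 2 powr (- (?N - \<beta>) * real k)"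
        by (simp flip: powr_add add: algebra_simps)
      have "(R / 2 ^ Suc k) powr (- \<beta>) * (unit_ball_vol ?N * (R / 2 ^ k) ^ DIM('a))
          = V * (R powr (- \<beta>) * R powr ?N) * (2 powr (real (Suc k) * \<beta>) * 2 powr (- (real k * ?N)))"
        unfolding A1 A2 V_def[symmetric] by (simp only: mult_ac)
      also have "\<dots> = V * 2 powr \<beta> * R powr (?N - \<beta>) * x ^ k"
        unfolding A3 B1 B2 by (simp only: mult_ac)
      finally show "(R / 2 ^ Suc k) powr (- \<beta>) * (unit_ball_vol ?N * (R / 2 ^ k) ^ DIM('a))
          = V * 2 powr \<beta> * R powr (?N - \<beta>) * x ^ k" .
    qed (use R x in auto)
    then show "(\<integral>\<^sup>+z. ennreal (indicator {z. norm z < R} z * norm (z::'a) powr (- \<beta>)) \<partial>lborel)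
        \<le> ennreal (V * 2 powr \<beta> / (1 - x) * R powr (?N - \<beta>))"
      by simp
  qed
qed

text \<open>The exponent \<open>2 * N\<close> is what Young's inequality makes of the kernel: the
  power \<open>2 N / (N - \<alpha>)\<close> of \<open>norm z powr - (N - \<alpha>)\<close>. The
  shells now double outwards, with ratio \<open>2 powr - N\<close>.\<close>

lemma nn_integral_powr_far:
  obtains C where "0 \<le> C"
    "\<And>R. 0 < R \<Longrightarrow> (\<integral>\<^sup>+z. ennreal (indicator {z. R \<le> norm z} z * norm (z::'a::euclidean_space) powr (- 2 * real DIM('a))) \<partial>lborel)
        \<le> ennreal (C * R powr (- real DIM('a)))"
proof -
  let ?N = "real DIM('a)"
  define x where "x = 2 powr (- ?N)"
  have x: "0 \<le> x" "x < 1" by (auto simp: x_def powr_less_one)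
  define V where "V = unit_ball_vol ?N"
  have V: "0 \<le> V" by (simp add: V_def)
  show thesis
  proof (rule that[of "V * 2 powr ?N / (1 - x)"])
    show "0 \<le> V * 2 powr ?N / (1 - x)" using V x by simp
    fix R :: real assume R: "0 < R"
    have "(\<integral>\<^sup>+z. ennreal (indicator {z. R \<le> norm z} z * norm (z::'a) powr (- 2 * ?N)) \<partial>lborel)
        \<le> ennreal (V * 2 powr ?N * R powr (- ?N) / (1 - x))"
    proof (rule nn_integral_dyadic_le[where c="\<lambda>k. (R * 2 ^ k) powr (- 2 * ?N)" and r="\<lambda>k. R * 2 ^ Suc k" and x=x])
      fix z :: 'a assume "ennreal (indicator {z. R \<le> norm z} z * norm z powr (- 2 * ?N)) \<noteq> 0"
      then have z: "R \<le> norm z" by (auto simp: indicator_def split: if_splits)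
      obtain m where m: "norm z / R < 2 ^ m" using real_arch_pow[of 2 "norm z / R"] by auto
      then have ex: "norm z < R * 2 ^ m" using R by (simp add: field_simps)
      define k where "k = (LEAST k. norm z < R * 2 ^ Suc k)"
      have "R * 2 ^ m \<le> R * 2 ^ Suc m" using R by (simp add: field_simps)
      then have "norm z < R * 2 ^ Suc m" using ex by linarith
      then have k: "norm z < R * 2 ^ Suc k"
        unfolding k_def by (rule LeastI[of "\<lambda>k. norm z < R * 2 ^ Suc k"])
      have k2: "R * 2 ^ k \<le> norm z"
      proof (cases k)
        case (Suc j)
        then have "j < (LEAST k. norm z < R * 2 ^ Suc k)" unfolding k_def by simp
        from not_less_Least[OF this] have "\<not> norm z < R * 2 ^ Suc j" .
        then show ?thesis using Suc by simp
      qed (use z in simp)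
      have "norm z powr (- 2 * ?N) \<le> (R * 2 ^ k) powr (- 2 * ?N)"
        using R k2 by (intro powr_mono2') auto
      then show "\<exists>k. norm z < R * 2 ^ Suc k \<and>
          ennreal (indicator {z. R \<le> norm z} z * norm z powr (- 2 * ?N)) \<le> ennreal ((R * 2 ^ k) powr (- 2 * ?N))"
        using z k by (intro exI[of _ k]) (auto intro: ennreal_leI)
    next
      fix k
      have p: "(2::real) ^ n = 2 powr real n" for n by (simp add: powr_realpow)
      have "(R * 2 ^ k) powr (- 2 * ?N) = R powr (- 2 * ?N) * 2 powr (- 2 * ?N * real k)"
        using R by (simp add: p powr_mult powr_powr mult_ac)
      moreover have "(R * 2 ^ Suc k) ^ DIM('a) = R powr ?N * 2 powr (real (Suc k) * ?N)"
      proof -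
        have "(R * 2 powr real (Suc k)) ^ DIM('a) = (R * 2 powr real (Suc k)) powr ?N"
          using R by (intro powr_realpow[symmetric]) simp
        then show ?thesis unfolding p using R by (simp only: powr_mult powr_powr)
      qed
      moreover have "x ^ k = 2 powr (- ?N * real k)"
        by (simp add: x_def powr_power mult.commute)
      ultimately show "(R * 2 ^ k) powr (- 2 * ?N) * (unit_ball_vol ?N * (R * 2 ^ Suc k) ^ DIM('a))
          = V * 2 powr ?N * R powr (- ?N) * x ^ k"
        by (simp add: V_def mult_ac powr_add[symmetric] algebra_simps)
    qed (use R x in auto)
    then show "(\<integral>\<^sup>+z. ennreal (indicator {z. R \<le> norm z} z * norm (z::'a) powr (- 2 * ?N)) \<partial>lborel)
        \<le> ennreal (V * 2 powr ?N / (1 - x) * R powr (- ?N))"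
      by simp
  qed
qed

text \<open>By symmetry only pairs with \<open>f y \<le> f x\<close> matter. Inside the ball of radius
  \<open>R = f(x) powr (-2/(N+\<alpha>))\<close> around \<open>x\<close> use \<open>f y \<le> f x\<close>, outside use Young's inequality; this \<open>R\<close>
  balances both contributions.\<close>

lemma hls_inner_estimate:
  fixes f :: "'a::euclidean_space \<Rightarrow> real" and \<alpha> :: real
  assumes \<alpha>: "0 < \<alpha>" "\<alpha> < DIM('a)" and fm[measurable]: "f \<in> borel_measurable borel" and f0: "\<And>x. 0 \<le> f x"
    and J: "(\<integral>\<^sup>+x. f x powr (2 * real DIM('a) / (real DIM('a) + \<alpha>)) \<partial>lborel) \<le> ennreal J" "0 \<le> J"
  obtains C where "0 \<le> C"
    "\<And>x. (\<integral>\<^sup>+y. (if f y \<le> f x then f x * norm (x - y) powr - (real DIM('a) - \<alpha>) * f y else 0) \<partial>lborel)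
      \<le> ennreal (C * f x powr (2 * real DIM('a) / (real DIM('a) + \<alpha>)))"
proof -
  let ?N = "real DIM('a)"
  define \<beta> where "\<beta> = ?N - \<alpha>"
  define q where "q = 2 * ?N / (?N + \<alpha>)"
  define q' where "q' = 2 * ?N / \<beta>"
  have \<beta>: "0 < \<beta>" "\<beta> < ?N" using \<alpha> by (auto simp: \<beta>_def)
  have q: "1 < q" "1 < q'" "1 / q + 1 / q' = 1" using \<alpha> by (auto simp: q_def q'_def \<beta>_def field_simps)
  obtain C1 where C1: "0 \<le> C1" "\<And>R. 0 < R \<Longrightarrow>
      (\<integral>\<^sup>+z. ennreal (indicator {z. norm z < R} z * norm (z::'a) powr (- \<beta>)) \<partial>lborel) \<le> ennreal (C1 * R powr (?N - \<beta>))"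
    by (rule nn_integral_powr_near[OF \<beta>]) blast
  obtain C2 where C2: "0 \<le> C2" "\<And>R. 0 < R \<Longrightarrow>
      (\<integral>\<^sup>+z. ennreal (indicator {z. R \<le> norm z} z * norm (z::'a) powr (- 2 * ?N)) \<partial>lborel) \<le> ennreal (C2 * R powr (- ?N))"
    by (rule nn_integral_powr_far) blast
  define C where "C = C1 + J + C2"
  show thesis
  proof (rule that[of C])
    show "0 \<le> C" using C1 C2 J by (simp add: C_def)
    fix x
    define a where "a = f x"
    show "(\<integral>\<^sup>+y. (if f y \<le> f x then f x * norm (x - y) powr - (?N - \<alpha>) * f y else 0) \<partial>lborel)
      \<le> ennreal (C * f x powr (2 * ?N / (?N + \<alpha>)))"
    proof (cases "a = 0")
      case True
      then have "f x = 0" by (simp add: a_def)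
      then show ?thesis by (simp cong: if_cong)
    next
      case False
      then have a: "0 < a" using f0[of x] by (simp add: a_def less_le)
      define R where "R = a powr (- 2 / (?N + \<alpha>))"
      have R: "0 < R" using a by (simp add: R_def)
      let ?near = "\<lambda>z::'a. indicator {z. norm z < R} z * norm z powr (- \<beta>)"
      let ?far = "\<lambda>z::'a. indicator {z. R \<le> norm z} z * norm z powr (- 2 * ?N)"
      have split: "(if f y \<le> f x then f x * norm (x - y) powr - (?N - \<alpha>) * f y else 0)
          \<le> a\<^sup>2 * ?near (x - y) + a * R powr (- \<beta> / 2) * f y powr q + a * R powr (- \<beta> / 2) * R powr ?N * ?far (x - y)" for y
      proof (cases "f y \<le> f x")
        case True
        let ?r = "norm (x - y)"
        have nn: "0 \<le> a * R powr (- \<beta> / 2) * f y powr q" "0 \<le> a * R powr (- \<beta> / 2) * R powr ?N * ?far (x - y)"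
          "0 \<le> a\<^sup>2 * ?near (x - y)"
          using a by auto
        have lhs: "(if f y \<le> f x then f x * ?r powr - (?N - \<alpha>) * f y else 0) = a * ?r powr (- \<beta>) * f y"
          using True by (simp add: a_def \<beta>_def)
        show ?thesis unfolding lhs
        proof (cases "?r < R")
          case near: True
          have "a * ?r powr (- \<beta>) * f y \<le> a * ?r powr (- \<beta>) * a"
            using True a by (intro mult_left_mono) (auto simp: a_def)
          then have "a * ?r powr (- \<beta>) * f y \<le> a\<^sup>2 * ?near (x - y)"
            using near by (simp add: power2_eq_square mult_ac)
          then show "a * ?r powr (- \<beta>) * f y
              \<le> a\<^sup>2 * ?near (x - y) + a * R powr (- \<beta> / 2) * f y powr q + a * R powr (- \<beta> / 2) * R powr ?N * ?far (x - y)"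
            using nn by linarith
        next
          case far: False
          \<comment> \<open>The factor \<open>R powr (\<beta> / 2)\<close> turns the Young term into
            \<open>R powr N * norm z powr (- 2 * N)\<close>, whose integral over the outer region is
            bounded independently of \<open>R\<close>; both outer contributions then carry the same
            factor \<open>a * R powr (- \<beta> / 2)\<close>.\<close>
          define b where "b = ?r powr (- \<beta>) * R powr (\<beta> / 2)"
          have "f y * b \<le> f y powr q / q + b powr q' / q'"
            by (rule Youngs_inequality[OF q f0]) (simp add: b_def)
          also have "\<dots> \<le> f y powr q / 1 + b powr q' / 1"
            using q by (intro add_mono divide_left_mono) auto
          also have "b powr q' = ?r powr (- 2 * ?N) * R powr ?N"
            using \<beta> R by (simp add: b_def q'_def powr_mult powr_powr)
          finally have *: "f y * b \<le> f y powr q + ?r powr (- 2 * ?N) * R powr ?N" by simp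
          have "a * ?r powr (- \<beta>) * f y = a * R powr (- \<beta> / 2) * (f y * b)"
            using R by (simp add: b_def powr_add[symmetric] mult_ac flip: powr_add)
          also have "\<dots> \<le> a * R powr (- \<beta> / 2) * (f y powr q + ?r powr (- 2 * ?N) * R powr ?N)"
            using a * by (intro mult_left_mono) auto
          finally have "a * ?r powr (- \<beta>) * f y
              \<le> a * R powr (- \<beta> / 2) * f y powr q + a * R powr (- \<beta> / 2) * R powr ?N * ?far (x - y)"
            using far by (simp add: algebra_simps)
          then show "a * ?r powr (- \<beta>) * f y
              \<le> a\<^sup>2 * ?near (x - y) + a * R powr (- \<beta> / 2) * f y powr q + a * R powr (- \<beta> / 2) * R powr ?N * ?far (x - y)"
            using nn by linarith
        qed
      qed (use a in auto)
      have [measurable]: "?near \<in> borel_measurable borel" "?far \<in> borel_measurable borel" by measurable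
      have "(\<integral>\<^sup>+y. (if f y \<le> f x then f x * norm (x - y) powr - (?N - \<alpha>) * f y else 0) \<partial>lborel)
          \<le> (\<integral>\<^sup>+y. ennreal (a\<^sup>2) * ennreal (?near (x - y)) + (ennreal (a * R powr (- \<beta> / 2)) * ennreal (f y powr q)
              + ennreal (a * R powr (- \<beta> / 2) * R powr ?N) * ennreal (?far (x - y))) \<partial>lborel)"
      proof (rule nn_integral_mono)
        fix y
        show "ennreal (if f y \<le> f x then f x * norm (x - y) powr - (?N - \<alpha>) * f y else 0)
          \<le> ennreal (a\<^sup>2) * ennreal (?near (x - y)) + (ennreal (a * R powr (- \<beta> / 2)) * ennreal (f y powr q)
              + ennreal (a * R powr (- \<beta> / 2) * R powr ?N) * ennreal (?far (x - y)))"
          using a ennreal_leI[OF split[of y]]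
          by (simp add: ennreal_mult'[symmetric] ennreal_plus[symmetric] add.assoc del: ennreal_plus)
      qed
      also have "\<dots> = ennreal (a\<^sup>2) * (\<integral>\<^sup>+z. ennreal (?near z) \<partial>lborel)
          + (ennreal (a * R powr (- \<beta> / 2)) * (\<integral>\<^sup>+y. ennreal (f y powr q) \<partial>lborel)
          + ennreal (a * R powr (- \<beta> / 2) * R powr ?N) * (\<integral>\<^sup>+z. ennreal (?far z) \<partial>lborel))"
        using nn_integral_reflect[of "\<lambda>z. ennreal (?near z)" x] nn_integral_reflect[of "\<lambda>z. ennreal (?far z)" x]
        by (simp add: nn_integral_add nn_integral_cmult)
      also have "\<dots> \<le> ennreal (a\<^sup>2) * ennreal (C1 * R powr (?N - \<beta>))
          + (ennreal (a * R powr (- \<beta> / 2)) * ennreal J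
          + ennreal (a * R powr (- \<beta> / 2) * R powr ?N) * ennreal (C2 * R powr (- ?N)))"
        using J C1(2)[OF R] C2(2)[OF R] by (intro add_mono mult_left_mono) (auto simp: q_def)
      also have "\<dots> = ennreal (a\<^sup>2 * (C1 * R powr (?N - \<beta>)) + (a * R powr (- \<beta> / 2) * J
          + a * R powr (- \<beta> / 2) * R powr ?N * (C2 * R powr (- ?N))))"
        using a C1 C2 J by (simp add: ennreal_mult'[symmetric] ennreal_plus[symmetric] del: ennreal_plus)
      also have "a\<^sup>2 * (C1 * R powr (?N - \<beta>)) + (a * R powr (- \<beta> / 2) * J
          + a * R powr (- \<beta> / 2) * R powr ?N * (C2 * R powr (- ?N))) = C * a powr q"
      proof -
        have e1: "a\<^sup>2 * R powr (?N - \<beta>) = a powr q"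
        proof -
          have "a\<^sup>2 * R powr (?N - \<beta>) = a powr (2 + (- 2 / (?N + \<alpha>)) * (?N - \<beta>))"
            using a by (simp only: R_def powr_powr powr_add) simp
          also have "2 + (- 2 / (?N + \<alpha>)) * (?N - \<beta>) = q" using \<alpha> by (simp add: q_def \<beta>_def field_simps)
          finally show ?thesis .
        qed
        have e2: "a * R powr (- \<beta> / 2) = a powr q"
        proof -
          have "a * R powr (- \<beta> / 2) = a powr (1 + (- 2 / (?N + \<alpha>)) * (- \<beta> / 2))"
            using a by (simp only: R_def powr_powr powr_add) simp
          also have "1 + (- 2 / (?N + \<alpha>)) * (- \<beta> / 2) = q" using \<alpha> by (simp add: q_def \<beta>_def field_simps)
          finally show ?thesis .
        qed
        have e3: "R powr ?N * R powr (- ?N) = 1" using R by (simp flip: powr_add)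
        have "a\<^sup>2 * (C1 * R powr (?N - \<beta>)) + (a * R powr (- \<beta> / 2) * J
          + a * R powr (- \<beta> / 2) * R powr ?N * (C2 * R powr (- ?N)))
          = C1 * (a\<^sup>2 * R powr (?N - \<beta>)) + J * (a * R powr (- \<beta> / 2))
            + C2 * (a * R powr (- \<beta> / 2)) * (R powr ?N * R powr (- ?N))" by (simp only: mult_ac add_ac)
        then show ?thesis unfolding e1 e2 e3 by (simp add: C_def algebra_simps)
      qed
      finally show ?thesis by (simp add: a_def q_def)
    qed
  qed
qed

text \<open>Whichever of \<open>f x\<close> and \<open>f y\<close> is larger, the integrand is at
  most \<open>G x y + G y x\<close>, and both halves have the same integral by Tonelli. Only
  finiteness is asserted: the constant of the inner estimate depends on the integral of the power of
  \<open>f\<close>.\<close>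

lemma hls_finite:
  fixes f :: "'a::euclidean_space \<Rightarrow> real" and \<alpha> :: real
  assumes \<alpha>: "0 < \<alpha>" "\<alpha> < DIM('a)" and fm[measurable]: "f \<in> borel_measurable borel" and f0: "\<And>x. 0 \<le> f x"
    and fq: "integrable lborel (\<lambda>x. f x powr (2 * real DIM('a) / (real DIM('a) + \<alpha>)))"
  shows "integrable (lborel \<Otimes>\<^sub>M lborel) (\<lambda>(x, y). f x * norm (x - y) powr - (real DIM('a) - \<alpha>) * f y)"
proof -
  let ?N = "real DIM('a)"
  let ?q = "2 * ?N / (?N + \<alpha>)"
  define G where "G x y = (if f y \<le> f x then f x * norm (x - y) powr - (?N - \<alpha>) * f y else 0)" for x y
  have Gm[measurable]: "(\<lambda>(x, y). G x y) \<in> borel_measurable (borel \<Otimes>\<^sub>M borel)"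
    unfolding G_def by measurable
  have G0: "0 \<le> G x y" for x y using f0 by (simp add: G_def)
  have J: "(\<integral>\<^sup>+x. f x powr ?q \<partial>lborel) = ennreal (LBINT x. f x powr ?q)"
    by (rule nn_integral_eq_integral[OF fq]) simp
  obtain C where C: "0 \<le> C" "\<And>x. (\<integral>\<^sup>+y. G x y \<partial>lborel) \<le> ennreal (C * f x powr ?q)"
    unfolding G_def
    using hls_inner_estimate[OF \<alpha> fm f0, of "LBINT x. f x powr ?q"] J by (auto simp: integral_nonneg_AE)
  have "(\<integral>\<^sup>+x. \<integral>\<^sup>+y. G x y \<partial>lborel \<partial>lborel) \<le> (\<integral>\<^sup>+x. ennreal (C * f x powr ?q) \<partial>lborel)"
    by (intro nn_integral_mono C)
  also have "\<dots> = ennreal (LBINT x. C * f x powr ?q)"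
    by (intro nn_integral_eq_integral integrable_mult_right fq AE_I2) (simp add: C)
  also have "\<dots> < \<infinity>" by simp
  finally have GI: "(\<integral>\<^sup>+x. \<integral>\<^sup>+y. G x y \<partial>lborel \<partial>lborel) < \<infinity>" .
  have GI': "(\<integral>\<^sup>+x. \<integral>\<^sup>+y. G y x \<partial>lborel \<partial>lborel) < \<infinity>"
    using GI by (subst lborel_pair.Fubini') (auto)
  show ?thesis
  proof (rule integrableI_bounded)
    have "(\<integral>\<^sup>+z. ennreal (norm (case z of (x, y) \<Rightarrow> f x * norm (x - y) powr - (?N - \<alpha>) * f y)) \<partial>(lborel \<Otimes>\<^sub>M lborel))
      = (\<integral>\<^sup>+x. \<integral>\<^sup>+y. ennreal (f x * norm (x - y) powr - (?N - \<alpha>) * f y) \<partial>lborel \<partial>lborel)"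
      by (subst lborel.nn_integral_fst[symmetric]) (auto simp: f0 abs_mult)
    also have "\<dots> \<le> (\<integral>\<^sup>+x. \<integral>\<^sup>+y. ennreal (G x y) + ennreal (G y x) \<partial>lborel \<partial>lborel)"
    proof (intro nn_integral_mono)
      fix x y
      have "f x * norm (x - y) powr - (?N - \<alpha>) * f y \<le> G x y + G y x"
        using f0 by (cases "f y \<le> f x") (auto simp: G_def norm_minus_commute mult_ac)
      then show "ennreal (f x * norm (x - y) powr - (?N - \<alpha>) * f y) \<le> ennreal (G x y) + ennreal (G y x)"
        by (simp add: ennreal_plus[symmetric] G0 ennreal_leI del: ennreal_plus)
    qed
    also have "\<dots> = (\<integral>\<^sup>+x. \<integral>\<^sup>+y. G x y \<partial>lborel \<partial>lborel) + (\<integral>\<^sup>+x. \<integral>\<^sup>+y. G y x \<partial>lborel \<partial>lborel)"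
      by (simp add: nn_integral_add)
    also have "\<dots> < \<infinity>" using GI GI' by simp
    finally show "(\<integral>\<^sup>+z. ennreal (norm (case z of (x, y) \<Rightarrow> f x * norm (x - y) powr - (?N - \<alpha>) * f y)) \<partial>(lborel \<Otimes>\<^sub>M lborel)) < \<infinity>" .
  qed measurable
qed

subsection \<open>Radial test fields and smooth approximation\<close>

text \<open>Integrability is bundled with convergence so that limits of finite sums can be assembled
  term by term.\<close>

definition lim_int :: "(nat \<Rightarrow> 'a::euclidean_space \<Rightarrow> real) \<Rightarrow> ('a \<Rightarrow> real) \<Rightarrow> bool" where
  "lim_int F G \<longleftrightarrow> (\<forall>n. integrable lborel (F n)) \<and> integrable lborel G \<and>
     (\<lambda>n. LBINT x. F n x) \<longlonglongrightarrow> (LBINT x. G x)"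

lemma lim_int_add:
  "lim_int F G \<Longrightarrow> lim_int F' G' \<Longrightarrow> lim_int (\<lambda>n x. F n x + F' n x) (\<lambda>x. G x + G' x)"
  unfolding lim_int_def by (auto intro: tendsto_add)

lemma lim_int_sum:
  assumes "\<And>i. i \<in> I \<Longrightarrow> lim_int (F i) (G i)"
  shows "lim_int (\<lambda>n x. \<Sum>i\<in>I. F i n x) (\<lambda>x. \<Sum>i\<in>I. G i x)"
  using assms unfolding lim_int_def by (auto intro: tendsto_sum)

lemma lim_int_unique_0:
  assumes "lim_int F G" "\<And>n. (LBINT x. F n x) = 0"
  shows "(LBINT x. G x) = 0"
  using assms unfolding lim_int_def by (simp add: LIMSEQ_const_iff)

lemma abs_mult_le_if_squares_le:
  fixes a b h :: real
  assumes "a\<^sup>2 \<le> h" "b\<^sup>2 \<le> h" shows "\<bar>a * b\<bar> \<le> h"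
proof -
  have "0 \<le> (\<bar>a\<bar> - \<bar>b\<bar>)\<^sup>2" by simp
  then have "2 * (\<bar>a\<bar> * \<bar>b\<bar>) \<le> a\<^sup>2 + b\<^sup>2" by (simp add: power2_diff)
  then show ?thesis using assms by (simp add: abs_mult)
qed

text \<open>Squares are dominated because the local integrals pair two such sequences: by
  \<open>abs_mult_le_if_squares_le\<close> the same \<open>H\<close> bounds their product. The ball
  of radius \<open>m\<close> is the one that carries the cut-offs.\<close>

definition dominated_seq :: "real \<Rightarrow> ('a::euclidean_space \<Rightarrow> real) \<Rightarrow> (nat \<Rightarrow> 'a \<Rightarrow> real) \<Rightarrow> ('a \<Rightarrow> real) \<Rightarrow> bool" where
  "dominated_seq m H A B \<longleftrightarrow> (\<forall>n. A n \<in> borel_measurable borel) \<and> B \<in> borel_measurable borel \<and>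
     (AE x in lborel. norm x \<le> m \<longrightarrow> (\<forall>n. (A n x)\<^sup>2 \<le> H x) \<and> (B x)\<^sup>2 \<le> H x \<and> (\<lambda>n. A n x) \<longlonglongrightarrow> B x)"

lemma dominated_seq_const: "dominated_seq m H A B \<Longrightarrow> dominated_seq m H (\<lambda>n. B) B"
  unfolding dominated_seq_def by (auto elim: eventually_mono)

text \<open>The summand 1 in the bound leaves room for powers below \<open>r\<close>, as in
  \<open>t powr p \<le> 1 + t powr r\<close>; it stays integrable because the weight lives on a
  ball.\<close>

lemma lim_int_weight:
  fixes w :: "'a::euclidean_space \<Rightarrow> real"
  assumes H: "integrable lborel H" and w: "continuous_on UNIV w" "\<And>x. norm x > m \<Longrightarrow> w x = 0"
    and Am [measurable]: "\<And>n. A n \<in> borel_measurable borel" "B \<in> borel_measurable borel"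
    and A: "AE x in lborel. norm x \<le> m \<longrightarrow> (\<forall>n. \<bar>A n x\<bar> \<le> 1 + H x) \<and> (\<lambda>n. A n x) \<longlonglongrightarrow> B x"
  shows "lim_int (\<lambda>n x. w x * A n x) (\<lambda>x. w x * B x)"
proof -
  obtain M where M: "0 \<le> M" "\<And>x. \<bar>w x\<bar> \<le> M"
    using bounded_continuous_compact_support[OF w] by blast
  have [measurable]: "w \<in> borel_measurable borel" using w(1) by (rule borel_measurable_continuous_onI)
  let ?G = "\<lambda>x. M * (indicator (cball 0 m) x + \<bar>H x\<bar>)"
  have Gi: "integrable lborel ?G"
    by (intro integrable_mult_right Bochner_Integration.integrable_add integrable_indicator_cball
        Bochner_Integration.integrable_abs H)
  have wA: "\<bar>w x * a\<bar> \<le> ?G x" if "norm x \<le> m \<longrightarrow> \<bar>a\<bar> \<le> 1 + H x" for x a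
  proof (cases "norm x \<le> m")
    case True
    then show ?thesis using that M unfolding abs_mult by (intro mult_mono) auto
  qed (use w(2) M in auto)
  have d: "AE x in lborel. norm (w x * A n x) \<le> ?G x" for n
    using A by eventually_elim (use wA in auto)
  have l: "AE x in lborel. (\<lambda>n. w x * A n x) \<longlonglongrightarrow> w x * B x"
    using A
  proof eventually_elim
    case (elim x)
    then show ?case using w(2)[of x] by (cases "norm x \<le> m") (auto intro!: tendsto_mult_left)
  qed
  have m1: "(\<lambda>x. w x * A n x) \<in> borel_measurable lborel" "(\<lambda>x. w x * B x) \<in> borel_measurable lborel" for n
    by simp_all
  show ?thesis unfolding lim_int_def
    using integrable_dominated_convergence2[OF m1(2) m1(1) Gi l d] integrable_dominated_convergence[OF m1(2) m1(1) Gi l d]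
      integral_dominated_convergence[OF m1(2) m1(1) Gi l d] by blast
qed

lemma lim_int_mult:
  fixes w :: "'a::euclidean_space \<Rightarrow> real"
  assumes H: "integrable lborel H" and w: "continuous_on UNIV w" "\<And>x. norm x > m \<Longrightarrow> w x = 0"
    and A: "dominated_seq m H A A'" and B: "dominated_seq m H B B'"
  shows "lim_int (\<lambda>n x. w x * (A n x * B n x)) (\<lambda>x. w x * (A' x * B' x))"
proof (rule lim_int_weight[OF H w])
  have [measurable]: "A n \<in> borel_measurable borel" "B n \<in> borel_measurable borel"
     "A' \<in> borel_measurable borel" "B' \<in> borel_measurable borel" for n
    using A B by (auto simp: dominated_seq_def)
  show "(\<lambda>x. A n x * B n x) \<in> borel_measurable borel" "(\<lambda>x. A' x * B' x) \<in> borel_measurable borel" for n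
    by simp_all
  have "AE x in lborel. norm x \<le> m \<longrightarrow> (\<forall>n. (A n x)\<^sup>2 \<le> H x) \<and> (A' x)\<^sup>2 \<le> H x \<and> (\<lambda>n. A n x) \<longlonglongrightarrow> A' x"
    "AE x in lborel. norm x \<le> m \<longrightarrow> (\<forall>n. (B n x)\<^sup>2 \<le> H x) \<and> (B' x)\<^sup>2 \<le> H x \<and> (\<lambda>n. B n x) \<longlonglongrightarrow> B' x"
    using A B by (auto simp: dominated_seq_def)
  then show "AE x in lborel. norm x \<le> m \<longrightarrow>
      (\<forall>n. \<bar>A n x * B n x\<bar> \<le> 1 + H x) \<and> (\<lambda>n. A n x * B n x) \<longlonglongrightarrow> A' x * B' x"
  proof eventually_elim
    case (elim x)
    have "\<bar>A n x * B n x\<bar> \<le> 1 + H x" if "norm x \<le> m" for n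
      using abs_mult_le_if_squares_le[of "A n x" "H x" "B n x"] elim that by (simp add: add_increasing)
    then show ?case using elim by (auto intro: tendsto_mult)
  qed
qed

text \<open>With \<open>P = cutP m\<close> and \<open>Q = cutQ m\<close> one has \<open>\<nabla>P = - Q x\<close>, and \<open>cutD m\<close> is the divergence of the field
  \<open>x \<mapsto> P(x) x\<close>. The factor \<open>exp 1\<close> normalises \<open>P(0) = 1\<close>.\<close>

definition cutP :: "real \<Rightarrow> 'a::euclidean_space \<Rightarrow> real" where
  "cutP m x = exp 1 * bump 0 ((1 / m)\<^sup>2) x"

definition cutQ :: "real \<Rightarrow> 'a::euclidean_space \<Rightarrow> real" where
  "cutQ m x = 2 * (1 / m)\<^sup>2 * exp 1 * bump 2 ((1 / m)\<^sup>2) x"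

definition cutD :: "real \<Rightarrow> 'a::euclidean_space \<Rightarrow> real" where
  "cutD m x = DIM('a) * cutP m x - cutQ m x * (x \<bullet> x)"

lemma cut_support: "0 < m \<Longrightarrow> m \<le> norm x \<Longrightarrow> cutP m x = 0 \<and> cutQ m x = 0 \<and> cutD m x = 0"
  unfolding cutP_def cutQ_def cutD_def using bump_support[of "1 / m" x] by simp

lemma cutP_has_derivative: "(cutP m has_derivative (\<lambda>h. - cutQ m x * (x \<bullet> h))) (at x)"
proof -
  have "((\<lambda>x. exp 1 * bump 0 ((1 / m)\<^sup>2) x) has_derivative
     (\<lambda>h. exp 1 * ((bump (0 + 2) ((1 / m)\<^sup>2) x - real 0 * bump (0 + 1) ((1 / m)\<^sup>2) x) * (- 2 * (1 / m)\<^sup>2 * (x \<bullet> h))))) (at x)"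
    by (rule has_derivative_mult_right[OF bump_has_derivative])
  then show ?thesis unfolding cutP_def[abs_def] cutQ_def
    by (rule has_derivative_eq_rhs) (simp add: fun_eq_iff numeral_2_eq_2)
qed

lemma smooth_cutP: "smooth (cutP m)"
  unfolding cutP_def[abs_def] using Ck_mult[OF Ck_const Ck_bump] by blast

lemma cut_continuous [continuous_intros]:
  "continuous_on S (cutP m)" "continuous_on S (cutQ m)" "continuous_on S (cutD m)"
proof -
  have b: "continuous_on UNIV (bump j \<kappa> :: 'a \<Rightarrow> real)" for j \<kappa> by (rule bump_continuous)
  have P: "continuous_on UNIV (cutP m :: 'a \<Rightarrow> real)"
    unfolding cutP_def[abs_def] by (intro continuous_intros b)
  have Q: "continuous_on UNIV (cutQ m :: 'a \<Rightarrow> real)"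
    unfolding cutQ_def[abs_def] by (intro continuous_intros b)
  have D: "continuous_on UNIV (cutD m :: 'a \<Rightarrow> real)"
    unfolding cutD_def[abs_def] by (intro continuous_intros P Q)
  show "continuous_on S (cutP m)" "continuous_on S (cutQ m)" "continuous_on S (cutD m)"
    using P Q D continuous_on_subset by blast+
qed

text \<open>The divergence theorem for the compactly supported field \<open>cutP m x * S x\<close>
  times \<open>x\<close>, obtained by integrating each diagonal derivative separately.\<close>

lemma radial_integration_by_parts:
  fixes S :: "'a::euclidean_space \<Rightarrow> real"
  assumes m: "0 < m" and S: "\<And>x. (S has_derivative S' x) (at x)"
    and S'c: "\<And>b. b \<in> Basis \<Longrightarrow> continuous_on UNIV (\<lambda>x. S' x b)"
  shows "(LBINT x. cutD m x * S x + (\<Sum>b\<in>Basis. cutP m x * (x \<bullet> b) * S' x b)) = 0"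
proof -
  have Sc: "continuous_on UNIV S"
    by (intro continuous_at_imp_continuous_on ballI) (rule has_derivative_continuous[OF S])
  let ?f = "\<lambda>b x. cutP m x * (x \<bullet> b) * S x"
  let ?f' = "\<lambda>b x h. cutP m x * (x \<bullet> b) * S' x h + (cutP m x * (h \<bullet> b) + - cutQ m x * (x \<bullet> h) * (x \<bullet> b)) * S x"
  have d: "(?f b has_derivative ?f' b x) (at x)" for b x
    by (intro has_derivative_mult cutP_has_derivative S bounded_linear.has_derivative[OF bounded_linear_inner_left]) simp
  have c: "continuous_on UNIV (\<lambda>x. ?f' b x b)" if "b \<in> Basis" for b
    by (intro continuous_intros S'c[OF that] Sc)
  have z: "?f b x = 0" "?f' b x h = 0" if "norm x > m" for b x h
    using cut_support[OF m, of x] that by auto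
  have i: "integrable lborel (\<lambda>x. ?f' b x b)" if "b \<in> Basis" for b
    by (rule continuous_compact_support_integrable[OF c[OF that] z(2)])
  have "(LBINT x. (\<Sum>b\<in>Basis. ?f' b x b)) = (\<Sum>b\<in>Basis. LBINT x. ?f' b x b)"
    using i by (rule Bochner_Integration.integral_sum)
  also have "\<dots> = 0"
    by (intro sum.neutral ballI integral_directional_derivative_eq_0[OF d c z(1)])
  also have "(\<lambda>x. \<Sum>b\<in>Basis. ?f' b x b) = (\<lambda>x. cutD m x * S x + (\<Sum>b\<in>Basis. cutP m x * (x \<bullet> b) * S' x b))"
  proof
    fix x :: 'a
    have "(\<Sum>b\<in>Basis. ?f' b x b) = (\<Sum>b\<in>Basis. cutP m x * (x \<bullet> b) * S' x b) + (\<Sum>b\<in>(Basis::'a set). cutP m x * S x)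
       - (\<Sum>b\<in>Basis. cutQ m x * S x * ((x \<bullet> b) * (x \<bullet> b)))"
    proof -
      have "(\<Sum>b\<in>Basis. ?f' b x b) = (\<Sum>b\<in>Basis. cutP m x * (x \<bullet> b) * S' x b + cutP m x * S x
         - cutQ m x * S x * ((x \<bullet> b) * (x \<bullet> b)))"
        by (rule sum.cong) (auto simp: algebra_simps)
      then show ?thesis by (simp only: sum.distrib sum_subtractf)
    qed
    also have "(\<Sum>b\<in>Basis. cutQ m x * S x * ((x \<bullet> b) * (x \<bullet> b))) = cutQ m x * S x * (x \<bullet> x)"
      unfolding sum_distrib_left[symmetric] euclidean_inner[of x x, symmetric] ..
    finally show "(\<Sum>b\<in>Basis. ?f' b x b) = cutD m x * S x + (\<Sum>b\<in>Basis. cutP m x * (x \<bullet> b) * S' x b)"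
      by (simp add: cutD_def algebra_simps)
  qed
  finally show ?thesis .
qed

section \<open>Derivatives of mollified functions\<close>

lemma moll_zero: "norm x > 1 / (real n + 1) \<longrightarrow> moll n x = 0"
  using moll_support by blast

lemma pd_conv_moll:
  assumes "locint f" "b \<in> Basis"
  shows "pd b (conv (moll n) f) = conv (pd b (moll n)) f"
  by (rule pd_conv[OF assms(1) smooth_moll moll_zero[rule_format] assms(2)])

lemma pd_pd_conv_moll:
  assumes "locint f" "b \<in> Basis" "c \<in> Basis"
  shows "pd c (pd b (conv (moll n) f)) = conv (pd c (pd b (moll n))) f"
  unfolding pd_conv_moll[OF assms(1,2)]
  by (rule pd_conv[OF assms(1) smooth_pd[OF smooth_moll assms(2)] pd_eq_0_outside[OF moll_zero[rule_format]] assms(3)])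

lemma smooth_conv_moll: "locint f \<Longrightarrow> smooth (conv (moll n) f)"
  using Ck_conv[OF _ smooth_moll moll_zero[rule_format]] by blast

lemma pd_conv_moll_weak:
  assumes "locint u" "b \<in> Basis"
    and "\<And>\<phi>. \<phi> \<in> test_functions \<Longrightarrow> (LBINT x. u x * pd b \<phi> x) = - (LBINT x. g x * \<phi> x)"
  shows "pd b (conv (moll n) u) = conv (moll n) g"
  unfolding pd_conv_moll[OF assms(1,2)]
  by (rule ext) (rule conv_weak_derivative[OF assms(3) smooth_moll moll_zero[rule_format]])

text \<open>Here \<open>g b\<close> is the \<open>b\<close>-component of \<open>\<nabla>u\<close>, and \<open>h b c\<close> is the weak \<open>c\<close>-derivative of \<open>g b\<close>. All
  representatives are Borel, so that Tonelli's theorem applies to the product of two copies of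
  \<open>lborel\<close>.\<close>

locale sobolev_data =
  fixes u :: "'a::euclidean_space \<Rightarrow> real" and g :: "'a \<Rightarrow> 'a \<Rightarrow> real" and h :: "'a \<Rightarrow> 'a \<Rightarrow> 'a \<Rightarrow> real"
    and r :: real
  assumes r: "1 < r"
    and um [measurable]: "u \<in> borel_measurable borel"
    and gm [measurable]: "\<And>b. b \<in> Basis \<Longrightarrow> g b \<in> borel_measurable borel"
    and hm [measurable]: "\<And>b c. b \<in> Basis \<Longrightarrow> c \<in> Basis \<Longrightarrow> h b c \<in> borel_measurable borel"
    and u2: "integrable lborel (\<lambda>x. (u x)\<^sup>2)"
    and ur: "integrable lborel (\<lambda>x. \<bar>u x\<bar> powr r)"
    and g2: "\<And>b. b \<in> Basis \<Longrightarrow> integrable lborel (\<lambda>x. (g b x)\<^sup>2)"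
    and gr: "\<And>b R. b \<in> Basis \<Longrightarrow> integrable lborel (\<lambda>x. indicator (cball 0 R) x * \<bar>g b x\<bar> powr r)"
    and h2: "\<And>b c R. b \<in> Basis \<Longrightarrow> c \<in> Basis \<Longrightarrow> integrable lborel (\<lambda>x. indicator (cball 0 R) x * (h b c x)\<^sup>2)"
    and weak_g: "\<And>\<phi> b. \<phi> \<in> test_functions \<Longrightarrow> b \<in> Basis \<Longrightarrow>
       (LBINT x. u x * pd b \<phi> x) = - (LBINT x. g b x * \<phi> x)"
    and weak_h: "\<And>\<phi> b c. \<phi> \<in> test_functions \<Longrightarrow> b \<in> Basis \<Longrightarrow> c \<in> Basis \<Longrightarrow>
       (LBINT x. g b x * pd c \<phi> x) = - (LBINT x. h b c x * \<phi> x)"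
begin

text \<open>Derivatives of a mollified function are mollifications of the weak derivatives. Hence
  one sequence of mollifiers, fast enough for \<open>u\<close>, \<open>g\<close> and
  \<open>h\<close> together, approximates \<open>u\<close> along with its derivatives.\<close>

lemma smooth_approximation:
  obtains U H where "\<And>n. smooth (U n)"
    "\<And>n b c x. b \<in> Basis \<Longrightarrow> c \<in> Basis \<Longrightarrow> pd c (pd b (U n)) x = pd b (pd c (U n)) x"
    "integrable lborel H" "\<And>x. 0 \<le> H x"
    "dominated_seq m H U u"
    "\<And>b. b \<in> Basis \<Longrightarrow> dominated_seq m H (\<lambda>n. pd b (U n)) (g b)"
    "\<And>b c. b \<in> Basis \<Longrightarrow> c \<in> Basis \<Longrightarrow> dominated_seq m H (\<lambda>n. pd c (pd b (U n))) (h b c)"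
    "AE x in lborel. norm x \<le> m \<longrightarrow> \<bar>u x\<bar> powr r \<le> H x \<and> (\<forall>n. \<bar>U n x\<bar> powr r \<le> H x) \<and>
       (\<forall>b\<in>Basis. \<bar>g b x\<bar> powr r \<le> H x \<and> (\<forall>n. \<bar>pd b (U n) x\<bar> powr r \<le> H x))"
proof -
  \<comment> \<open>\<open>u\<close> and \<open>g\<close> occur with both exponents 2 and
    \<open>r\<close>, the second derivatives with 2 only; the finite index set yields a single
    majorant \<open>H\<close> for all of them.\<close>
  define I where "I = {(u, 2), (u, r)} \<union> (\<lambda>b. (g b, 2)) ` Basis \<union> (\<lambda>b. (g b, r)) ` Basis
     \<union> (\<lambda>(b, c). (h b c, 2)) ` (Basis \<times> Basis)"
  have sq: "\<bar>a\<bar> powr 2 = a\<^sup>2" for a :: real by (simp add: powr_numeral)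
  have fin: "finite I" unfolding I_def by simp
  have Im: "fst i \<in> borel_measurable borel" if "i \<in> I" for i using that by (auto simp: I_def um gm hm)
  have Iq: "1 < snd i" if "i \<in> I" for i using that r by (auto simp: I_def)
  have Ii: "integrable lborel (\<lambda>x. indicator (cball 0 R) x * \<bar>fst i x\<bar> powr snd i)" if "i \<in> I" for i R
    using that by (auto simp: I_def sq intro: gr h2 integrable_indicator_mult[OF u2]
      integrable_indicator_mult[OF ur] integrable_indicator_mult[OF g2])
  obtain k H where H: "integrable lborel H" "\<And>x. 0 \<le> H x" and
    ae: "AE x in lborel. norm x \<le> m \<longrightarrow> (\<forall>i\<in>I. (\<forall>n. \<bar>conv (moll (k n)) (fst i) x\<bar> powr snd i \<le> H x) \<and>
       \<bar>fst i x\<bar> powr snd i \<le> H x \<and> (\<lambda>n. conv (moll (k n)) (fst i) x) \<longlonglongrightarrow> fst i x)"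
    using fast_mollifier_sequence[of I fst snd m, OF fin Im Iq Ii] by blast
  have lu: "locint u" by (rule locint_of_powr[of u 2]) (use integrable_indicator_mult[OF u2] in \<open>auto simp: sq\<close>)
  have lg: "locint (g b)" if "b \<in> Basis" for b
    by (rule locint_of_powr[of "g b" 2]) (use integrable_indicator_mult[OF g2[OF that]] gm[OF that] in \<open>auto simp: sq\<close>)
  have lh: "locint (h b c)" if "b \<in> Basis" "c \<in> Basis" for b c
    by (rule locint_of_powr[of "h b c" 2]) (use h2[OF that] hm[OF that] in \<open>auto simp: sq\<close>)
  define U where "U n = conv (moll (k n)) u" for n
  have U1: "pd b (U n) = conv (moll (k n)) (g b)" if "b \<in> Basis" for n b
    unfolding U_def by (rule pd_conv_moll_weak[OF lu that weak_g[OF _ that]])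
  have U2: "pd c (pd b (U n)) = conv (moll (k n)) (h b c)" if "b \<in> Basis" "c \<in> Basis" for n b c
    unfolding U1[OF that(1)] by (rule pd_conv_moll_weak[OF lg[OF that(1)] that(2) weak_h[OF _ that]])
  have dom: "dominated_seq m H (\<lambda>n. conv (moll (k n)) f) f" if "(f, 2) \<in> I" for f
    unfolding dominated_seq_def
  proof (intro conjI allI)
    show "f \<in> borel_measurable borel" "conv (moll (k n)) f \<in> borel_measurable borel" for n
      using Im[OF that] by auto
    show "AE x in lborel. norm x \<le> m \<longrightarrow> (\<forall>n. (conv (moll (k n)) f x)\<^sup>2 \<le> H x) \<and>
        (f x)\<^sup>2 \<le> H x \<and> (\<lambda>n. conv (moll (k n)) f x) \<longlonglongrightarrow> f x"
      using ae
    proof eventually_elim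
      case (elim x)
      then show ?case using that by (force simp: sq)
    qed
  qed
  show thesis
  proof (rule that[of U H])
    show "smooth (U n)" for n unfolding U_def by (rule smooth_conv_moll[OF lu])
    show "pd c (pd b (U n)) x = pd b (pd c (U n)) x" if "b \<in> Basis" "c \<in> Basis" for n b c x
    proof -
      \<comment> \<open>Both derivatives are moved onto the mollifier, where they commute.\<close>
      have "pd c (pd b (U n)) = conv (pd c (pd b (moll (k n)))) u" if "b \<in> Basis" "c \<in> Basis" for b c
        unfolding U_def by (rule pd_pd_conv_moll[OF lu that])
      then have "pd c (pd b (U n)) x = conv (pd c (pd b (moll (k n)))) u x"
        "pd b (pd c (U n)) x = conv (pd b (pd c (moll (k n)))) u x"
        using that by metis+
      then show ?thesis unfolding conv_def using pd_pd_moll_commute[OF that] by (simp cong: Bochner_Integration.integral_cong)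
    qed
    show "dominated_seq m H U u" unfolding U_def by (rule dom) (simp add: I_def)
    show "dominated_seq m H (\<lambda>n. pd b (U n)) (g b)" if "b \<in> Basis" for b
      unfolding U1[OF that] by (rule dom) (use that in \<open>simp add: I_def\<close>)
    show "dominated_seq m H (\<lambda>n. pd c (pd b (U n))) (h b c)" if "b \<in> Basis" "c \<in> Basis" for b c
      unfolding U2[OF that] by (rule dom) (use that in \<open>auto simp: I_def\<close>)
    show "AE x in lborel. norm x \<le> m \<longrightarrow> \<bar>u x\<bar> powr r \<le> H x \<and> (\<forall>n. \<bar>U n x\<bar> powr r \<le> H x) \<and>
       (\<forall>b\<in>Basis. \<bar>g b x\<bar> powr r \<le> H x \<and> (\<forall>n. \<bar>pd b (U n) x\<bar> powr r \<le> H x))"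
      using ae
    proof eventually_elim
      case (elim x)
      have "(u, r) \<in> I" by (simp add: I_def)
      show ?case
      proof (intro impI conjI ballI allI)
        assume x: "norm x \<le> m"
        show "\<bar>u x\<bar> powr r \<le> H x" "\<bar>U n x\<bar> powr r \<le> H x" for n
          using bspec[OF mp[OF elim x] \<open>(u, r) \<in> I\<close>] by (auto simp: U_def)
        fix b :: 'a assume b: "b \<in> Basis"
        then have "(g b, r) \<in> I" by (simp add: I_def)
        from bspec[OF mp[OF elim x] this]
        show "\<bar>g b x\<bar> powr r \<le> H x" "\<bar>pd b (U n) x\<bar> powr r \<le> H x" for n
          using fun_cong[OF U1[OF b]] by auto
      qed
    qed
  qed (use H in auto)
qed

end

text \<open>The sequence and the majorant depend on the radius \<open>m\<close>; fixing all three
  keeps the local computations free of existential statements.\<close>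

locale approximated_data = sobolev_data u g h r
  for u :: "'a::euclidean_space \<Rightarrow> real" and g h r +
  fixes m :: real and U :: "nat \<Rightarrow> 'a \<Rightarrow> real" and H :: "'a \<Rightarrow> real"
  assumes m: "0 < m" and Us: "\<And>n. smooth (U n)"
    and Ucomm: "\<And>n b c x. b \<in> Basis \<Longrightarrow> c \<in> Basis \<Longrightarrow> pd c (pd b (U n)) x = pd b (pd c (U n)) x"
    and Hi: "integrable lborel H" and H0: "\<And>x. 0 \<le> H x"
    and U0: "dominated_seq m H U u"
    and U1: "\<And>b. b \<in> Basis \<Longrightarrow> dominated_seq m H (\<lambda>n. pd b (U n)) (g b)"
    and U2: "\<And>b c. b \<in> Basis \<Longrightarrow> c \<in> Basis \<Longrightarrow> dominated_seq m H (\<lambda>n. pd c (pd b (U n))) (h b c)"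
    and Ur: "AE x in lborel. norm x \<le> m \<longrightarrow> \<bar>u x\<bar> powr r \<le> H x \<and> (\<forall>n. \<bar>U n x\<bar> powr r \<le> H x) \<and>
       (\<forall>b\<in>Basis. \<bar>g b x\<bar> powr r \<le> H x \<and> (\<forall>n. \<bar>pd b (U n) x\<bar> powr r \<le> H x))"
begin

text \<open>\<open>wt b\<close> is the \<open>b\<close>-component of the field X, and
  \<open>wt2 j b\<close> is the derivative of \<open>wt b\<close> in direction
  \<open>j\<close>.\<close>

abbreviation "wt b x \<equiv> cutP m x * (x \<bullet> b)"
abbreviation "wt2 j b x \<equiv> cutP m x * (j \<bullet> b) - cutQ m x * (x \<bullet> j) * (x \<bullet> b)"

lemma wt_zero: "norm x > m \<Longrightarrow> wt b x = 0" "norm x > m \<Longrightarrow> wt2 j b x = 0" "norm x > m \<Longrightarrow> cutP m x = 0"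
   "norm x > m \<Longrightarrow> cutQ m x = 0" "norm x > m \<Longrightarrow> cutD m x = 0"
  using cut_support[OF m, of x] by auto

lemma Ud: "(U n has_derivative frechet_derivative (U n) (at x)) (at x)"
  by (rule smooth_has_derivative[OF Us])

lemma U1c: "b \<in> Basis \<Longrightarrow> continuous_on UNIV (pd b (U n))"
  by (rule smooth_continuous[OF smooth_pd[OF Us]])

lemma U2c: "b \<in> Basis \<Longrightarrow> c \<in> Basis \<Longrightarrow> continuous_on UNIV (pd c (pd b (U n)))"
  by (rule smooth_continuous[OF smooth_pd[OF smooth_pd[OF Us]]])

text \<open>The divergence of the field \<open>u\<^sup>2 X\<close> has integral 0: true for the
  smooth \<open>U n\<close>, and passed to the limit.\<close>

lemma radial_identity_u:
  "(LBINT x. cutD m x * (u x * u x) + (\<Sum>b\<in>Basis. 2 * wt b x * (u x * g b x))) = 0"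
  "integrable lborel (\<lambda>x. cutD m x * (u x * u x) + (\<Sum>b\<in>Basis. 2 * wt b x * (u x * g b x)))"
proof -
  have l: "lim_int (\<lambda>n x. cutD m x * (U n x * U n x) + (\<Sum>b\<in>Basis. 2 * wt b x * (U n x * pd b (U n) x)))
     (\<lambda>x. cutD m x * (u x * u x) + (\<Sum>b\<in>Basis. 2 * wt b x * (u x * g b x)))" (is "lim_int ?F ?G")
    using wt_zero
    by (intro lim_int_add lim_int_sum lim_int_mult[OF Hi] U0 U1 continuous_intros)
      (auto intro: U0 U1 U2 dominated_seq_const)
  have z: "(LBINT x. ?F n x) = 0" for n
  proof -
    have d: "((\<lambda>x. U n x * U n x) has_derivative (\<lambda>k. U n x * pd k (U n) x + pd k (U n) x * U n x)) (at x)" for x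
      by (rule has_derivative_mult[OF Ud Ud])
    have "(LBINT x. cutD m x * (U n x * U n x) + (\<Sum>b\<in>Basis. wt b x * (U n x * pd b (U n) x + pd b (U n) x * U n x))) = 0"
      by (rule radial_integration_by_parts[OF m d]) (intro continuous_intros U1c smooth_continuous[OF Us])
    then show ?thesis by (simp add: algebra_simps)
  qed
  show "(LBINT x. ?G x) = 0" by (rule lim_int_unique_0[OF l z])
  show "integrable lborel ?G" using l by (simp only: lim_int_def)
qed

text \<open>The same for \<open>|\<nabla>u|\<^sup>2 X\<close>. Here the second weak derivatives
  enter, and with them the local assumption on the gradient.\<close>

lemma radial_identity_g:
  "(LBINT x. (\<Sum>j\<in>Basis. cutD m x * (g j x * g j x)) + (\<Sum>j\<in>Basis. \<Sum>b\<in>Basis. 2 * wt b x * (g j x * h j b x))) = 0"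
  "integrable lborel (\<lambda>x. (\<Sum>j\<in>Basis. cutD m x * (g j x * g j x)) + (\<Sum>j\<in>Basis. \<Sum>b\<in>Basis. 2 * wt b x * (g j x * h j b x)))"
proof -
  have l: "lim_int (\<lambda>n x. (\<Sum>j\<in>Basis. cutD m x * (pd j (U n) x * pd j (U n) x))
      + (\<Sum>j\<in>Basis. \<Sum>b\<in>Basis. 2 * wt b x * (pd j (U n) x * pd b (pd j (U n)) x)))
     (\<lambda>x. (\<Sum>j\<in>Basis. cutD m x * (g j x * g j x)) + (\<Sum>j\<in>Basis. \<Sum>b\<in>Basis. 2 * wt b x * (g j x * h j b x)))"
    (is "lim_int ?F ?G")
    using wt_zero
    by (intro lim_int_add lim_int_sum lim_int_mult[OF Hi] U1 U2 continuous_intros)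
      (auto intro: U0 U1 U2 dominated_seq_const)
  have z: "(LBINT x. ?F n x) = 0" for n
  proof -
    note d1 = smooth_has_derivative[OF smooth_pd[OF Us]]
    have d: "((\<lambda>x. \<Sum>j\<in>Basis. pd j (U n) x * pd j (U n) x) has_derivative
        (\<lambda>k. \<Sum>j\<in>Basis. pd j (U n) x * pd k (pd j (U n)) x + pd k (pd j (U n)) x * pd j (U n) x)) (at x)" for x
      by (intro has_derivative_sum has_derivative_mult d1)
    have "(LBINT x. cutD m x * (\<Sum>j\<in>Basis. pd j (U n) x * pd j (U n) x)
        + (\<Sum>b\<in>Basis. wt b x * (\<Sum>j\<in>Basis. pd j (U n) x * pd b (pd j (U n)) x + pd b (pd j (U n)) x * pd j (U n) x))) = 0"
      by (rule radial_integration_by_parts[OF m d]) (intro continuous_intros U1c U2c)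
    also have "(\<lambda>x. cutD m x * (\<Sum>j\<in>Basis. pd j (U n) x * pd j (U n) x)
        + (\<Sum>b\<in>Basis. wt b x * (\<Sum>j\<in>Basis. pd j (U n) x * pd b (pd j (U n)) x + pd b (pd j (U n)) x * pd j (U n) x))) = ?F n"
    proof
      fix x
      have "(\<Sum>b\<in>Basis. wt b x * (\<Sum>j\<in>Basis. pd j (U n) x * pd b (pd j (U n)) x + pd b (pd j (U n)) x * pd j (U n) x))
          = (\<Sum>j\<in>Basis. \<Sum>b\<in>Basis. 2 * wt b x * (pd j (U n) x * pd b (pd j (U n)) x))"
        unfolding sum_distrib_left by (subst sum.swap) (intro sum.cong refl, simp add: algebra_simps)
      then show "cutD m x * (\<Sum>j\<in>Basis. pd j (U n) x * pd j (U n) x)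
        + (\<Sum>b\<in>Basis. wt b x * (\<Sum>j\<in>Basis. pd j (U n) x * pd b (pd j (U n)) x + pd b (pd j (U n)) x * pd j (U n) x)) = ?F n x"
        by (simp only: sum_distrib_left)
    qed
    finally show ?thesis .
  qed
  show "(LBINT x. ?G x) = 0" by (rule lim_int_unique_0[OF l z])
  show "integrable lborel ?G" using l by (simp only: lim_int_def)
qed

text \<open>A test function approximating \<open>X \<bullet> \<nabla>u\<close>.\<close>

definition "vtest n x = (\<Sum>b\<in>Basis. wt b x * pd b (U n) x)"

lemma vtest_test_function: "vtest n \<in> test_functions"
proof (rule test_functionsI[of _ m])
  have c: "Ck k (cutP m :: 'a \<Rightarrow> real)" "b \<in> Basis \<Longrightarrow> Ck k (pd b (U n))" for k b
    using smooth_cutP smooth_pd[OF Us] by blast+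
  show "smooth (vtest n)"
    unfolding vtest_def[abs_def] by (intro allI Ck_sum Ck_mult c Ck_inner)
  show "vtest n x = 0" if "norm x > m" for x
    unfolding vtest_def wt_zero(1)[OF that] by simp
qed

text \<open>The second derivatives are put in the order whose limit is \<open>h j b\<close>, the
  form that occurs in \<open>radial_identity_g\<close>.\<close>

lemma pd_vtest:
  assumes "j \<in> Basis"
  shows "pd j (vtest n) x = (\<Sum>b\<in>Basis. wt b x * pd b (pd j (U n)) x + wt2 j b x * pd b (U n) x)"
proof -
  note d1 = smooth_has_derivative[OF smooth_pd[OF Us]]
  have "(vtest n has_derivative (\<lambda>k. \<Sum>b\<in>Basis. wt b x * pd k (pd b (U n)) x
      + (cutP m x * (k \<bullet> b) + - cutQ m x * (x \<bullet> k) * (x \<bullet> b)) * pd b (U n) x)) (at x)"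
    unfolding vtest_def[abs_def]
    by (intro has_derivative_sum has_derivative_mult cutP_has_derivative d1
        bounded_linear.has_derivative[OF bounded_linear_inner_left]) simp_all
  then have "pd j (vtest n) x = (\<Sum>b\<in>Basis. wt b x * pd j (pd b (U n)) x
      + (cutP m x * (j \<bullet> b) + - cutQ m x * (x \<bullet> j) * (x \<bullet> b)) * pd b (U n) x)"
    by (rule pd_eqI)
  also have "\<dots> = (\<Sum>b\<in>Basis. wt b x * pd b (pd j (U n)) x + wt2 j b x * pd b (U n) x)"
    using assms by (intro sum.cong refl) (simp add: Ucomm)
  finally show ?thesis .
qed

text \<open>The terms of second and zeroth order are halves of the derivatives of
  \<open>|\<nabla>u|\<^sup>2\<close> and \<open>u\<^sup>2\<close> along X. The radial identities
  trade both for the divergence of X, so no second derivative survives in the limit.\<close>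

lemma vtest_lhs_limit:
  "(\<lambda>n. LBINT x. (\<Sum>j\<in>Basis. g j x * pd j (vtest n) x) + u x * vtest n x) \<longlonglongrightarrow>
     (LBINT x. (\<Sum>j\<in>Basis. \<Sum>b\<in>Basis. wt2 j b x * (g j x * g b x)))
     - (LBINT x. cutD m x * ((u x * u x + (\<Sum>j\<in>Basis. g j x * g j x)) / 2))"
proof -
  let ?A = "\<lambda>x. \<Sum>j\<in>Basis. \<Sum>b\<in>Basis. wt b x * (g j x * h j b x)"
  let ?B = "\<lambda>x. \<Sum>j\<in>Basis. \<Sum>b\<in>Basis. wt2 j b x * (g j x * g b x)"
  let ?C = "\<lambda>x. \<Sum>b\<in>Basis. wt b x * (u x * g b x)"
  let ?Du = "\<lambda>x. cutD m x * (u x * u x)" and ?Dg = "\<lambda>x. \<Sum>j\<in>Basis. cutD m x * (g j x * g j x)"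
  have lA: "lim_int (\<lambda>n x. \<Sum>j\<in>Basis. \<Sum>b\<in>Basis. wt b x * (g j x * pd b (pd j (U n)) x)) ?A"
    using wt_zero by (intro lim_int_sum lim_int_mult[OF Hi] dominated_seq_const[OF U1] U2 continuous_intros)
      (auto intro: U0 U1 U2 dominated_seq_const)
  have lB: "lim_int (\<lambda>n x. \<Sum>j\<in>Basis. \<Sum>b\<in>Basis. wt2 j b x * (g j x * pd b (U n) x)) ?B"
    using wt_zero by (intro lim_int_sum lim_int_mult[OF Hi] dominated_seq_const[OF U1] U1 continuous_intros)
      (auto intro: U0 U1 U2 dominated_seq_const)
  have lC: "lim_int (\<lambda>n x. \<Sum>b\<in>Basis. wt b x * (u x * pd b (U n) x)) ?C"
    using wt_zero by (intro lim_int_sum lim_int_mult[OF Hi] dominated_seq_const[OF U0] U1 continuous_intros)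
      (auto intro: U0 U1 U2 dominated_seq_const)
  have lDu: "lim_int (\<lambda>n::nat. ?Du) ?Du"
    using wt_zero by (intro lim_int_mult[OF Hi] dominated_seq_const[OF U0] continuous_intros)
      (auto intro: U0 U1 U2 dominated_seq_const)
  have lDg: "lim_int (\<lambda>n::nat. ?Dg) ?Dg"
    using wt_zero by (intro lim_int_sum lim_int_mult[OF Hi] dominated_seq_const[OF U1] continuous_intros)
      (auto intro: U0 U1 U2 dominated_seq_const)
  have i: "integrable lborel ?A" "integrable lborel ?B" "integrable lborel ?C"
    "integrable lborel ?Du" "integrable lborel ?Dg"
    using lA lB lC lDu lDg by (auto simp only: lim_int_def)
  have "(LBINT x. ?Dg x + (\<Sum>j\<in>Basis. \<Sum>b\<in>Basis. 2 * wt b x * (g j x * h j b x))) = (LBINT x. ?Dg x + 2 * ?A x)"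
    by (simp add: sum_distrib_left mult.assoc)
  also have "\<dots> = (LBINT x. ?Dg x) + 2 * (LBINT x. ?A x)"
    using i by (subst Bochner_Integration.integral_add) auto
  finally have eA: "(LBINT x. ?Dg x) + 2 * (LBINT x. ?A x) = 0"
    using radial_identity_g(1) by simp
  have "(LBINT x. ?Du x + (\<Sum>b\<in>Basis. 2 * wt b x * (u x * g b x))) = (LBINT x. ?Du x + 2 * ?C x)"
    by (simp add: sum_distrib_left mult.assoc)
  also have "\<dots> = (LBINT x. ?Du x) + 2 * (LBINT x. ?C x)"
    using i by (subst Bochner_Integration.integral_add) auto
  finally have eC: "(LBINT x. ?Du x) + 2 * (LBINT x. ?C x) = 0"
    using radial_identity_u(1) by simp
  have "(LBINT x. cutD m x * ((u x * u x + (\<Sum>j\<in>Basis. g j x * g j x)) / 2))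
      = (LBINT x. (?Du x + ?Dg x) / 2)"
    by (simp add: sum_distrib_left distrib_left)
  also have "\<dots> = ((LBINT x. ?Du x) + (LBINT x. ?Dg x)) / 2"
    using i by simp
  finally have eD: "(LBINT x. cutD m x * ((u x * u x + (\<Sum>j\<in>Basis. g j x * g j x)) / 2))
    = ((LBINT x. ?Du x) + (LBINT x. ?Dg x)) / 2" .
  have "lim_int (\<lambda>n x. (\<Sum>j\<in>Basis. \<Sum>b\<in>Basis. wt b x * (g j x * pd b (pd j (U n)) x))
      + (\<Sum>j\<in>Basis. \<Sum>b\<in>Basis. wt2 j b x * (g j x * pd b (U n) x)) + (\<Sum>b\<in>Basis. wt b x * (u x * pd b (U n) x)))
      (\<lambda>x. ?A x + ?B x + ?C x)"
    by (intro lim_int_add lA lB lC)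
  moreover have "(\<Sum>j\<in>Basis. g j x * pd j (vtest n) x) + u x * vtest n x
     = (\<Sum>j\<in>Basis. \<Sum>b\<in>Basis. wt b x * (g j x * pd b (pd j (U n)) x))
      + (\<Sum>j\<in>Basis. \<Sum>b\<in>Basis. wt2 j b x * (g j x * pd b (U n) x)) + (\<Sum>b\<in>Basis. wt b x * (u x * pd b (U n) x))" for n x
    by (simp add: pd_vtest vtest_def sum_distrib_left sum.distrib[symmetric] algebra_simps cong: sum.cong)
  ultimately have "(\<lambda>n. LBINT x. (\<Sum>j\<in>Basis. g j x * pd j (vtest n) x) + u x * vtest n x)
      \<longlonglongrightarrow> (LBINT x. ?A x + ?B x + ?C x)"
    by (simp only: lim_int_def)
  also have "(LBINT x. ?A x + ?B x + ?C x) = (LBINT x. ?A x) + (LBINT x. ?B x) + (LBINT x. ?C x)"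
    using i by (simp only: Bochner_Integration.integral_add Bochner_Integration.integrable_add)
  also have "\<dots> = (LBINT x. ?B x) - ((LBINT x. ?Du x) + (LBINT x. ?Dg x)) / 2"
  proof -
    have "a + b + c = b - (d + e) / 2" if "e + 2 * a = 0" "d + 2 * c = 0" for a b c d e :: real
      using that by (simp add: field_simps)
    from this[OF eA eC] show ?thesis .
  qed
  finally show ?thesis unfolding eD .
qed

end

subsection \<open>The nonlocal term\<close>

text \<open>At 0 the difference quotient has modulus \<open>\<bar>h\<bar> powr (p - 1)\<close>,
  which tends to 0 because \<open>p > 1\<close>. The claimed derivative is 0 there too, so one
  formula covers all \<open>t\<close>, even for \<open>p < 2\<close>.\<close>

lemma abs_powr_has_derivative:
  fixes p t :: real
  assumes "1 < p"
  shows "((\<lambda>t. \<bar>t\<bar> powr p) has_real_derivative p * (\<bar>t\<bar> powr (p - 2) * t)) (at t)"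
proof -
  consider "t > 0" | "t < 0" | "t = 0" by linarith
  then show ?thesis
  proof cases
    case 1
    have "((\<lambda>t. t powr p) has_real_derivative p * t powr (p - 1)) (at t)"
      using 1 by (rule has_real_derivative_powr)
    moreover have "t powr (p - 1) = \<bar>t\<bar> powr (p - 2) * t"
      using 1 powr_mult_base[of t "p - 2"] by (simp add: mult.commute)
    ultimately have "((\<lambda>t. t powr p) has_real_derivative p * (\<bar>t\<bar> powr (p - 2) * t)) (at t)" by simp
    then show ?thesis
      by (rule has_field_derivative_transform_within_open[where S="{0<..}"]) (use 1 in auto)
  next
    case 2
    have "((\<lambda>t. (- t) powr p) has_real_derivative - (p * (- t) powr (p - 1))) (at t)"
      using 2 by (auto intro!: derivative_eq_intros)
    moreover have "- ((- t) powr (p - 1)) = \<bar>t\<bar> powr (p - 2) * t"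
      using 2 powr_mult_base[of "- t" "p - 2"] by (simp add: mult.commute)
    ultimately have "((\<lambda>t. (- t) powr p) has_real_derivative p * (\<bar>t\<bar> powr (p - 2) * t)) (at t)"
      by (metis mult_minus_right)
    then show ?thesis
      by (rule has_field_derivative_transform_within_open[where S="{..<0}"]) (use 2 in auto)
  next
    case 3
    have "((\<lambda>h. \<bar>h\<bar> powr p / h) \<longlongrightarrow> 0) (at 0)"
    proof (rule Lim_null_comparison)
      show "\<forall>\<^sub>F h in at 0. norm (\<bar>h\<bar> powr p / h) \<le> \<bar>h\<bar> powr (p - 1)"
        unfolding eventually_at_filter
        by (intro always_eventually allI impI) (simp add: powr_diff)
      show "((\<lambda>h. \<bar>h\<bar> powr (p - 1)) \<longlongrightarrow> 0) (at (0::real))"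
        using assms by (intro tendsto_zero_powrI[where b="p - 1"]) (auto intro!: tendsto_eq_intros)
    qed
    then show ?thesis using 3 assms by (simp add: DERIV_def)
  qed
qed

lemma abs_powr_sgn:
  fixes p t :: real
  assumes "1 < p" shows "\<bar>\<bar>t\<bar> powr (p - 2) * t\<bar> = \<bar>t\<bar> powr (p - 1)"
  using powr_mult_base[of "\<bar>t\<bar>" "p - 2"] by (simp add: abs_mult mult.commute)

lemma isCont_signed_powr:
  fixes p t :: real
  assumes "1 < p" shows "isCont (\<lambda>t. \<bar>t\<bar> powr (p - 2) * t) t"
proof (cases "t = 0")
  case True
  have "((\<lambda>t. \<bar>t\<bar> powr (p - 2) * t) \<longlongrightarrow> 0) (at 0)"
  proof (rule Lim_null_comparison)
    show "\<forall>\<^sub>F h in at 0. norm (\<bar>h\<bar> powr (p - 2) * h) \<le> \<bar>h\<bar> powr (p - 1)"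
      using abs_powr_sgn[OF assms] by (intro always_eventually) auto
    show "((\<lambda>h. \<bar>h\<bar> powr (p - 1)) \<longlongrightarrow> 0) (at (0::real))"
      using assms by (intro tendsto_zero_powrI[where b="p - 1"]) (auto intro!: tendsto_eq_intros)
  qed
  then show ?thesis using True by (simp add: isCont_def)
next
  case False
  then show ?thesis by (intro continuous_intros) auto
qed

text \<open>Kernel bounds and limits are available only off the diagonal: on it
  \<open>0 powr - lam\<close> is 0, whereas the regularised kernel is positive. The diagonal is null
  because its sections are singletons.\<close>

lemma AE_pair_lborel_neq:
  "AE z in (lborel \<Otimes>\<^sub>M lborel :: ('a::euclidean_space \<times> 'a) measure). fst z \<noteq> snd z"
proof (rule lborel_pair.AE_pair_measure)
  have "AE y in lborel. fst (x, y) \<noteq> snd (x, y)" for x :: 'a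
    using AE_lborel_singleton[of x] by eventually_elim auto
  then show "AE x in lborel. AE y in lborel. fst (x, y) \<noteq> snd (x::'a, y)" by simp
qed measurable

text \<open>\<open>c\<close> stands for the normalising constant of the Riesz potential, so that the
  kernel \<open>K\<close> is a pure power and \<open>c * V\<close> is the potential in the
  equation.\<close>

locale choquard_data = sobolev_data u g h r
  for u :: "'a::euclidean_space \<Rightarrow> real" and g h r +
  fixes \<alpha> p c :: real
  assumes \<alpha>: "0 < \<alpha>" "\<alpha> < DIM('a)" and p: "1 < p"
    and r_eq: "r = 2 * real DIM('a) * p / (real DIM('a) + \<alpha>)"
    and eqn: "\<And>\<phi>. \<phi> \<in> test_functions \<Longrightarrow>
      (LBINT x. (\<Sum>j\<in>Basis. g j x * pd j \<phi> x) + u x * \<phi> x) =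
      c * (LBINT x. (LBINT y. norm (x - y) powr - (real DIM('a) - \<alpha>) * \<bar>u y\<bar> powr p)
            * (\<bar>u x\<bar> powr (p - 2) * u x) * \<phi> x)"
begin

definition "lam = real DIM('a) - \<alpha>"
definition "K z = norm (z::'a) powr - lam"
definition "F x = \<bar>u x\<bar> powr p"
definition "s x = \<bar>u x\<bar> powr (p - 2) * u x"
definition "V x = (LBINT y. K (x - y) * F y)"

lemma lam: "0 < lam" "lam < DIM('a)"
  using \<alpha> by (auto simp: lam_def)

lemma K_measurable [measurable]: "K \<in> borel_measurable borel"
  unfolding K_def[abs_def] by measurable

lemma F_measurable [measurable]: "F \<in> borel_measurable borel"
  unfolding F_def[abs_def] by measurable

lemma s_measurable [measurable]: "s \<in> borel_measurable borel"
  unfolding s_def[abs_def] by measurable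

lemma V_measurable [measurable]: "V \<in> borel_measurable borel"
  unfolding V_def[abs_def] by measurable

lemma K_nonneg: "0 \<le> K z" by (simp add: K_def)
lemma F_nonneg: "0 \<le> F x" by (simp add: F_def)
lemma V_nonneg: "0 \<le> V x" unfolding V_def by (intro integral_nonneg_AE AE_I2 mult_nonneg_nonneg K_nonneg F_nonneg)

lemma r_p: "r / p = 2 * real DIM('a) / (real DIM('a) + \<alpha>)"
  using p by (simp add: r_eq)

lemma p_less_r: "p < r"
proof -
  have "1 < r / p" using \<alpha> unfolding r_p by simp
  then show ?thesis using p by (simp add: field_simps)
qed

lemma equation: "\<phi> \<in> test_functions \<Longrightarrow>
   (LBINT x. (\<Sum>j\<in>Basis. g j x * pd j \<phi> x) + u x * \<phi> x) = c * (LBINT x. V x * (s x * \<phi> x))"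
  using eqn by (simp add: V_def s_def K_def F_def lam_def mult.assoc)

lemma abs_s: "\<bar>s x\<bar> = \<bar>u x\<bar> powr (p - 1)"
  unfolding s_def by (rule abs_powr_sgn[OF p])

lemma s_u: "s x * u x = F x"
proof -
  have "s x * u x = \<bar>u x\<bar> powr (p - 2) * \<bar>u x\<bar> * \<bar>u x\<bar>" by (simp add: s_def mult.assoc)
  also have "\<dots> = F x"
    unfolding F_def using powr_mult_base[of "\<bar>u x\<bar>" "p - 2"] powr_mult_base[of "\<bar>u x\<bar>" "p - 1"]
    by (simp add: mult.commute)
  finally show ?thesis .
qed

definition kernel :: "('a \<Rightarrow> real) \<Rightarrow> 'a \<times> 'a \<Rightarrow> real" where
  "kernel E z = E (fst z) * K (fst z - snd z) * E (snd z)"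

text \<open>\<open>r / p\<close> is the diagonal Hardy-Littlewood-Sobolev exponent. The summand
  \<open>E\<close> makes room for a majorant of \<open>|u| powr (p - 1) * |\<nabla>u|\<close>, which
  has to be paired with \<open>F\<close> through the same kernel.\<close>

lemma kernel_integrable:
  assumes [measurable]: "E \<in> borel_measurable borel" and E0: "\<And>x. 0 \<le> E x"
    and Ei: "integrable lborel (\<lambda>x. E x powr (r / p))"
  shows "integrable (lborel \<Otimes>\<^sub>M lborel) (kernel (\<lambda>x. F x + E x))"
proof -
  have Fi: "integrable lborel (\<lambda>x. F x powr (r / p))"
    using ur p by (simp add: F_def powr_powr)
  have "integrable lborel (\<lambda>x. (F x + E x) powr (r / p))"
  proof (rule Bochner_Integration.integrable_bound)
    show "integrable lborel (\<lambda>x. 3 powr (r / p) * (F x powr (r / p) + E x powr (r / p)))"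
      using Fi Ei by auto
    show "AE x in lborel. norm ((F x + E x) powr (r / p)) \<le> norm (3 powr (r / p) * (F x powr (r / p) + E x powr (r / p)))"
      using powr_sum3[of "r / p" "F _" "E _" 0] r p by (intro AE_I2) (simp add: E0 F_nonneg)
  qed measurable
  then have "integrable (lborel \<Otimes>\<^sub>M lborel) (\<lambda>(x, y). (F x + E x) * norm (x - y) powr - (real DIM('a) - \<alpha>) * (F y + E y))"
    unfolding r_p using \<alpha> by (intro hls_finite) (auto simp: E0 F_nonneg)
  then show ?thesis by (simp add: kernel_def[abs_def] K_def lam_def case_prod_unfold)
qed

lemma kernel_F_integrable: "integrable (lborel \<Otimes>\<^sub>M lborel) (kernel F)"
  using kernel_integrable[of "\<lambda>x. 0"] by simp

text \<open>The product is the inner integral of a function of two variables that the symmetric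
  kernel of \<open>F + E\<close> dominates, so Fubini applies.\<close>

lemma V_integrable:
  assumes E: "integrable (lborel \<Otimes>\<^sub>M lborel) (kernel (\<lambda>x. F x + E x))" and E0: "\<And>x. 0 \<le> E x"
    and [measurable]: "E \<in> borel_measurable borel"
  shows "integrable lborel (\<lambda>x. V x * (F x + E x))"
proof -
  have "integrable (lborel \<Otimes>\<^sub>M lborel) (\<lambda>z. (F (fst z) + E (fst z)) * K (fst z - snd z) * F (snd z))"
  proof (rule Bochner_Integration.integrable_bound[OF E])
    show "AE z in lborel \<Otimes>\<^sub>M lborel. norm ((F (fst z) + E (fst z)) * K (fst z - snd z) * F (snd z))
        \<le> norm (kernel (\<lambda>x. F x + E x) z)"
      by (intro AE_I2) (auto simp: kernel_def abs_mult E0 F_nonneg K_nonneg intro!: mult_left_mono)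
  qed measurable
  from lborel_pair.integrable_fst'[OF this] show ?thesis
    unfolding V_def mult.commute[of "integral\<^sup>L _ _"] by (simp add: mult.assoc)
qed

lemma V_Fubini:
  assumes "integrable (lborel \<Otimes>\<^sub>M lborel) (\<lambda>z. k (fst z) * K (fst z - snd z) * F (snd z))"
  shows "(\<integral>z. k (fst z) * K (fst z - snd z) * F (snd z) \<partial>(lborel \<Otimes>\<^sub>M lborel)) = (LBINT x. V x * k x)"
  unfolding lborel_pair.integral_fst'[OF assms, symmetric] V_def mult.commute[of "integral\<^sup>L _ _"]
  by (simp add: mult.assoc)

end

section \<open>Cut-off estimates uniform in the truncation radius\<close>

lemma cutP_bounds: "0 \<le> cutP m x" "cutP m x \<le> exp 1"
  using flat_le[of 0 "1 - (1 / m)\<^sup>2 * (x \<bullet> x)" 0] by (auto simp: cutP_def bump_def flat_nonneg)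

text \<open>Inside the support \<open>(1 / m)\<^sup>2 * (x \<bullet> x)\<close> is below 1, and
  \<open>flat 2\<close> is at most \<open>fact 2\<close>. The point is that the second bound is free
  of \<open>m\<close>.\<close>

lemma cutQ_bounds: "0 \<le> cutQ m x" "cutQ m x * (x \<bullet> x) \<le> 4 * exp 1"
proof -
  show "0 \<le> cutQ m x" by (simp add: cutQ_def bump_nonneg)
  let ?t = "(1 / m)\<^sup>2 * (x \<bullet> x)"
  have "?t * bump 2 ((1 / m)\<^sup>2) x \<le> 1 * 2"
  proof (cases "?t < 1")
    case True
    show ?thesis using True flat_le[of 2 "1 - ?t" 0]
      by (intro mult_mono) (auto simp: bump_def flat_nonneg numeral_2_eq_2)
  qed (simp add: bump_def flat_def)
  then have "2 * exp 1 * (?t * bump 2 ((1 / m)\<^sup>2) x) \<le> 2 * exp 1 * (1 * 2)"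
    by (intro mult_left_mono) auto
  then show "cutQ m x * (x \<bullet> x) \<le> 4 * exp 1" by (simp add: cutQ_def mult_ac)
qed

lemma cutD_bound: "\<bar>cutD m (x::'a::euclidean_space)\<bar> \<le> DIM('a) * exp 1 + 4 * exp 1"
proof -
  have "0 \<le> real DIM('a) * cutP m x" "real DIM('a) * cutP m x \<le> DIM('a) * exp 1"
    using cutP_bounds[of m x] by (auto intro: mult_left_mono)
  moreover have "0 \<le> cutQ m x * (x \<bullet> x)" using cutQ_bounds(1)[of m x] by simp
  ultimately show ?thesis unfolding cutD_def using cutQ_bounds(2)[of m x] by linarith
qed

text \<open>The derivative of the field consists of a multiple \<open>cutP\<close> of the identity,
  at most \<open>exp 1\<close>, and a rank-one part of size
  \<open>cutQ m x * (x \<bullet> x)\<close>, at most \<open>4 * exp 1\<close>; the constant is again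
  free of \<open>m\<close>.\<close>

lemma cut_field_lipschitz:
  "norm (cutP m x *\<^sub>R x - cutP m y *\<^sub>R y) \<le> 5 * exp 1 * norm (x - y :: 'a::euclidean_space)"
proof (rule differentiable_bound[of UNIV "\<lambda>x. cutP m x *\<^sub>R x"
      "\<lambda>x h. cutP m x *\<^sub>R h + (- cutQ m x * (x \<bullet> h)) *\<^sub>R x"])
  fix z :: 'a
  show "((\<lambda>x. cutP m x *\<^sub>R x) has_derivative (\<lambda>h. cutP m z *\<^sub>R h + (- cutQ m z * (z \<bullet> h)) *\<^sub>R z)) (at z within UNIV)"
    by (intro has_derivative_scaleR cutP_has_derivative has_derivative_ident)
  show "onorm (\<lambda>h. cutP m z *\<^sub>R h + (- cutQ m z * (z \<bullet> h)) *\<^sub>R z) \<le> 5 * exp 1"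
  proof (rule onorm_le)
    fix h
    have "norm ((- cutQ m z * (z \<bullet> h)) *\<^sub>R z) \<le> cutQ m z * (norm z * norm h) * norm z"
      using cutQ_bounds(1)[of m z] Cauchy_Schwarz_ineq2[of z h]
      by (auto simp: abs_mult intro!: mult_right_mono mult_left_mono)
    also have "\<dots> = cutQ m z * (z \<bullet> z) * norm h"
      by (simp add: power2_norm_eq_inner[symmetric] power2_eq_square)
    also have "\<dots> \<le> 4 * exp 1 * norm h" using cutQ_bounds(2)[of m z] by (intro mult_right_mono) auto
    finally have "norm ((- cutQ m z * (z \<bullet> h)) *\<^sub>R z) \<le> 4 * exp 1 * norm h" .
    moreover have "norm (cutP m z *\<^sub>R h) \<le> exp 1 * norm h"
      using cutP_bounds[of m z] by (simp add: mult_right_mono)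
    ultimately show "norm (cutP m z *\<^sub>R h + (- cutQ m z * (z \<bullet> h)) *\<^sub>R z) \<le> 5 * exp 1 * norm h"
      using norm_triangle_ineq[of "cutP m z *\<^sub>R h" "(- cutQ m z * (z \<bullet> h)) *\<^sub>R z"] by linarith
  qed
qed auto

lemma AE_pair_fst:
  fixes P :: "'a::euclidean_space \<Rightarrow> bool"
  assumes "AE x in lborel. P x"
  shows "AE z in (lborel \<Otimes>\<^sub>M (lborel :: 'b::euclidean_space measure)). P (fst z)"
proof -
  obtain N where N: "{x \<in> space lborel. \<not> P x} \<subseteq> N" "emeasure lborel N = 0" "N \<in> sets lborel"
    using AE_E[OF assms] by blast
  have [measurable]: "N \<in> sets borel" using N(3) by simp
  have "AE x in lborel. x \<notin> N" using N by (intro AE_not_in) (simp add: null_sets_def)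
  then have "AE x in lborel. AE y in (lborel :: 'b measure). fst (x, y) \<notin> N"
    by eventually_elim simp
  then have "AE z in (lborel \<Otimes>\<^sub>M (lborel :: 'b measure)). fst z \<notin> N"
    by (intro lborel_pair.AE_pair_measure) measurable
  then show ?thesis by eventually_elim (use N(1) in auto)
qed

lemma powr_le_1_plus:
  fixes t p r :: real
  assumes "0 \<le> t" "p \<le> r" "0 \<le> p" shows "t powr p \<le> 1 + t powr r"
proof (cases "t \<le> 1")
  case True
  then have "t powr p \<le> 1 powr p" using assms by (intro powr_mono2) auto
  then show ?thesis by (simp add: add_increasing2)
next
  case False
  then have "t powr p \<le> t powr r" using assms by (intro powr_mono) auto
  then show ?thesis by simp
qed

text \<open>Both factors are bounded by powers of \<open>b powr (1 / r)\<close>, of total degree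
  \<open>p\<close>. With \<open>b = H x\<close> it bounds the products of the nonlinearity with
  \<open>u\<close>, its gradient and their approximations.\<close>

lemma powr_mult_le_powr:
  fixes t a b p r :: real
  assumes p: "1 < p" and r: "0 < r" and "\<bar>t\<bar> powr r \<le> b" "\<bar>a\<bar> powr r \<le> b"
  shows "\<bar>t\<bar> powr (p - 1) * \<bar>a\<bar> \<le> b powr (p / r)"
proof -
  have b: "0 \<le> b" using assms(3) powr_ge_zero order_trans by blast
  have *: "\<bar>y\<bar> \<le> b powr (1 / r)" if "\<bar>y\<bar> powr r \<le> b" for y
  proof -
    have "\<bar>y\<bar> = (\<bar>y\<bar> powr r) powr (1 / r)" using r by (simp add: powr_powr)
    also have "\<dots> \<le> b powr (1 / r)" using that r by (intro powr_mono2) auto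
    finally show ?thesis .
  qed
  have "\<bar>t\<bar> powr (p - 1) * \<bar>a\<bar> \<le> (b powr (1 / r)) powr (p - 1) * b powr (1 / r)"
    using p * assms by (intro mult_mono powr_mono2) auto
  also have "\<dots> = b powr (1 / r * (p - 1) + 1 / r)" by (simp add: powr_powr powr_add)
  also have "1 / r * (p - 1) + 1 / r = p / r" using r by (simp add: field_simps)
  finally show ?thesis .
qed

text \<open>\<open>Kd \<delta>\<close> regularises the kernel \<open>|z| powr - lam\<close>, and its gradient is \<open>Ed \<delta> z\<close> times \<open>z\<close>.\<close>

definition "Kd \<delta> lam z = (z \<bullet> z + \<delta>) powr (- lam / 2 :: real)"
definition "Ed \<delta> lam z = - lam * (z \<bullet> z + \<delta>) powr (- lam / 2 - 1 :: real)"

lemma Kd_has_derivative: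
  fixes y :: "'a::euclidean_space"
  assumes "0 < \<delta>"
  shows "((\<lambda>x. Kd \<delta> lam (x - y)) has_derivative (\<lambda>k. Ed \<delta> lam (x - y) * ((x - y) \<bullet> k))) (at x)"
proof -
  have pos: "0 < (x - y) \<bullet> (x - y) + \<delta>" using assms by (simp add: add_nonneg_pos)
  have 1: "((\<lambda>t. t powr (- lam / 2)) has_real_derivative (- lam / 2) * ((x - y) \<bullet> (x - y) + \<delta>) powr (- lam / 2 - 1))
     (at ((x - y) \<bullet> (x - y) + \<delta>))"
    by (rule has_real_derivative_powr[OF pos])
  have 2: "((\<lambda>x. (x - y) \<bullet> (x - y) + \<delta>) has_derivative (\<lambda>k. 2 * ((x - y) \<bullet> k))) (at x)"
    by (auto intro!: derivative_eq_intros simp: inner_commute)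
  show ?thesis unfolding Kd_def Ed_def
    using DERIV_compose_FDERIV[OF 1 2] by (rule has_derivative_eq_rhs) (simp add: fun_eq_iff)
qed

lemma Kd_Ed_continuous:
  fixes y :: "'a::euclidean_space"
  assumes "0 < \<delta>"
  shows "continuous_on S (\<lambda>x. Kd \<delta> lam (x - y))" "continuous_on S (\<lambda>x. Ed \<delta> lam (x - y))"
proof -
  have "(x - y) \<bullet> (x - y) + \<delta> \<noteq> 0" for x using assms by (simp add: add_nonneg_pos less_imp_neq[symmetric])
  then show "continuous_on S (\<lambda>x. Kd \<delta> lam (x - y))" "continuous_on S (\<lambda>x. Ed \<delta> lam (x - y))"
    unfolding Kd_def Ed_def by (intro continuous_intros; simp)+
qed

lemma Kd_Ed_measurable [measurable]:
  "Kd \<delta> lam \<in> borel_measurable (borel :: 'a::euclidean_space measure)"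
  "Ed \<delta> lam \<in> borel_measurable (borel :: 'a::euclidean_space measure)"
  unfolding Kd_def[abs_def] Ed_def[abs_def] by measurable

locale approximated_choquard = choquard_data u g h r \<alpha> p c + approximated_data u g h r m U H
  for u :: "'a::euclidean_space \<Rightarrow> real" and g h r \<alpha> p c m U H
begin

text \<open>The exponent is chosen so that \<open>E0 powr (r / p)\<close> is \<open>H\<close> on the
  ball, hence integrable, while \<open>E0\<close> bounds \<open>\<bar>s x * a\<bar>\<close> whenever
  \<open>\<bar>a\<bar> powr r \<le> H x\<close>. Thus \<open>kernel f1\<close> is an integrable
  majorant common to all double integrals.\<close>

definition "E0 x = indicator (cball 0 m) x * H x powr (p / r)"
definition "f1 x = F x + E0 x"

lemma H_measurable [measurable]: "H \<in> borel_measurable borel"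
  using Hi by auto

lemma E0_measurable [measurable]: "E0 \<in> borel_measurable borel"
proof -
  have "(\<lambda>x. H x powr (p / r)) \<in> borel_measurable borel" by measurable
  then show ?thesis unfolding E0_def[abs_def] by (intro borel_measurable_times indicator_cball_measurable)
qed

lemma f1_measurable [measurable]: "f1 \<in> borel_measurable borel"
  unfolding f1_def[abs_def] by measurable

lemma E0_nonneg: "0 \<le> E0 x" by (simp add: E0_def)

lemma f1_nonneg: "0 \<le> f1 x" by (simp add: f1_def E0_nonneg F_nonneg)

lemma kernel_f1_integrable: "integrable (lborel \<Otimes>\<^sub>M lborel) (kernel f1)"
proof -
  have "(\<lambda>x. E0 x powr (r / p)) = (\<lambda>x. indicator (cball 0 m) x * H x)"
  proof
    fix x
    show "E0 x powr (r / p) = indicator (cball 0 m) x * H x"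
      using H0[of x] r p by (auto simp: E0_def powr_powr indicator_def)
  qed
  then have "integrable lborel (\<lambda>x. E0 x powr (r / p))"
    using integrable_indicator_mult[OF Hi] by simp
  then show ?thesis unfolding f1_def[abs_def] by (intro kernel_integrable E0_nonneg E0_measurable)
qed

lemma kernel_f1_nonneg: "0 \<le> kernel f1 z"
  by (simp add: kernel_def f1_nonneg K_nonneg)

lemma V_f1_integrable: "integrable lborel (\<lambda>x. V x * f1 x)"
  using V_integrable[OF kernel_f1_integrable[unfolded f1_def[abs_def]] E0_nonneg E0_measurable]
  by (simp add: f1_def)

text \<open>The quantifier over \<open>a\<close> sits inside, so a single null set serves
  \<open>u\<close>, \<open>g\<close> and all \<open>U n\<close> with their derivatives.\<close>

lemma s_mult_le: "AE x in lborel. norm x \<le> m \<longrightarrow> (\<forall>a. \<bar>a\<bar> powr r \<le> H x \<longrightarrow> \<bar>s x * a\<bar> \<le> E0 x)"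
  using Ur
proof eventually_elim
  case (elim x)
  then show ?case using powr_mult_le_powr[OF p, of r "u x" "H x"] r by (auto simp: abs_mult abs_s E0_def)
qed

lemma kernel_dominated_integrable:
  assumes "f \<in> borel_measurable (lborel \<Otimes>\<^sub>M lborel)" "AE z in lborel \<Otimes>\<^sub>M lborel. \<bar>f z\<bar> \<le> C * kernel f1 z"
  shows "integrable (lborel \<Otimes>\<^sub>M lborel) f"
proof (rule Bochner_Integration.integrable_bound[of _ "\<lambda>z. \<bar>C\<bar> * kernel f1 z"])
  show "integrable (lborel \<Otimes>\<^sub>M lborel) (\<lambda>z. \<bar>C\<bar> * kernel f1 z)"
    by (intro integrable_mult_right kernel_f1_integrable)
  show "AE z in lborel \<Otimes>\<^sub>M lborel. norm (f z) \<le> norm (\<bar>C\<bar> * kernel f1 z)"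
    using assms(2)
  proof eventually_elim
    case (elim z)
    have "C * kernel f1 z \<le> \<bar>C\<bar> * kernel f1 z" using kernel_f1_nonneg by (intro mult_right_mono) auto
    then show ?case using elim kernel_f1_nonneg[of z] by simp
  qed
qed fact

text \<open>The majorant is a multiple of \<open>V x * f1 x\<close>, integrable by the
  Hardy-Littlewood-Sobolev inequality.\<close>

lemma V_lim_int:
  assumes w: "continuous_on UNIV w" "\<And>x. norm x > m \<Longrightarrow> w x = 0"
    and Am [measurable]: "\<And>n. A n \<in> borel_measurable borel" "B \<in> borel_measurable borel"
    and A: "AE x in lborel. norm x \<le> m \<longrightarrow> (\<forall>n. \<bar>A n x\<bar> powr r \<le> H x) \<and> (\<lambda>n. A n x) \<longlonglongrightarrow> B x"
  shows "lim_int (\<lambda>n x. V x * (s x * (w x * A n x))) (\<lambda>x. V x * (s x * (w x * B x)))"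
proof -
  obtain M where M: "0 \<le> M" "\<And>x. \<bar>w x\<bar> \<le> M"
    using bounded_continuous_compact_support[OF w] by blast
  have [measurable]: "w \<in> borel_measurable borel" using w(1) by (rule borel_measurable_continuous_onI)
  let ?G = "\<lambda>x. M * (V x * f1 x)"
  have Gi: "integrable lborel ?G" by (intro integrable_mult_right V_f1_integrable)
  have G0: "0 \<le> ?G x" for x using M V_nonneg f1_nonneg by simp
  have d: "AE x in lborel. norm (V x * (s x * (w x * A n x))) \<le> ?G x" for n
    using A s_mult_le
  proof eventually_elim
    case (elim x)
    show ?case
    proof (cases "norm x \<le> m")
      case True
      then have "\<bar>s x * A n x\<bar> \<le> f1 x" using elim F_nonneg[of x] by (simp add: f1_def add_increasing)
      then have "\<bar>w x\<bar> * (V x * \<bar>s x * A n x\<bar>) \<le> M * (V x * f1 x)"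
        using M V_nonneg[of x] by (intro mult_mono mult_left_mono) auto
      then show ?thesis using V_nonneg[of x] by (simp add: abs_mult mult_ac)
    next
      case False
      then show ?thesis using w(2)[of x] G0[of x] by simp
    qed
  qed
  have l: "AE x in lborel. (\<lambda>n. V x * (s x * (w x * A n x))) \<longlonglongrightarrow> V x * (s x * (w x * B x))"
    using A
  proof eventually_elim
    case (elim x)
    then show ?case using w(2)[of x] by (cases "norm x \<le> m") (auto intro!: tendsto_mult_left)
  qed
  have m1: "(\<lambda>x. V x * (s x * (w x * A n x))) \<in> borel_measurable lborel" "(\<lambda>x. V x * (s x * (w x * B x))) \<in> borel_measurable lborel" for n
    by simp_all
  show ?thesis unfolding lim_int_def
    using integrable_dominated_convergence2[OF m1(2) m1(1) Gi l d] integrable_dominated_convergence[OF m1(2) m1(1) Gi l d]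
      integral_dominated_convergence[OF m1(2) m1(1) Gi l d] by blast
qed

lemma pd_U_conv: "b \<in> Basis \<Longrightarrow>
   AE x in lborel. norm x \<le> m \<longrightarrow> (\<forall>n. \<bar>pd b (U n) x\<bar> powr r \<le> H x) \<and> (\<lambda>n. pd b (U n) x) \<longlonglongrightarrow> g b x"
  using Ur U1[of b] unfolding dominated_seq_def by (auto elim: eventually_elim2)

lemma U_conv: "AE x in lborel. norm x \<le> m \<longrightarrow> (\<forall>n. \<bar>U n x\<bar> powr r \<le> H x) \<and> (\<lambda>n. U n x) \<longlonglongrightarrow> u x"
  using Ur U0 unfolding dominated_seq_def by (auto elim: eventually_elim2)

lemma U_measurable [measurable]: "U n \<in> borel_measurable borel"
  by (rule smooth_measurable[OF Us])

lemma pd_U_measurable: "b \<in> Basis \<Longrightarrow> pd b (U n) \<in> borel_measurable borel"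
  by (rule smooth_measurable[OF smooth_pd[OF Us]])

lemma V_radial_lim_int:
  "lim_int (\<lambda>n x. \<Sum>b\<in>Basis. V x * (s x * (wt b x * pd b (U n) x))) (\<lambda>x. \<Sum>b\<in>Basis. V x * (s x * (wt b x * g b x)))"
  by (intro lim_int_sum V_lim_int pd_U_conv pd_U_measurable gm continuous_intros) (auto simp: wt_zero)

lemma pohozaev_test:
  "(LBINT x. (\<Sum>j\<in>Basis. \<Sum>b\<in>Basis. wt2 j b x * (g j x * g b x)))
     - (LBINT x. cutD m x * ((u x * u x + (\<Sum>j\<in>Basis. g j x * g j x)) / 2))
   = c * (LBINT x. (\<Sum>b\<in>Basis. V x * (s x * (wt b x * g b x))))"
proof (rule LIMSEQ_unique[OF vtest_lhs_limit])
  have "(\<lambda>n. c * (LBINT x. (\<Sum>b\<in>Basis. V x * (s x * (wt b x * pd b (U n) x)))))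
     \<longlonglongrightarrow> c * (LBINT x. (\<Sum>b\<in>Basis. V x * (s x * (wt b x * g b x))))"
    using V_radial_lim_int unfolding lim_int_def by (intro tendsto_mult_left) auto
  moreover have "c * (LBINT x. (\<Sum>b\<in>Basis. V x * (s x * (wt b x * pd b (U n) x))))
      = (LBINT x. (\<Sum>j\<in>Basis. g j x * pd j (vtest n) x) + u x * vtest n x)" for n
    unfolding equation[OF vtest_test_function] by (simp add: vtest_def sum_distrib_left)
  ultimately show "(\<lambda>n. LBINT x. (\<Sum>j\<in>Basis. g j x * pd j (vtest n) x) + u x * vtest n x)
     \<longlonglongrightarrow> c * (LBINT x. (\<Sum>b\<in>Basis. V x * (s x * (wt b x * g b x))))" by simp
qed

text \<open>The test function is \<open>cutP m x * U n x\<close>. Differentiating the cut-off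
  produces the middle sum, which disappears only when \<open>m\<close> tends to infinity.\<close>

lemma energy_test:
  "(LBINT x. (\<Sum>j\<in>Basis. cutP m x * (g j x * g j x)) + (\<Sum>j\<in>Basis. (- cutQ m x * (x \<bullet> j)) * (g j x * u x))
      + cutP m x * (u x * u x)) = c * (LBINT x. V x * (cutP m x * F x))"
proof -
  define w where "w n x = cutP m x * U n x" for n x
  have wt: "w n \<in> test_functions" for n
  proof (rule test_functionsI[of _ m])
    show "smooth (w n)" unfolding w_def[abs_def] using Ck_mult smooth_cutP Us by blast
  qed (simp add: w_def wt_zero)
  have pw: "pd j (w n) x = cutP m x * pd j (U n) x + - cutQ m x * (x \<bullet> j) * U n x" for j n x
    unfolding w_def[abs_def] by (rule pd_eqI[OF has_derivative_mult[OF cutP_has_derivative Ud]])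
  have "lim_int (\<lambda>n x. (\<Sum>j\<in>Basis. cutP m x * (g j x * pd j (U n) x)) + (\<Sum>j\<in>Basis. (- cutQ m x * (x \<bullet> j)) * (g j x * U n x))
      + cutP m x * (u x * U n x))
    (\<lambda>x. (\<Sum>j\<in>Basis. cutP m x * (g j x * g j x)) + (\<Sum>j\<in>Basis. (- cutQ m x * (x \<bullet> j)) * (g j x * u x))
      + cutP m x * (u x * u x))"
    using wt_zero by (intro lim_int_add lim_int_sum lim_int_mult[OF Hi] continuous_intros)
      (auto intro: U0 U1 U2 dominated_seq_const)
  moreover have "(\<Sum>j\<in>Basis. cutP m x * (g j x * pd j (U n) x)) + (\<Sum>j\<in>Basis. (- cutQ m x * (x \<bullet> j)) * (g j x * U n x))
      + cutP m x * (u x * U n x) = (\<Sum>j\<in>Basis. g j x * pd j (w n) x) + u x * w n x" for n x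
    by (simp add: pw w_def algebra_simps sum.distrib[symmetric] cong: sum.cong)
  ultimately have 1: "(\<lambda>n. LBINT x. (\<Sum>j\<in>Basis. g j x * pd j (w n) x) + u x * w n x) \<longlonglongrightarrow>
     (LBINT x. (\<Sum>j\<in>Basis. cutP m x * (g j x * g j x)) + (\<Sum>j\<in>Basis. (- cutQ m x * (x \<bullet> j)) * (g j x * u x))
      + cutP m x * (u x * u x))"
    by (simp only: lim_int_def)
  have "lim_int (\<lambda>n x. V x * (s x * (cutP m x * U n x))) (\<lambda>x. V x * (s x * (cutP m x * u x)))"
    by (intro V_lim_int U_conv U_measurable um continuous_intros) (simp add: wt_zero)
  then have "(\<lambda>n. c * (LBINT x. V x * (s x * (cutP m x * U n x)))) \<longlonglongrightarrow> c * (LBINT x. V x * (s x * (cutP m x * u x)))"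
    unfolding lim_int_def by (intro tendsto_mult_left) auto
  moreover have "s x * (cutP m x * u x) = cutP m x * F x" for x
    using s_u[of x] by (simp add: mult.left_commute)
  ultimately have "(\<lambda>n. LBINT x. (\<Sum>j\<in>Basis. g j x * pd j (w n) x) + u x * w n x)
      \<longlonglongrightarrow> c * (LBINT x. V x * (cutP m x * F x))"
    unfolding equation[OF wt] by (simp add: w_def)
  then show ?thesis using 1 LIMSEQ_unique by blast
qed

text \<open>The divergence of the field \<open>|u| powr p * Kd \<delta> lam (x - y)\<close> times X,
  integrated in \<open>x\<close> for fixed \<open>y\<close>. Its three groups come from X, from
  \<open>|u| powr p\<close> and from the kernel. The regularised kernel is differentiable across
  \<open>x = y\<close>, so \<open>radial_integration_by_parts\<close> applies with
  \<open>U n\<close> in place of \<open>u\<close>.\<close>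

lemma regularised_identity:
  assumes \<delta>: "0 < \<delta>"
  shows "(LBINT x. (cutD m x * Kd \<delta> lam (x - y)) * F x + (\<Sum>b\<in>Basis. (p * wt b x * Kd \<delta> lam (x - y)) * (s x * g b x))
     + (\<Sum>b\<in>Basis. (wt b x * (Ed \<delta> lam (x - y) * ((x - y) \<bullet> b))) * F x)) = 0"
proof -
  note cont = Kd_Ed_continuous[OF \<delta>]
  define \<sigma> where "\<sigma> t = \<bar>t\<bar> powr (p - 2) * t" for t :: real
  have c\<sigma>: "continuous_on UNIV (\<lambda>x. \<sigma> (U n x))" for n
    unfolding \<sigma>_def using isCont_signed_powr[OF p]
    by (intro continuous_on_compose2[of UNIV "\<lambda>t. \<bar>t\<bar> powr (p - 2) * t" UNIV "U n"] continuous_at_imp_continuous_on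
        smooth_continuous[OF Us]) auto
  have cp: "continuous_on UNIV (\<lambda>x. \<bar>U n x\<bar> powr p)" for n
    using DERIV_isCont[OF abs_powr_has_derivative[OF p]]
    by (intro continuous_on_compose2[of UNIV "\<lambda>t. \<bar>t\<bar> powr p" UNIV "U n"] continuous_at_imp_continuous_on
        smooth_continuous[OF Us]) auto
  have s\<sigma>: "s x = \<sigma> (u x)" for x by (simp add: s_def \<sigma>_def)
  have pr: "p \<le> r" using p_less_r by simp
  have AF: "AE x in lborel. norm x \<le> m \<longrightarrow> (\<forall>n. \<bar>\<bar>U n x\<bar> powr p\<bar> \<le> 1 + H x) \<and> (\<lambda>n. \<bar>U n x\<bar> powr p) \<longlonglongrightarrow> F x"
    using U_conv
  proof eventually_elim
    case (elim x)
    show ?case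
    proof (intro impI conjI allI)
      assume x: "norm x \<le> m"
      show "\<bar>\<bar>U n x\<bar> powr p\<bar> \<le> 1 + H x" for n
      proof -
        have "\<bar>U n x\<bar> powr p \<le> 1 + \<bar>U n x\<bar> powr r" using pr p by (intro powr_le_1_plus) auto
        also have "\<dots> \<le> 1 + H x" using elim x by simp
        finally show ?thesis by simp
      qed
      show "(\<lambda>n. \<bar>U n x\<bar> powr p) \<longlonglongrightarrow> F x"
        unfolding F_def using elim x
        by (intro isCont_tendsto_compose[where g="\<lambda>t. \<bar>t\<bar> powr p"] DERIV_isCont[OF abs_powr_has_derivative[OF p]]) simp
    qed
  qed
  have As: "AE x in lborel. norm x \<le> m \<longrightarrow> (\<forall>n. \<bar>\<sigma> (U n x) * pd b (U n) x\<bar> \<le> 1 + H x)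
      \<and> (\<lambda>n. \<sigma> (U n x) * pd b (U n) x) \<longlonglongrightarrow> s x * g b x" if "b \<in> Basis" for b
    using U_conv pd_U_conv[OF that]
  proof eventually_elim
    case (elim x)
    show ?case
    proof (intro impI conjI allI)
      assume x: "norm x \<le> m"
      show "\<bar>\<sigma> (U n x) * pd b (U n) x\<bar> \<le> 1 + H x" for n
      proof -
        have "\<bar>\<sigma> (U n x) * pd b (U n) x\<bar> = \<bar>U n x\<bar> powr (p - 1) * \<bar>pd b (U n) x\<bar>"
          unfolding \<sigma>_def abs_mult[of _ "pd b (U n) x"] abs_powr_sgn[OF p] ..
        also have "\<dots> \<le> H x powr (p / r)"
          using elim x r by (intro powr_mult_le_powr[OF p]) auto
        also have "\<dots> \<le> 1 + H x powr 1"
          using H0 pr p r by (intro powr_le_1_plus) auto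
        finally show ?thesis using H0[of x] by simp
      qed
      show "(\<lambda>n. \<sigma> (U n x) * pd b (U n) x) \<longlonglongrightarrow> s x * g b x"
      proof (rule tendsto_mult)
        show "(\<lambda>n. \<sigma> (U n x)) \<longlonglongrightarrow> s x"
          unfolding s\<sigma> \<sigma>_def using elim x
          by (intro isCont_tendsto_compose[where g="\<lambda>t. \<bar>t\<bar> powr (p - 2) * t"] isCont_signed_powr[OF p]) simp
        show "(\<lambda>n. pd b (U n) x) \<longlonglongrightarrow> g b x" using elim x by simp
      qed
    qed
  qed
  have m\<sigma>: "(\<lambda>x. \<sigma> (U n x) * pd b (U n) x) \<in> borel_measurable borel" if "b \<in> Basis" for n b
    by (intro borel_measurable_continuous_onI continuous_intros c\<sigma> U1c that)
  have msg: "(\<lambda>x. s x * g b x) \<in> borel_measurable borel" if "b \<in> Basis" for b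
    using gm[OF that] by measurable
  have mp: "(\<lambda>x. \<bar>U n x\<bar> powr p) \<in> borel_measurable borel" for n
    by (intro borel_measurable_continuous_onI cp)
  let ?\<Phi> = "\<lambda>n x. (cutD m x * Kd \<delta> lam (x - y)) * \<bar>U n x\<bar> powr p
     + (\<Sum>b\<in>Basis. (p * wt b x * Kd \<delta> lam (x - y)) * (\<sigma> (U n x) * pd b (U n) x))
     + (\<Sum>b\<in>Basis. (wt b x * (Ed \<delta> lam (x - y) * ((x - y) \<bullet> b))) * \<bar>U n x\<bar> powr p)"
  have l: "lim_int ?\<Phi> (\<lambda>x. (cutD m x * Kd \<delta> lam (x - y)) * F x
     + (\<Sum>b\<in>Basis. (p * wt b x * Kd \<delta> lam (x - y)) * (s x * g b x))
     + (\<Sum>b\<in>Basis. (wt b x * (Ed \<delta> lam (x - y) * ((x - y) \<bullet> b))) * F x))"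
    by (intro lim_int_add lim_int_sum lim_int_weight[OF Hi _ _ _ _ AF] lim_int_weight[OF Hi _ _ _ _ As]
        m\<sigma> msg mp F_measurable continuous_intros cont) (auto simp: wt_zero)
  have z: "(LBINT x. ?\<Phi> n x) = 0" for n
  proof -
    have dp: "((\<lambda>x. \<bar>U n x\<bar> powr p) has_derivative (\<lambda>k. pd k (U n) x * (p * \<sigma> (U n x)))) (at x)" for x
      unfolding \<sigma>_def by (rule DERIV_compose_FDERIV[OF abs_powr_has_derivative[OF p] Ud])
    have d: "((\<lambda>x. \<bar>U n x\<bar> powr p * Kd \<delta> lam (x - y)) has_derivative
        (\<lambda>k. \<bar>U n x\<bar> powr p * (Ed \<delta> lam (x - y) * ((x - y) \<bullet> k)) + pd k (U n) x * (p * \<sigma> (U n x)) * Kd \<delta> lam (x - y))) (at x)" for x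
      by (rule has_derivative_mult[OF dp Kd_has_derivative[OF \<delta>]])
    have "(LBINT x. cutD m x * (\<bar>U n x\<bar> powr p * Kd \<delta> lam (x - y)) + (\<Sum>b\<in>Basis. wt b x *
        (\<bar>U n x\<bar> powr p * (Ed \<delta> lam (x - y) * ((x - y) \<bullet> b)) + pd b (U n) x * (p * \<sigma> (U n x)) * Kd \<delta> lam (x - y)))) = 0"
      by (rule radial_integration_by_parts[OF m d]) (intro continuous_intros c\<sigma> cp U1c cont)
    also have "(\<lambda>x. cutD m x * (\<bar>U n x\<bar> powr p * Kd \<delta> lam (x - y)) + (\<Sum>b\<in>Basis. wt b x *
        (\<bar>U n x\<bar> powr p * (Ed \<delta> lam (x - y) * ((x - y) \<bullet> b)) + pd b (U n) x * (p * \<sigma> (U n x)) * Kd \<delta> lam (x - y)))) = ?\<Phi> n"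
      unfolding distrib_left sum.distrib by (rule ext) (simp add: mult_ac)
    finally show ?thesis .
  qed
  show ?thesis by (rule lim_int_unique_0[OF l z])
qed

end

section \<open>Estimates and limits for the regularised kernel\<close>

lemma inner_self_powr: "(z \<bullet> z) powr a = norm z powr (2 * a)"
  by (simp add: power2_norm_eq_inner[symmetric] powr_powr flip: powr_numeral)

lemma Kd_nonneg: "0 \<le> Kd \<delta> lam z"
  by (simp add: Kd_def)

lemma Kd_le:
  fixes z :: "'a::euclidean_space"
  assumes "z \<noteq> 0" "0 < \<delta>" "0 < lam"
  shows "Kd \<delta> lam z \<le> norm z powr - lam"
proof -
  have "(z \<bullet> z + \<delta>) powr (- lam / 2) \<le> (z \<bullet> z) powr (- lam / 2)"
    using assms by (intro powr_mono2') auto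
  then show ?thesis by (simp add: Kd_def inner_self_powr)
qed

lemma Ed_eq:
  fixes z :: "'a::euclidean_space"
  assumes "0 < \<delta>"
  shows "Ed \<delta> lam z = - lam * Kd \<delta> lam z / (z \<bullet> z + \<delta>)"
proof -
  have "0 < z \<bullet> z + \<delta>" using assms by (simp add: add_nonneg_pos)
  then show ?thesis by (simp add: Ed_def Kd_def powr_diff)
qed

lemma Kd_Ed_tendsto:
  fixes z :: "'a::euclidean_space"
  assumes "z \<noteq> 0"
  shows "(\<lambda>k. Kd (1 / (real k + 1)) lam z) \<longlonglongrightarrow> norm z powr - lam"
    and "(\<lambda>k. Ed (1 / (real k + 1)) lam z) \<longlonglongrightarrow> - lam * norm z powr - lam / (z \<bullet> z)"
proof -
  have i: "(\<lambda>k. 1 / (real k + 1)) \<longlonglongrightarrow> 0"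
    using LIMSEQ_inverse_real_of_nat by (simp add: inverse_eq_divide add.commute)
  have d: "(\<lambda>k. z \<bullet> z + 1 / (real k + 1)) \<longlonglongrightarrow> z \<bullet> z"
    using tendsto_add[OF tendsto_const i, of "z \<bullet> z"] by simp
  have K: "(\<lambda>k. Kd (1 / (real k + 1)) lam z) \<longlonglongrightarrow> (z \<bullet> z) powr (- lam / 2)"
    unfolding Kd_def using assms by (intro tendsto_powr d tendsto_const) simp
  then show K': "(\<lambda>k. Kd (1 / (real k + 1)) lam z) \<longlonglongrightarrow> norm z powr - lam"
    by (simp add: inner_self_powr)
  have "(\<lambda>k. - lam * Kd (1 / (real k + 1)) lam z / (z \<bullet> z + 1 / (real k + 1))) \<longlonglongrightarrow> - lam * norm z powr - lam / (z \<bullet> z)"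
    using assms by (intro tendsto_divide tendsto_mult K' d tendsto_const) simp
  then show "(\<lambda>k. Ed (1 / (real k + 1)) lam z) \<longlonglongrightarrow> - lam * norm z powr - lam / (z \<bullet> z)"
    by (subst Ed_eq) simp_all
qed

text \<open>A crude bound that blows up as \<delta> tends to 0. It serves only to make
  \<open>tc\<close> integrable for a fixed \<delta>, which is what the interchange of variables
  requires.\<close>

lemma norm_div_le:
  fixes z :: "'a::euclidean_space"
  assumes "0 < \<delta>"
  shows "norm z / (z \<bullet> z + \<delta>) \<le> 1 + 1 / \<delta>"
proof -
  have pos: "0 < z \<bullet> z + \<delta>" using assms by (simp add: add_nonneg_pos)
  have "norm z \<le> 1 + z \<bullet> z"
    using le_1_powr[of "norm z" 2] by (simp add: power2_norm_eq_inner powr_numeral)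
  also have "\<dots> \<le> (1 + 1 / \<delta>) * (z \<bullet> z + \<delta>)"
    using assms by (simp add: field_simps)
  finally show ?thesis using pos by (simp add: pos_divide_le_eq)
qed

definition cutX :: "real \<Rightarrow> 'a::euclidean_space \<Rightarrow> 'a" where
  "cutX m x = cutP m x *\<^sub>R x"

text \<open>On the diagonal the quotient is 0 by division by zero, so the bound in
  \<open>cutL_bound\<close> holds everywhere.\<close>

definition cutL :: "real \<Rightarrow> 'a::euclidean_space \<times> 'a \<Rightarrow> real" where
  "cutL m z = (fst z - snd z) \<bullet> (cutX m (fst z) - cutX m (snd z)) / ((fst z - snd z) \<bullet> (fst z - snd z))"

lemma cut_inner_le:
  "\<bar>(x - y) \<bullet> (cutX m x - cutX m y)\<bar> \<le> 5 * exp 1 * ((x - y) \<bullet> (x - y))"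
proof -
  have "\<bar>(x - y) \<bullet> (cutX m x - cutX m y)\<bar> \<le> norm (x - y) * norm (cutX m x - cutX m y)"
    by (rule Cauchy_Schwarz_ineq2)
  also have "\<dots> \<le> norm (x - y) * (5 * exp 1 * norm (x - y))"
    unfolding cutX_def by (intro mult_left_mono cut_field_lipschitz) simp
  finally show ?thesis by (simp add: power2_norm_eq_inner[symmetric] power2_eq_square mult_ac)
qed

lemma cutL_bound: "\<bar>cutL m z\<bar> \<le> 5 * exp 1"
proof (cases "fst z = snd z")
  case False
  then have "0 < (fst z - snd z) \<bullet> (fst z - snd z)" by simp
  then show ?thesis using cut_inner_le[of "fst z" "snd z" m] by (simp add: cutL_def abs_divide pos_divide_le_eq)
qed (simp add: cutL_def)

lemma cut_measurable [measurable]: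
  "cutP m \<in> borel_measurable (borel :: 'a::euclidean_space measure)"
  "cutD m \<in> borel_measurable (borel :: 'a::euclidean_space measure)"
  "cutQ m \<in> borel_measurable (borel :: 'a::euclidean_space measure)"
  by (intro borel_measurable_continuous_onI cut_continuous)+

lemma cutX_measurable [measurable]: "cutX m \<in> borel_measurable (borel :: 'a::euclidean_space measure)"
  unfolding cutX_def[abs_def] by measurable

lemma cutL_measurable [measurable]:
  "cutL m \<in> borel_measurable (lborel \<Otimes>\<^sub>M lborel :: ('a::euclidean_space \<times> 'a) measure)"
  unfolding cutL_def[abs_def] by measurable

context approximated_choquard
begin

lemma F_kernel_le: "F x * K (x - y) * F y \<le> kernel f1 (x, y)"
  unfolding kernel_def f1_def using E0_nonneg F_nonneg K_nonneg
  by (simp add: mult_mono mult_nonneg_nonneg add_nonneg_nonneg)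

lemma E0_kernel_le: "E0 x * K (x - y) * F y \<le> kernel f1 (x, y)"
  unfolding kernel_def f1_def using E0_nonneg F_nonneg K_nonneg
  by (simp add: mult_mono mult_nonneg_nonneg add_nonneg_nonneg)

lemma wt_bound:
  assumes "b \<in> Basis" shows "\<bar>wt b x\<bar> \<le> exp 1 * m"
proof (cases "norm x \<le> m")
  case True
  then have "\<bar>x \<bullet> b\<bar> \<le> m" using Basis_le_norm[OF assms, of x] by simp
  then show ?thesis using cutP_bounds[of m x] unfolding abs_mult by (intro mult_mono) auto
next
  case False
  then have z: "wt b x = 0" by (intro wt_zero) simp
  show ?thesis unfolding z using m by simp
qed

lemma cutX_norm: "norm (cutX m x) \<le> exp 1 * m"
proof (cases "norm x \<le> m")
  case True
  then show ?thesis using cutP_bounds[of m x] by (simp add: cutX_def mult_mono)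
next
  case False
  then have z: "cutP m x = 0" by (intro wt_zero) simp
  show ?thesis unfolding cutX_def z using m by simp
qed

lemma Kd_le_K: "0 < \<delta> \<Longrightarrow> x \<noteq> y \<Longrightarrow> Kd \<delta> lam (x - y) \<le> K (x - y)"
  using Kd_le[of "x - y" \<delta> lam] lam by (simp add: K_def)

text \<open>Formally \<open>p * Sg\<close> is the derivative of \<open>|u| powr p\<close> along
  X.\<close>

definition "Sg x = (\<Sum>b\<in>Basis. wt b x * (s x * g b x))"

lemma Sg_measurable [measurable]: "Sg \<in> borel_measurable borel"
  unfolding Sg_def[abs_def] by (intro borel_measurable_sum borel_measurable_times cut_measurable s_measurable gm) simp_all

lemma Sg_bound: "AE x in lborel. \<bar>Sg x\<bar> \<le> DIM('a) * (exp 1 * m) * E0 x"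
  using s_mult_le Ur
proof eventually_elim
  case (elim x)
  have "\<bar>Sg x\<bar> \<le> (\<Sum>b\<in>(Basis::'a set). exp 1 * m * E0 x)"
    unfolding Sg_def
  proof (rule order_trans[OF sum_abs sum_mono])
    fix b :: 'a assume b: "b \<in> Basis"
    show "\<bar>wt b x * (s x * g b x)\<bar> \<le> exp 1 * m * E0 x"
    proof (cases "norm x \<le> m")
      case True
      then have "\<bar>s x * g b x\<bar> \<le> E0 x" using elim b by auto
      then show ?thesis unfolding abs_mult[of "wt b x"] using wt_bound[OF b, of x] m
        by (intro mult_mono) auto
    next
      case False
      then have z: "wt b x = 0" by (intro wt_zero) simp
      show ?thesis unfolding z using m E0_nonneg[of x] by simp
    qed
  qed
  then show ?case by (simp add: mult.assoc)
qed

lemma a_bound: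
  assumes "0 < \<delta>" "x \<noteq> y"
  shows "\<bar>cutD m x * Kd \<delta> lam (x - y) * F x * F y\<bar> \<le> (DIM('a) * exp 1 + 4 * exp 1) * kernel f1 (x, y)"
proof -
  have "\<bar>cutD m x * Kd \<delta> lam (x - y) * F x * F y\<bar> = \<bar>cutD m x\<bar> * (F x * Kd \<delta> lam (x - y) * F y)"
    using F_nonneg Kd_nonneg[of \<delta> lam "x - y"] by (simp add: abs_mult mult_ac)
  also have "\<dots> \<le> (DIM('a) * exp 1 + 4 * exp 1) * (F x * K (x - y) * F y)"
    using Kd_le_K[OF assms] F_nonneg Kd_nonneg cutD_bound[of m x]
    by (intro mult_mono mult_left_mono mult_right_mono) (auto intro: mult_nonneg_nonneg)
  also have "\<dots> \<le> (DIM('a) * exp 1 + 4 * exp 1) * kernel f1 (x, y)"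
    using F_kernel_le[of x y] by (intro mult_left_mono) auto
  finally show ?thesis .
qed

lemma b_bound:
  assumes "0 < \<delta>" "x \<noteq> y" "\<bar>Sg x\<bar> \<le> C * E0 x" "0 \<le> C"
  shows "\<bar>Sg x * Kd \<delta> lam (x - y) * F y\<bar> \<le> C * kernel f1 (x, y)"
proof -
  have "\<bar>Sg x * Kd \<delta> lam (x - y) * F y\<bar> = \<bar>Sg x\<bar> * (Kd \<delta> lam (x - y) * F y)"
    using F_nonneg Kd_nonneg[of \<delta> lam "x - y"] by (simp add: abs_mult)
  also have "\<dots> \<le> C * E0 x * (K (x - y) * F y)"
    using Kd_le_K[OF assms(1,2)] assms F_nonneg E0_nonneg
    by (intro mult_mono mult_right_mono mult_nonneg_nonneg Kd_nonneg K_nonneg) auto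
  also have "\<dots> = C * (E0 x * K (x - y) * F y)" by simp
  also have "\<dots> \<le> C * kernel f1 (x, y)" by (intro mult_left_mono E0_kernel_le assms)
  finally show ?thesis .
qed

lemma Ed_abs_le:
  assumes "0 < \<delta>" "x \<noteq> y"
  shows "\<bar>Ed \<delta> lam (x - y)\<bar> \<le> lam * K (x - y) / ((x - y) \<bullet> (x - y) + \<delta>)"
proof -
  have pos: "0 < (x - y) \<bullet> (x - y) + \<delta>" using assms by (simp add: add_nonneg_pos)
  have "\<bar>Ed \<delta> lam (x - y)\<bar> = lam * Kd \<delta> lam (x - y) / ((x - y) \<bullet> (x - y) + \<delta>)"
    using pos lam Kd_nonneg[of \<delta> lam "x - y"] by (simp add: Ed_eq[OF assms(1)] abs_mult)
  also have "\<dots> \<le> lam * K (x - y) / ((x - y) \<bullet> (x - y) + \<delta>)"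
    using pos lam Kd_le_K[OF assms] by (intro divide_right_mono mult_left_mono) auto
  finally show ?thesis .
qed

lemma c_bound:
  assumes "0 < \<delta>" "x \<noteq> y"
  shows "\<bar>Ed \<delta> lam (x - y) * (cutX m x \<bullet> (x - y)) * F x * F y\<bar>
    \<le> lam * (exp 1 * m) * (1 + 1 / \<delta>) * kernel f1 (x, y)"
proof -
  let ?d = "(x - y) \<bullet> (x - y) + \<delta>"
  have pos: "0 < ?d" using assms by (simp add: add_nonneg_pos)
  have "\<bar>cutX m x \<bullet> (x - y)\<bar> \<le> exp 1 * m * norm (x - y)"
    using Cauchy_Schwarz_ineq2[of "cutX m x" "x - y"] cutX_norm[of x]
    by (meson mult_right_mono norm_ge_zero order_trans)
  then have "\<bar>Ed \<delta> lam (x - y)\<bar> * \<bar>cutX m x \<bullet> (x - y)\<bar> \<le> lam * K (x - y) / ?d * (exp 1 * m * norm (x - y))"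
    using Ed_abs_le[OF assms] lam K_nonneg[of "x - y"] pos by (intro mult_mono) auto
  also have "\<dots> = lam * K (x - y) * (exp 1 * m) * (norm (x - y) / ?d)" by simp
  also have "\<dots> \<le> lam * K (x - y) * (exp 1 * m) * (1 + 1 / \<delta>)"
    using lam K_nonneg[of "x - y"] m norm_div_le[OF assms(1), of "x - y"] by (intro mult_left_mono) auto
  finally have "\<bar>Ed \<delta> lam (x - y)\<bar> * \<bar>cutX m x \<bullet> (x - y)\<bar> * (F x * F y)
      \<le> lam * K (x - y) * (exp 1 * m) * (1 + 1 / \<delta>) * (F x * F y)"
    using F_nonneg by (intro mult_right_mono) auto
  also have "\<dots> = lam * (exp 1 * m) * (1 + 1 / \<delta>) * (F x * K (x - y) * F y)" by (simp add: mult_ac)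
  also have "\<dots> \<le> lam * (exp 1 * m) * (1 + 1 / \<delta>) * kernel f1 (x, y)"
    using lam m assms by (intro mult_left_mono F_kernel_le) auto
  finally show ?thesis using F_nonneg by (simp add: abs_mult mult.assoc)
qed

text \<open>The Lipschitz property of X gives the factor \<open>(x - y) \<bullet> (x - y)\<close>,
  which cancels the denominator of \<open>Ed\<close>. Unlike in \<open>c_bound\<close>, the constant
  is free of \<delta>.\<close>

lemma e_bound:
  assumes "0 < \<delta>" "x \<noteq> y"
  shows "\<bar>Ed \<delta> lam (x - y) * ((x - y) \<bullet> (cutX m x - cutX m y)) * F x * F y\<bar> \<le> lam * (5 * exp 1) * kernel f1 (x, y)"
proof -
  let ?d = "(x - y) \<bullet> (x - y) + \<delta>"
  have pos: "0 < ?d" using assms by (simp add: add_nonneg_pos)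
  have "\<bar>Ed \<delta> lam (x - y)\<bar> * \<bar>(x - y) \<bullet> (cutX m x - cutX m y)\<bar> \<le> lam * K (x - y) / ?d * (5 * exp 1 * ?d)"
    using Ed_abs_le[OF assms] lam K_nonneg[of "x - y"] pos cut_inner_le[of x y m] assms(1)
    by (intro mult_mono) (auto intro: order_trans)
  also have "\<dots> = lam * (5 * exp 1) * K (x - y)" using pos by simp
  finally have "\<bar>Ed \<delta> lam (x - y)\<bar> * \<bar>(x - y) \<bullet> (cutX m x - cutX m y)\<bar> * (F x * F y) \<le> lam * (5 * exp 1) * K (x - y) * (F x * F y)"
    using F_nonneg by (intro mult_right_mono) auto
  also have "\<dots> = lam * (5 * exp 1) * (F x * K (x - y) * F y)" by (simp add: mult_ac)
  also have "\<dots> \<le> lam * (5 * exp 1) * kernel f1 (x, y)"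
    using lam by (intro mult_left_mono F_kernel_le) auto
  finally show ?thesis using F_nonneg by (simp add: abs_mult mult.assoc)
qed

abbreviation "MM \<equiv> (lborel \<Otimes>\<^sub>M lborel :: ('a \<times> 'a) measure)"

text \<open>\<open>ta\<close>, \<open>p * tb\<close> and \<open>tc\<close> are the three groups of
  \<open>regularised_identity\<close> multiplied by \<open>F y\<close>; \<open>te\<close> is
  \<open>tc\<close> plus its image under interchange of the variables.\<close>

definition "ta \<delta> z = cutD m (fst z) * Kd \<delta> lam (fst z - snd z) * F (fst z) * F (snd z)"
definition "tb \<delta> z = Sg (fst z) * Kd \<delta> lam (fst z - snd z) * F (snd z)"
definition "tc \<delta> z = Ed \<delta> lam (fst z - snd z) * (cutX m (fst z) \<bullet> (fst z - snd z)) * F (fst z) * F (snd z)"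
definition "te \<delta> z = Ed \<delta> lam (fst z - snd z) * ((fst z - snd z) \<bullet> (cutX m (fst z) - cutX m (snd z))) * F (fst z) * F (snd z)"

lemma t_measurable [measurable]:
  "ta \<delta> \<in> borel_measurable MM" "tb \<delta> \<in> borel_measurable MM" "tc \<delta> \<in> borel_measurable MM" "te \<delta> \<in> borel_measurable MM"
  unfolding ta_def[abs_def] tb_def[abs_def] tc_def[abs_def] te_def[abs_def] by measurable

lemma t_bounds:
  assumes "0 < \<delta>"
  shows "AE z in MM. \<bar>ta \<delta> z\<bar> \<le> (DIM('a) * exp 1 + 4 * exp 1) * kernel f1 z"
    and "AE z in MM. \<bar>tb \<delta> z\<bar> \<le> DIM('a) * (exp 1 * m) * kernel f1 z"
    and "AE z in MM. \<bar>tc \<delta> z\<bar> \<le> lam * (exp 1 * m) * (1 + 1 / \<delta>) * kernel f1 z"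
    and "AE z in MM. \<bar>te \<delta> z\<bar> \<le> lam * (5 * exp 1) * kernel f1 z"
proof -
  note ne = AE_pair_lborel_neq[where 'a='a]
  show "AE z in MM. \<bar>ta \<delta> z\<bar> \<le> (DIM('a) * exp 1 + 4 * exp 1) * kernel f1 z"
    using ne by eventually_elim (use a_bound[OF assms] in \<open>auto simp: ta_def\<close>)
  show "AE z in MM. \<bar>tc \<delta> z\<bar> \<le> lam * (exp 1 * m) * (1 + 1 / \<delta>) * kernel f1 z"
    using ne by eventually_elim (unfold tc_def, metis c_bound[OF assms] prod.collapse)
  show "AE z in MM. \<bar>te \<delta> z\<bar> \<le> lam * (5 * exp 1) * kernel f1 z"
    using ne by eventually_elim (unfold te_def, metis e_bound[OF assms] prod.collapse)
  show "AE z in MM. \<bar>tb \<delta> z\<bar> \<le> DIM('a) * (exp 1 * m) * kernel f1 z"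
    using ne AE_pair_fst[OF Sg_bound]
  proof eventually_elim
    case (elim z)
    then show ?case using b_bound[OF assms elim(1,2)] m by (simp add: tb_def)
  qed
qed

lemma t_integrable:
  assumes "0 < \<delta>"
  shows "integrable MM (ta \<delta>)" "integrable MM (tb \<delta>)" "integrable MM (tc \<delta>)" "integrable MM (te \<delta>)"
  using t_bounds[OF assms] t_measurable by (auto intro: kernel_dominated_integrable)

text \<open>Interchanging \<open>x\<close> and \<open>y\<close> trades the factor \<open>X x\<close>, which does not compensate the singularity of the
  differentiated kernel, for half of \<open>X x - X y\<close>, which does.\<close>

lemma swap_tc:
  assumes "0 < \<delta>"
  shows "(\<integral>z. tc \<delta> z \<partial>MM) = (\<integral>z. te \<delta> z \<partial>MM) / 2"
proof -
  have s: "(\<integral>z. tc \<delta> (snd z, fst z) \<partial>MM) = (\<integral>z. tc \<delta> z \<partial>MM)"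
    using lborel_pair.integral_product_swap[OF t_measurable(3)] by (simp add: case_prod_unfold)
  have si: "integrable MM (\<lambda>z. tc \<delta> (snd z, fst z))"
    using lborel_pair.integrable_product_swap[OF t_integrable(3)[OF assms]] by (simp add: case_prod_unfold)
  have "te \<delta> z = tc \<delta> z + tc \<delta> (snd z, fst z)" for z
  proof -
    have "Ed \<delta> lam (snd z - fst z) = Ed \<delta> lam (fst z - snd z)"
      unfolding Ed_def by (simp add: power2_norm_eq_inner[symmetric] norm_minus_commute)
    then show ?thesis unfolding te_def tc_def fst_conv snd_conv
      by (simp add: inner_diff_left inner_diff_right inner_commute algebra_simps)
  qed
  then have "(\<integral>z. te \<delta> z \<partial>MM) = (\<integral>z. tc \<delta> z \<partial>MM) + (\<integral>z. tc \<delta> (snd z, fst z) \<partial>MM)"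
    using si t_integrable(3)[OF assms] by simp
  then show ?thesis using s by simp
qed

text \<open>Multiply \<open>regularised_identity\<close> by \<open>F y\<close> and integrate over
  \<open>y\<close>. The part in which the kernel is differentiated is then rewritten by
  \<open>swap_tc\<close>, which leaves only terms with bounds uniform in \<delta>.\<close>

lemma regularised_nonlocal:
  assumes "0 < \<delta>"
  shows "(\<integral>z. ta \<delta> z \<partial>MM) + p * (\<integral>z. tb \<delta> z \<partial>MM) + (\<integral>z. te \<delta> z \<partial>MM) / 2 = 0"
proof -
  have i: "integrable MM (\<lambda>z. ta \<delta> z + p * tb \<delta> z + tc \<delta> z)"
    using t_integrable[OF assms] by auto
  have eq: "ta \<delta> (x, y) + p * tb \<delta> (x, y) + tc \<delta> (x, y) =
     ((cutD m x * Kd \<delta> lam (x - y)) * F x + (\<Sum>b\<in>Basis. (p * wt b x * Kd \<delta> lam (x - y)) * (s x * g b x))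
     + (\<Sum>b\<in>Basis. (wt b x * (Ed \<delta> lam (x - y) * ((x - y) \<bullet> b))) * F x)) * F y" for x y
  proof -
    have E1: "(\<Sum>b\<in>Basis. (p * wt b x * Kd \<delta> lam (x - y)) * (s x * g b x)) = p * Sg x * Kd \<delta> lam (x - y)"
      unfolding Sg_def sum_distrib_left sum_distrib_right by (intro sum.cong refl) simp
    have E2: "(\<Sum>b\<in>Basis. (wt b x * (Ed \<delta> lam (x - y) * ((x - y) \<bullet> b))) * F x)
        = Ed \<delta> lam (x - y) * (cutX m x \<bullet> (x - y)) * F x"
      unfolding cutX_def inner_scaleR_left euclidean_inner[of x "x - y"] sum_distrib_left sum_distrib_right
      by (intro sum.cong refl) simp
    show ?thesis unfolding ta_def tb_def tc_def fst_conv snd_conv E1 E2 by (simp only: distrib_right mult.assoc)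
  qed
  have "(\<integral>z. ta \<delta> z + p * tb \<delta> z + tc \<delta> z \<partial>MM)
      = (LBINT y. \<integral>x. ta \<delta> (x, y) + p * tb \<delta> (x, y) + tc \<delta> (x, y) \<partial>lborel)"
    using lborel_pair.integral_snd[of "\<lambda>x y. ta \<delta> (x, y) + p * tb \<delta> (x, y) + tc \<delta> (x, y)"] i
    by (simp add: case_prod_unfold)
  also have "\<dots> = 0"
    unfolding eq using regularised_identity[OF assms] by simp
  finally have "(\<integral>z. ta \<delta> z \<partial>MM) + p * (\<integral>z. tb \<delta> z \<partial>MM) + (\<integral>z. tc \<delta> z \<partial>MM) = 0"
    using t_integrable[OF assms] by simp
  then show ?thesis using swap_tc[OF assms] by simp
qed

text \<open>Let \<delta> tend to 0 with multiples of \<open>kernel f1\<close> as majorants. In the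
  factor \<open>lam / 2\<close>, \<open>lam\<close> comes from differentiating the power and the
  half from symmetrising.\<close>

lemma nonlocal_identity:
  "(\<integral>z. cutD m (fst z) * kernel F z \<partial>MM) + p * (LBINT x. (\<Sum>b\<in>Basis. V x * (s x * (wt b x * g b x))))
    - lam / 2 * (\<integral>z. cutL m z * kernel F z \<partial>MM) = 0"
proof -
  define d where "d k = 1 / (real k + 1)" for k
  have d: "0 < d k" for k by (simp add: d_def)
  note ne = AE_pair_lborel_neq[where 'a='a]
  have ki: "integrable MM (\<lambda>z. C * kernel f1 z)" for C
    by (intro integrable_mult_right kernel_f1_integrable)
  have [measurable]: "kernel F \<in> borel_measurable MM" using kernel_F_integrable by auto
  have la: "(\<lambda>k. \<integral>z. ta (d k) z \<partial>MM) \<longlonglongrightarrow> (\<integral>z. cutD m (fst z) * kernel F z \<partial>MM)"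
  proof (rule integral_dominated_convergence[OF _ _ ki])
    show "AE z in MM. norm (ta (d k) z) \<le> (DIM('a) * exp 1 + 4 * exp 1) * kernel f1 z" for k
      using t_bounds(1)[OF d] by simp
    show "AE z in MM. (\<lambda>k. ta (d k) z) \<longlonglongrightarrow> cutD m (fst z) * kernel F z"
      using ne
    proof eventually_elim
      case (elim z)
      have "(\<lambda>k. ta (d k) z) \<longlonglongrightarrow> cutD m (fst z) * norm (fst z - snd z) powr - lam * F (fst z) * F (snd z)"
        unfolding ta_def d_def using elim by (intro tendsto_mult tendsto_const Kd_Ed_tendsto) simp
      then show ?case by (simp add: kernel_def K_def mult_ac)
    qed
  qed measurable
  have lb': "(\<lambda>k. \<integral>z. tb (d k) z \<partial>MM) \<longlonglongrightarrow> (\<integral>z. Sg (fst z) * K (fst z - snd z) * F (snd z) \<partial>MM)"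
    and ib: "integrable MM (\<lambda>z. Sg (fst z) * K (fst z - snd z) * F (snd z))"
  proof -
    have l: "AE z in MM. (\<lambda>k. tb (d k) z) \<longlonglongrightarrow> Sg (fst z) * K (fst z - snd z) * F (snd z)"
      using ne
    proof eventually_elim
      case (elim z)
      show ?case unfolding tb_def d_def K_def using elim
        by (intro tendsto_mult tendsto_const Kd_Ed_tendsto) simp
    qed
    have b: "AE z in MM. norm (tb (d k) z) \<le> DIM('a) * (exp 1 * m) * kernel f1 z" for k
      using t_bounds(2)[OF d] by simp
    have m1: "(\<lambda>z. Sg (fst z) * K (fst z - snd z) * F (snd z)) \<in> borel_measurable MM" by measurable
    show "(\<lambda>k. \<integral>z. tb (d k) z \<partial>MM) \<longlonglongrightarrow> (\<integral>z. Sg (fst z) * K (fst z - snd z) * F (snd z) \<partial>MM)"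
      by (rule integral_dominated_convergence[OF m1 t_measurable(2) ki l b])
    show "integrable MM (\<lambda>z. Sg (fst z) * K (fst z - snd z) * F (snd z))"
      by (rule integrable_dominated_convergence[OF m1 t_measurable(2) ki l b])
  qed
  have "(\<integral>z. Sg (fst z) * K (fst z - snd z) * F (snd z) \<partial>MM) = (LBINT x. V x * Sg x)"
    by (rule V_Fubini[OF ib])
  also have "\<dots> = (LBINT x. (\<Sum>b\<in>Basis. V x * (s x * (wt b x * g b x))))"
    by (simp add: Sg_def sum_distrib_left mult_ac)
  finally have lb: "(\<lambda>k. \<integral>z. tb (d k) z \<partial>MM) \<longlonglongrightarrow> (LBINT x. (\<Sum>b\<in>Basis. V x * (s x * (wt b x * g b x))))"
    using lb' by simp
  have le: "(\<lambda>k. \<integral>z. te (d k) z \<partial>MM) \<longlonglongrightarrow> (\<integral>z. - lam * (cutL m z * kernel F z) \<partial>MM)"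
  proof (rule integral_dominated_convergence[OF _ _ ki])
    show "AE z in MM. norm (te (d k) z) \<le> lam * (5 * exp 1) * kernel f1 z" for k
      using t_bounds(4)[OF d] by simp
    show "AE z in MM. (\<lambda>k. te (d k) z) \<longlonglongrightarrow> - lam * (cutL m z * kernel F z)"
      using ne
    proof eventually_elim
      case (elim z)
      let ?D = "fst z - snd z"
      have "(\<lambda>k. te (d k) z) \<longlonglongrightarrow> (- lam * norm ?D powr - lam / (?D \<bullet> ?D))
          * (?D \<bullet> (cutX m (fst z) - cutX m (snd z))) * F (fst z) * F (snd z)"
        unfolding te_def d_def using elim by (intro tendsto_mult tendsto_const Kd_Ed_tendsto) simp
      then show ?case by (simp add: kernel_def K_def cutL_def mult_ac)
    qed
  qed measurable
  have "(\<lambda>k. (\<integral>z. ta (d k) z \<partial>MM) + p * (\<integral>z. tb (d k) z \<partial>MM) + (\<integral>z. te (d k) z \<partial>MM) / 2)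
     \<longlonglongrightarrow> (\<integral>z. cutD m (fst z) * kernel F z \<partial>MM) + p * (LBINT x. (\<Sum>b\<in>Basis. V x * (s x * (wt b x * g b x))))
    + (\<integral>z. - lam * (cutL m z * kernel F z) \<partial>MM) / 2"
    by (intro tendsto_add tendsto_mult tendsto_divide tendsto_const la lb le) simp
  then show ?thesis
    unfolding regularised_nonlocal[OF d] by (simp add: LIMSEQ_const_iff)
qed

end

subsection \<open>The global identities\<close>

lemma cut_tendsto:
  fixes x :: "'a::euclidean_space"
  shows "(\<lambda>n. cutP (real n + 1) x) \<longlonglongrightarrow> 1" "(\<lambda>n. cutQ (real n + 1) x) \<longlonglongrightarrow> 0"
    "(\<lambda>n. cutD (real n + 1) x) \<longlonglongrightarrow> DIM('a)"
proof -
  have i: "(\<lambda>n. 1 / (real n + 1)) \<longlonglongrightarrow> 0"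
    using LIMSEQ_inverse_real_of_nat by (simp add: inverse_eq_divide add.commute)
  then have i2: "(\<lambda>n. (1 / (real n + 1))\<^sup>2) \<longlonglongrightarrow> 0" using tendsto_power[OF i, of 2] by simp
  have t: "(\<lambda>n. 1 - (1 / (real n + 1))\<^sup>2 * (x \<bullet> x)) \<longlonglongrightarrow> 1"
    using tendsto_diff[OF tendsto_const tendsto_mult_left_zero[OF i2]] by simp
  have b: "(\<lambda>n. bump j ((1 / (real n + 1))\<^sup>2) x) \<longlonglongrightarrow> exp (- 1)" for j
  proof -
    have "isCont (flat j) 1" by (rule DERIV_isCont[OF flat_deriv])
    from isCont_tendsto_compose[OF this t] show ?thesis by (simp add: bump_def flat_def)
  qed
  show P: "(\<lambda>n. cutP (real n + 1) x) \<longlonglongrightarrow> 1"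
    using tendsto_mult_left[OF b, of "exp 1" 0] by (simp add: cutP_def exp_minus)
  have "(\<lambda>n. 2 * (1 / (real n + 1))\<^sup>2 * exp 1 * bump 2 ((1 / (real n + 1))\<^sup>2) x) \<longlonglongrightarrow> 2 * 0 * exp 1 * exp (- 1)"
    by (intro tendsto_mult tendsto_const i2 b)
  then show Q: "(\<lambda>n. cutQ (real n + 1) x) \<longlonglongrightarrow> 0" by (simp add: cutQ_def)
  have "(\<lambda>n. DIM('a) * cutP (real n + 1) x - cutQ (real n + 1) x * (x \<bullet> x)) \<longlonglongrightarrow> real DIM('a) * 1 - 0 * (x \<bullet> x)"
    by (intro tendsto_intros P Q)
  then show "(\<lambda>n. cutD (real n + 1) x) \<longlonglongrightarrow> DIM('a)" by (simp add: cutD_def)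
qed

lemma cutL_tendsto:
  assumes "fst z \<noteq> snd z"
  shows "(\<lambda>n. cutL (real n + 1) z) \<longlonglongrightarrow> 1"
proof -
  let ?D = "fst z - snd z"
  have "(\<lambda>n. ?D \<bullet> (cutX (real n + 1) (fst z) - cutX (real n + 1) (snd z)) / (?D \<bullet> ?D))
      \<longlonglongrightarrow> ?D \<bullet> (1 *\<^sub>R fst z - 1 *\<^sub>R snd z) / (?D \<bullet> ?D)"
    unfolding cutX_def using assms by (intro tendsto_intros cut_tendsto) simp
  then show ?thesis using assms by (simp add: cutL_def)
qed

lemma cutQ_le: "cutQ (real n + 1) x \<le> 4 * exp 1"
proof -
  have "(1 / (real n + 1))\<^sup>2 \<le> 1" by (simp add: power_le_one)
  moreover have "bump 2 ((1 / (real n + 1))\<^sup>2) x \<le> 2"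
    using flat_le[of 2 "1 - (1 / (real n + 1))\<^sup>2 * (x \<bullet> x)" 0] by (simp add: bump_def numeral_2_eq_2)
  ultimately have "(1 / (real n + 1))\<^sup>2 * bump 2 ((1 / (real n + 1))\<^sup>2) x \<le> 1 * 2"
    by (intro mult_mono) (auto simp: bump_nonneg)
  then have "2 * exp 1 * ((1 / (real n + 1))\<^sup>2 * bump 2 ((1 / (real n + 1))\<^sup>2) x) \<le> 2 * exp 1 * (1 * 2)"
    by (intro mult_left_mono) auto
  then show ?thesis by (simp add: cutQ_def mult_ac)
qed

text \<open>For the second bound \<open>\<bar>x \<bullet> j\<bar> \<le> 1 + x \<bullet> x\<close>
  splits the product into \<open>cutQ\<close> and \<open>cutQ\<close> times
  \<open>x \<bullet> x\<close>, each at most \<open>4 * exp 1\<close> for radii from 1 on.\<close>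

lemma cutQ_inner_le:
  fixes x :: "'a::euclidean_space"
  assumes "j \<in> Basis" "b \<in> Basis"
  shows "\<bar>cutQ m x * (x \<bullet> j) * (x \<bullet> b)\<bar> \<le> 4 * exp 1" "\<bar>cutQ (real n + 1) x * (x \<bullet> j)\<bar> \<le> 8 * exp 1"
proof -
  have n: "\<bar>x \<bullet> b\<bar> \<le> norm x" if "b \<in> Basis" for b using that by (rule Basis_le_norm)
  have "\<bar>x \<bullet> j\<bar> * \<bar>x \<bullet> b\<bar> \<le> norm x * norm x" using n assms by (intro mult_mono) auto
  then have "\<bar>x \<bullet> j\<bar> * \<bar>x \<bullet> b\<bar> \<le> x \<bullet> x" by (simp add: power2_norm_eq_inner[symmetric] power2_eq_square)
  then have "cutQ m x * (\<bar>x \<bullet> j\<bar> * \<bar>x \<bullet> b\<bar>) \<le> cutQ m x * (x \<bullet> x)"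
    using cutQ_bounds(1)[of m x] by (rule mult_left_mono)
  then show "\<bar>cutQ m x * (x \<bullet> j) * (x \<bullet> b)\<bar> \<le> 4 * exp 1"
    using cutQ_bounds[of m x] by (simp add: abs_mult mult.assoc)
  have "\<bar>x \<bullet> j\<bar> \<le> 1 + x \<bullet> x"
    using n[OF assms(1)] le_1_powr[of "norm x" 2] by (simp add: power2_norm_eq_inner powr_numeral)
  then have "cutQ (real n + 1) x * \<bar>x \<bullet> j\<bar> \<le> cutQ (real n + 1) x * (1 + x \<bullet> x)"
    using cutQ_bounds(1) by (rule mult_left_mono)
  also have "\<dots> \<le> 8 * exp 1"
    using cutQ_le[of n x] cutQ_bounds(2)[of "real n + 1" x] by (simp add: distrib_left)
  finally show "\<bar>cutQ (real n + 1) x * (x \<bullet> j)\<bar> \<le> 8 * exp 1"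
    using cutQ_bounds(1)[of "real n + 1" x] by (simp add: abs_mult)
qed

lemma weighted_integral_tendsto:
  fixes f :: "'b \<Rightarrow> real"
  assumes f: "integrable M f" and w [measurable]: "\<And>n. w n \<in> borel_measurable M"
    and C: "\<And>n x. \<bar>w n x\<bar> \<le> C" and l: "AE x in M. (\<lambda>n. w n x) \<longlonglongrightarrow> L"
  shows "(\<lambda>n. \<integral>x. w n x * f x \<partial>M) \<longlonglongrightarrow> L * (\<integral>x. f x \<partial>M)"
    and "\<And>n. integrable M (\<lambda>x. w n x * f x)"
proof -
  have [measurable]: "f \<in> borel_measurable M" using f by auto
  have C0: "0 \<le> C" using C[of 0 undefined] by (smt (verit) abs_ge_zero)
  have b: "\<bar>w n x * f x\<bar> \<le> C * \<bar>f x\<bar>" for n x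
    unfolding abs_mult using C by (intro mult_right_mono) auto
  have i: "integrable M (\<lambda>x. C * \<bar>f x\<bar>)" using f by auto
  have "(\<lambda>n. \<integral>x. w n x * f x \<partial>M) \<longlonglongrightarrow> (\<integral>x. L * f x \<partial>M)"
  proof (rule integral_dominated_convergence[OF _ _ i])
    show "AE x in M. (\<lambda>n. w n x * f x) \<longlonglongrightarrow> L * f x"
      using l by eventually_elim (rule tendsto_mult_right)
    show "AE x in M. norm (w n x * f x) \<le> C * \<bar>f x\<bar>" for n using b by simp
  qed measurable
  then show "(\<lambda>n. \<integral>x. w n x * f x \<partial>M) \<longlonglongrightarrow> L * (\<integral>x. f x \<partial>M)" by simp
  show "integrable M (\<lambda>x. w n x * f x)" for n
    by (rule Bochner_Integration.integrable_bound[OF i]) (use b C0 in \<open>auto intro!: AE_I2 simp: abs_mult\<close>)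
qed

context choquard_data
begin

abbreviation "PM \<equiv> (lborel \<Otimes>\<^sub>M lborel :: ('a \<times> 'a) measure)"

lemma approximation_exists:
  assumes "0 < m" shows "\<exists>U H. approximated_choquard u g h r \<alpha> p c m U H"
proof (rule smooth_approximation[of m], goal_cases)
  case (1 U H)
  have "approximated_choquard u g h r \<alpha> p c m U H"
    by (unfold_locales; (rule assms | (rule 1; assumption)))
  then show ?case by blast
qed

text \<open>The approximating sequence belongs to one \<open>m\<close> and is discarded here. What
  remains mentions only \<open>u\<close>, \<open>g\<close> and the cut-offs, so \<open>m\<close> is
  free to grow.\<close>

lemma localized_identities:
  assumes m: "0 < m"
  shows "(LBINT x. (\<Sum>j\<in>Basis. \<Sum>b\<in>Basis. (cutP m x * (j \<bullet> b) - cutQ m x * (x \<bullet> j) * (x \<bullet> b)) * (g j x * g b x)))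
     - (LBINT x. cutD m x * ((u x * u x + (\<Sum>j\<in>Basis. g j x * g j x)) / 2))
   = c * ((lam / 2 * (\<integral>z. cutL m z * kernel F z \<partial>PM) - (\<integral>z. cutD m (fst z) * kernel F z \<partial>PM)) / p)" (is ?A)
  and "(LBINT x. (\<Sum>j\<in>Basis. cutP m x * (g j x * g j x)) + (\<Sum>j\<in>Basis. (- cutQ m x * (x \<bullet> j)) * (g j x * u x))
      + cutP m x * (u x * u x)) = c * (LBINT x. V x * (cutP m x * F x))" (is ?B)
  and "(LBINT x. cutD m x * (u x * u x) + (\<Sum>b\<in>Basis. 2 * (cutP m x * (x \<bullet> b)) * (u x * g b x))) = 0" (is ?C)
proof -
  obtain U H where "approximated_choquard u g h r \<alpha> p c m U H"
    using approximation_exists[OF m] by blast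
  then interpret A: approximated_choquard u g h r \<alpha> p c m U H .
  show ?B by (rule A.energy_test)
  show ?C by (rule A.radial_identity_u(1))
  have "(LBINT x. (\<Sum>b\<in>Basis. V x * (s x * (cutP m x * (x \<bullet> b) * g b x))))
      = (lam / 2 * (\<integral>z. cutL m z * kernel F z \<partial>PM) - (\<integral>z. cutD m (fst z) * kernel F z \<partial>PM)) / p"
    using A.nonlocal_identity p by (simp add: field_simps)
  then show ?A using A.pohozaev_test by simp
qed

definition "dirichlet = (LBINT x. (\<Sum>j\<in>Basis. g j x * g j x))"
definition "mass = (LBINT x. u x * u x)"
text \<open>Taken without the constant: the quantity D of the overview is
  \<open>c * riesz_energy\<close>.\<close>

definition "riesz_energy = (\<integral>z. kernel F z \<partial>PM)"

section \<open>Integrability on the whole space and removal of the cut-off\<close>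

lemma uu_integrable: "integrable lborel (\<lambda>x. u x * u x)"
  using u2 by (simp add: power2_eq_square)

lemma product_integrable:
  assumes "(f::'a \<Rightarrow> real) \<in> borel_measurable borel" "k \<in> borel_measurable borel"
    "integrable lborel (\<lambda>x. (f x)\<^sup>2)" "integrable lborel (\<lambda>x. (k x)\<^sup>2)"
  shows "integrable lborel (\<lambda>x. f x * k x)"
proof (rule Bochner_Integration.integrable_bound[OF Bochner_Integration.integrable_add[OF assms(3,4)]])
  have "\<bar>f x * k x\<bar> \<le> (f x)\<^sup>2 + (k x)\<^sup>2" for x
    by (rule abs_mult_le_if_squares_le) auto
  then show "AE x in lborel. norm (f x * k x) \<le> norm ((f x)\<^sup>2 + (k x)\<^sup>2)" by simp
qed (use assms in auto)

lemma gg_integrable: "j \<in> Basis \<Longrightarrow> b \<in> Basis \<Longrightarrow> integrable lborel (\<lambda>x. g j x * g b x)"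
  by (intro product_integrable gm g2)

lemma gu_integrable: "j \<in> Basis \<Longrightarrow> integrable lborel (\<lambda>x. g j x * u x)"
  by (intro product_integrable gm g2 um u2)

lemma sum_gg_integrable: "integrable lborel (\<lambda>x. \<Sum>j\<in>Basis. g j x * g j x)"
  by (intro Bochner_Integration.integrable_sum gg_integrable)

lemma dirichlet_eq: "dirichlet = (\<Sum>j\<in>Basis. LBINT x. g j x * g j x)"
  unfolding dirichlet_def by (intro Bochner_Integration.integral_sum gg_integrable)

lemma riesz_energy_eq: "riesz_energy = (LBINT x. V x * F x)"
  using V_Fubini[of F] kernel_F_integrable by (simp add: riesz_energy_def kernel_def[abs_def])

lemma cut_lim_integrals:
  fixes f :: "'a \<Rightarrow> real"
  assumes "integrable lborel f"
  shows "(\<lambda>n. LBINT x. cutP (real n + 1) x * f x) \<longlonglongrightarrow> (LBINT x. f x)"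
    "(\<lambda>n. LBINT x. cutD (real n + 1) x * f x) \<longlonglongrightarrow> DIM('a) * (LBINT x. f x)"
    "integrable lborel (\<lambda>x. cutP (real n + 1) x * f x)" "integrable lborel (\<lambda>x. cutD (real n + 1) x * f x)"
proof -
  have P: "\<bar>cutP m x\<bar> \<le> exp 1" for m and x :: 'a using cutP_bounds[of m x] by simp
  have AP: "AE x::'a in lborel. (\<lambda>n. cutP (real n + 1) x) \<longlonglongrightarrow> 1"
    and AD: "AE x::'a in lborel. (\<lambda>n. cutD (real n + 1) x) \<longlonglongrightarrow> real DIM('a)"
    by (intro AE_I2 cut_tendsto)+
  have mP: "cutP (real n + 1) \<in> borel_measurable (lborel :: 'a measure)"
    and mD: "cutD (real n + 1) \<in> borel_measurable (lborel :: 'a measure)" for n by simp_all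
  note wP = weighted_integral_tendsto[where w="\<lambda>n. cutP (real n + 1)", OF assms mP P AP]
  note wD = weighted_integral_tendsto[where w="\<lambda>n. cutD (real n + 1)", OF assms mD cutD_bound AD]
  show "(\<lambda>n. LBINT x. cutP (real n + 1) x * f x) \<longlonglongrightarrow> (LBINT x. f x)"
    using wP(1) by simp
  show "(\<lambda>n. LBINT x. cutD (real n + 1) x * f x) \<longlonglongrightarrow> DIM('a) * (LBINT x. f x)"
    by (rule wD(1))
  show "integrable lborel (\<lambda>x. cutP (real n + 1) x * f x)" "integrable lborel (\<lambda>x. cutD (real n + 1) x * f x)"
    by (rule wP(2), rule wD(2))
qed

text \<open>The terms with \<open>cutQ\<close> vanish in the limit: their weights are bounded by
  \<open>8 * exp 1\<close> and tend to 0 pointwise, while \<open>g j x * u x\<close> is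
  integrable.\<close>

lemma energy_identity: "dirichlet + mass = c * riesz_energy"
proof (rule LIMSEQ_unique)
  let ?m = "\<lambda>n. real n + 1"
  let ?w = "\<lambda>j n (x::'a). - cutQ (?m n) x * (x \<bullet> j)"
  have w: "(\<lambda>n. LBINT x. ?w j n x * (g j x * u x)) \<longlonglongrightarrow> 0 * (LBINT x. g j x * u x)"
    "integrable lborel (\<lambda>x. ?w j n x * (g j x * u x))" if j: "j \<in> Basis" for j n
  proof -
    have 1: "?w j n \<in> borel_measurable lborel" for n by simp
    have 2: "\<bar>?w j n x\<bar> \<le> 8 * exp 1" for n x using cutQ_inner_le(2)[OF j j, of n x] by simp
    have "(\<lambda>n. ?w j n x) \<longlonglongrightarrow> 0" for x
      using tendsto_mult[OF tendsto_minus[OF cut_tendsto(2)] tendsto_const, of x "x \<bullet> j"] by simp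
    then have 3: "AE x in lborel. (\<lambda>n. ?w j n x) \<longlonglongrightarrow> 0" by simp
    show "(\<lambda>n. LBINT x. ?w j n x * (g j x * u x)) \<longlonglongrightarrow> 0 * (LBINT x. g j x * u x)"
      "integrable lborel (\<lambda>x. ?w j n x * (g j x * u x))"
      using weighted_integral_tendsto[OF gu_integrable[OF j] 1 2 3] by blast+
  qed
  have "(\<lambda>n. (\<Sum>j\<in>Basis. LBINT x. cutP (?m n) x * (g j x * g j x))
      + (\<Sum>j\<in>Basis. LBINT x. ?w j n x * (g j x * u x)) + (LBINT x. cutP (?m n) x * (u x * u x)))
      \<longlonglongrightarrow> (\<Sum>j\<in>Basis. LBINT x. g j x * g j x) + (\<Sum>j\<in>Basis. 0 * (LBINT x. g j x * u x)) + (LBINT x. u x * u x)"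
    by (intro tendsto_add tendsto_sum cut_lim_integrals w gg_integrable uu_integrable)
  moreover have "(\<Sum>j\<in>Basis. LBINT x. cutP (?m n) x * (g j x * g j x))
      + (\<Sum>j\<in>Basis. LBINT x. ?w j n x * (g j x * u x)) + (LBINT x. cutP (?m n) x * (u x * u x))
      = (LBINT x. (\<Sum>j\<in>Basis. cutP (?m n) x * (g j x * g j x)) + (\<Sum>j\<in>Basis. ?w j n x * (g j x * u x))
      + cutP (?m n) x * (u x * u x))" for n
  proof -
    have i: "integrable lborel (\<lambda>x. \<Sum>j\<in>Basis. cutP (?m n) x * (g j x * g j x))"
      by (intro Bochner_Integration.integrable_sum cut_lim_integrals gg_integrable)
    have i': "integrable lborel (\<lambda>x. \<Sum>j\<in>Basis. ?w j n x * (g j x * u x))"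
      by (intro Bochner_Integration.integrable_sum w)
    have i'': "integrable lborel (\<lambda>x. cutP (?m n) x * (u x * u x))"
      by (intro cut_lim_integrals uu_integrable)
    have "(\<Sum>j\<in>Basis. LBINT x. cutP (?m n) x * (g j x * g j x)) = (LBINT x. (\<Sum>j\<in>Basis. cutP (?m n) x * (g j x * g j x)))"
      by (intro Bochner_Integration.integral_sum[symmetric] cut_lim_integrals gg_integrable)
    moreover have "(\<Sum>j\<in>Basis. LBINT x. ?w j n x * (g j x * u x)) = (LBINT x. (\<Sum>j\<in>Basis. ?w j n x * (g j x * u x)))"
      by (intro Bochner_Integration.integral_sum[symmetric] w)
    ultimately show ?thesis
      by (simp only: Bochner_Integration.integral_add[OF Bochner_Integration.integrable_add[OF i i'] i'']
          Bochner_Integration.integral_add[OF i i'])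
  qed
  moreover have "\<dots> n = c * (LBINT x. V x * (cutP (?m n) x * F x))" for n
    by (rule localized_identities(2)) simp
  ultimately show "(\<lambda>n. c * (LBINT x. V x * (cutP (?m n) x * F x))) \<longlonglongrightarrow> dirichlet + mass"
    by (simp add: dirichlet_eq mass_def)
  have "integrable lborel (\<lambda>x. V x * F x)"
    using V_integrable[of "\<lambda>x. 0"] kernel_F_integrable by simp
  from cut_lim_integrals(1)[OF this]
  show "(\<lambda>n. c * (LBINT x. V x * (cutP (?m n) x * F x))) \<longlonglongrightarrow> c * riesz_energy"
    unfolding riesz_energy_eq by (intro tendsto_mult_left) (simp add: mult.left_commute)
qed

text \<open>As the radius grows, the derivative of X tends to the identity, its divergence to N and
  \<open>cutL\<close> to 1. The nonlocal side therefore has the coefficient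
  \<open>lam / 2 - N = - (N + \<alpha>) / 2\<close>, divided by the \<open>p\<close> from
  differentiating \<open>|u| powr p\<close>.\<close>

lemma pohozaev_identity: "dirichlet - DIM('a) * (mass + dirichlet) / 2 = - c * ((DIM('a) + \<alpha>) / (2 * p)) * riesz_energy"
proof (rule LIMSEQ_unique)
  let ?m = "\<lambda>n. real n + 1"
  let ?w = "\<lambda>j b n (x::'a). cutP (?m n) x * (j \<bullet> b) - cutQ (?m n) x * (x \<bullet> j) * (x \<bullet> b)"
  let ?E = "\<lambda>x. (u x * u x + (\<Sum>j\<in>Basis. g j x * g j x)) / 2"
  have w: "(\<lambda>n. LBINT x. ?w j b n x * (g j x * g b x)) \<longlonglongrightarrow> (j \<bullet> b) * (LBINT x. g j x * g b x)"
    "integrable lborel (\<lambda>x. ?w j b n x * (g j x * g b x))" if j: "j \<in> Basis" and b: "b \<in> Basis" for j b n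
  proof -
    have 1: "?w j b n \<in> borel_measurable lborel" for n by simp
    have 2: "\<bar>?w j b n x\<bar> \<le> 5 * exp 1" for n x
    proof -
      have "\<bar>cutP (?m n) x * (j \<bullet> b)\<bar> \<le> exp 1"
        using cutP_bounds[of "?m n" x] j b by (auto simp: inner_Basis)
      then show ?thesis using cutQ_inner_le(1)[OF j b, of "?m n" x] by linarith
    qed
    have "(\<lambda>n. ?w j b n x) \<longlonglongrightarrow> 1 * (j \<bullet> b) - 0 * (x \<bullet> j) * (x \<bullet> b)" for x
      by (intro tendsto_intros cut_tendsto)
    then have 3: "AE x in lborel. (\<lambda>n. ?w j b n x) \<longlonglongrightarrow> j \<bullet> b" by simp
    show "(\<lambda>n. LBINT x. ?w j b n x * (g j x * g b x)) \<longlonglongrightarrow> (j \<bullet> b) * (LBINT x. g j x * g b x)"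
      "integrable lborel (\<lambda>x. ?w j b n x * (g j x * g b x))"
      using weighted_integral_tendsto[OF gg_integrable[OF j b] 1 2 3] by blast+
  qed
  have Ei: "integrable lborel ?E" using uu_integrable sum_gg_integrable by auto
  have Eeq: "(LBINT x. ?E x) = (mass + dirichlet) / 2"
    using uu_integrable sum_gg_integrable by (simp add: mass_def dirichlet_def)
  have jj: "(\<Sum>j\<in>Basis. \<Sum>b\<in>Basis. (j \<bullet> b) * (LBINT x. g j x * g b x)) = dirichlet"
  proof -
    have "(\<Sum>b\<in>Basis. (j \<bullet> b) * (LBINT x. g j x * g b x)) = (LBINT x. g j x * g j x)" if "j \<in> Basis" for j
    proof -
      have "(\<Sum>b\<in>Basis. (j \<bullet> b) * (LBINT x. g j x * g b x))
          = (\<Sum>b\<in>Basis. if b = j then (LBINT x. g j x * g j x) else 0)"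
        using that by (intro sum.cong) (auto simp: inner_Basis)
      then show ?thesis using that by simp
    qed
    then show ?thesis by (simp add: dirichlet_eq)
  qed
  have "(\<lambda>n. (\<Sum>j\<in>Basis. \<Sum>b\<in>Basis. LBINT x. ?w j b n x * (g j x * g b x)) - (LBINT x. cutD (?m n) x * ?E x))
     \<longlonglongrightarrow> (\<Sum>j\<in>Basis. \<Sum>b\<in>Basis. (j \<bullet> b) * (LBINT x. g j x * g b x)) - DIM('a) * (LBINT x. ?E x)"
    by (intro tendsto_diff tendsto_sum w cut_lim_integrals Ei)
  moreover have "(\<Sum>j\<in>Basis. \<Sum>b\<in>Basis. LBINT x. ?w j b n x * (g j x * g b x))
      = (LBINT x. (\<Sum>j\<in>Basis. \<Sum>b\<in>Basis. ?w j b n x * (g j x * g b x)))" for n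
  proof -
    have "(LBINT x. (\<Sum>j\<in>Basis. \<Sum>b\<in>Basis. ?w j b n x * (g j x * g b x)))
        = (\<Sum>j\<in>Basis. LBINT x. (\<Sum>b\<in>Basis. ?w j b n x * (g j x * g b x)))"
      by (intro Bochner_Integration.integral_sum Bochner_Integration.integrable_sum w)
    also have "\<dots> = (\<Sum>j\<in>Basis. \<Sum>b\<in>Basis. LBINT x. ?w j b n x * (g j x * g b x))"
      by (intro sum.cong refl Bochner_Integration.integral_sum w)
    finally show ?thesis by simp
  qed
  moreover have "(LBINT x. (\<Sum>j\<in>Basis. \<Sum>b\<in>Basis. ?w j b n x * (g j x * g b x))) - (LBINT x. cutD (?m n) x * ?E x)
      = c * ((lam / 2 * (\<integral>z. cutL (?m n) z * kernel F z \<partial>PM) - (\<integral>z. cutD (?m n) (fst z) * kernel F z \<partial>PM)) / p)" for n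
    by (rule localized_identities(1)) simp
  ultimately show "(\<lambda>n. c * ((lam / 2 * (\<integral>z. cutL (?m n) z * kernel F z \<partial>PM) - (\<integral>z. cutD (?m n) (fst z) * kernel F z \<partial>PM)) / p))
    \<longlonglongrightarrow> dirichlet - DIM('a) * (mass + dirichlet) / 2"
    by (simp only: Eeq jj times_divide_eq_right)
  have L: "(\<lambda>n. \<integral>z. cutL (?m n) z * kernel F z \<partial>PM) \<longlonglongrightarrow> 1 * riesz_energy"
    unfolding riesz_energy_def
  proof (rule weighted_integral_tendsto(1)[OF kernel_F_integrable _ cutL_bound])
    show "AE z in PM. (\<lambda>n. cutL (?m n) z) \<longlonglongrightarrow> 1"
      using AE_pair_lborel_neq by eventually_elim (rule cutL_tendsto)
  qed measurable
  have D: "(\<lambda>n. \<integral>z. cutD (?m n) (fst z) * kernel F z \<partial>PM) \<longlonglongrightarrow> DIM('a) * riesz_energy"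
    unfolding riesz_energy_def
  proof (rule weighted_integral_tendsto(1)[OF kernel_F_integrable _ cutD_bound])
    show "AE z in PM. (\<lambda>n. cutD (?m n) (fst z)) \<longlonglongrightarrow> real DIM('a)"
      by (intro AE_I2 cut_tendsto)
  qed measurable
  have "(\<lambda>n. c * ((lam / 2 * (\<integral>z. cutL (?m n) z * kernel F z \<partial>PM) - (\<integral>z. cutD (?m n) (fst z) * kernel F z \<partial>PM)) / p))
    \<longlonglongrightarrow> c * ((lam / 2 * (1 * riesz_energy) - DIM('a) * riesz_energy) / p)"
    using p by (intro tendsto_intros L D) simp
  also have "c * ((lam / 2 * (1 * riesz_energy) - DIM('a) * riesz_energy) / p) = - c * ((DIM('a) + \<alpha>) / (2 * p)) * riesz_energy"
    using p by (simp add: lam_def field_simps)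
  finally show "(\<lambda>n. c * ((lam / 2 * (\<integral>z. cutL (?m n) z * kernel F z \<partial>PM) - (\<integral>z. cutD (?m n) (fst z) * kernel F z \<partial>PM)) / p))
    \<longlonglongrightarrow> - c * ((DIM('a) + \<alpha>) / (2 * p)) * riesz_energy" .
qed

text \<open>The factor \<open>x\<close> is unbounded, so the argument runs through the truncated
  identity: with vanishing gradient it says that \<open>cutD m x * (u x * u x)\<close> has integral
  0 for every radius, and \<open>cutD\<close> tends boundedly to N.\<close>

lemma mass_eq_0_if_gradient_0:
  assumes "dirichlet = 0" shows "mass = 0"
proof -
  have "AE x in lborel. (\<Sum>j\<in>Basis. g j x * g j x) = 0"
    using assms unfolding dirichlet_def
    by (subst (asm) integral_nonneg_eq_0_iff_AE[OF sum_gg_integrable]) (auto intro!: sum_nonneg)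
  then have g0: "AE x in lborel. \<forall>b\<in>Basis. g b x = 0"
    by eventually_elim (simp add: sum_nonneg_eq_0_iff)
  have "(LBINT x. cutD (real n + 1) x * (u x * u x)) = 0" for n
  proof -
    have "(LBINT x. cutD (real n + 1) x * (u x * u x))
      = (LBINT x. cutD (real n + 1) x * (u x * u x) + (\<Sum>b\<in>Basis. 2 * (cutP (real n + 1) x * (x \<bullet> b)) * (u x * g b x)))"
    proof (rule integral_cong_AE)
      show "AE x in lborel. cutD (real n + 1) x * (u x * u x)
         = cutD (real n + 1) x * (u x * u x) + (\<Sum>b\<in>Basis. 2 * (cutP (real n + 1) x * (x \<bullet> b)) * (u x * g b x))"
        using g0 by eventually_elim simp
      show "(\<lambda>x. cutD (real n + 1) x * (u x * u x) + (\<Sum>b\<in>Basis. 2 * (cutP (real n + 1) x * (x \<bullet> b)) * (u x * g b x))) \<in> borel_measurable lborel"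
        unfolding measurable_lborel1
        by (intro borel_measurable_add borel_measurable_sum borel_measurable_times cut_measurable um gm) simp_all
    qed simp
    then show ?thesis using localized_identities(3)[of "real n + 1"] by simp
  qed
  then have "DIM('a) * (LBINT x. u x * u x) = 0"
    using cut_lim_integrals(2)[OF uu_integrable] by (simp add: LIMSEQ_const_iff)
  then show ?thesis by (simp add: mass_def)
qed

text \<open>In terms of \<kappa> the two conditions read \<open>\<kappa> \<le> N - 2\<close> and
  \<open>N \<le> \<kappa>\<close>. The coefficients of \<open>dirichlet\<close> and
  \<open>mass\<close> in \<open>eq\<close> differ by 2, so when they have the same weak sign one of
  them has modulus at least 2.\<close>

theorem u_eq_0:
  assumes "1 / p \<le> (real DIM('a) - 2) / (real DIM('a) + \<alpha>) \<or> 1 / p \<ge> real DIM('a) / (real DIM('a) + \<alpha>)"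
  shows "AE x in lborel. u x = 0"
proof -
  let ?N = "real DIM('a)"
  define \<kappa> where "\<kappa> = (?N + \<alpha>) / p"
  have nn: "0 \<le> dirichlet" "0 \<le> mass"
    unfolding dirichlet_def mass_def by (auto intro!: integral_nonneg_AE sum_nonneg)
  have "dirichlet - ?N * (mass + dirichlet) / 2 = - (\<kappa> / 2) * (dirichlet + mass)"
    unfolding energy_identity pohozaev_identity \<kappa>_def by (simp add: mult_ac)
  then have eq: "(\<kappa> - (?N - 2)) * dirichlet + (\<kappa> - ?N) * mass = 0"
    by (simp add: field_simps)
  have "mass = 0"
    using assms
  proof
    assume "1 / p \<le> (?N - 2) / (?N + \<alpha>)"
    then have "\<kappa> \<le> ?N - 2" using p \<alpha> by (simp add: \<kappa>_def field_simps)
    then have "(\<kappa> - (?N - 2)) * dirichlet \<le> 0" "(\<kappa> - ?N) * mass \<le> - 2 * mass"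
      using nn by (intro mult_nonpos_nonneg mult_right_mono; simp)+
    then show ?thesis using eq nn by linarith
  next
    assume "1 / p \<ge> ?N / (?N + \<alpha>)"
    then have "?N \<le> \<kappa>" using p \<alpha> by (simp add: \<kappa>_def field_simps)
    then have "2 * dirichlet \<le> (\<kappa> - (?N - 2)) * dirichlet" "0 \<le> (\<kappa> - ?N) * mass"
      using nn by (intro mult_right_mono mult_nonneg_nonneg; simp)+
    then have "dirichlet = 0" using eq nn by linarith
    then show ?thesis by (rule mass_eq_0_if_gradient_0)
  qed
  then have "AE x in lborel. u x * u x = 0"
    unfolding mass_def by (subst (asm) integral_nonneg_eq_0_iff_AE[OF uu_integrable]) auto
  then show ?thesis by eventually_elim simp
qed

end

subsection \<open>Passing to Borel representatives\<close>

text \<open>The integrals agree even when they diverge, since both then have the default value 0.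
  Weak formulations can thus be transferred without proving integrability.\<close>

lemma lebesgue_representative:
  fixes f f' :: "'a::euclidean_space \<Rightarrow> real"
  assumes f: "f \<in> borel_measurable lebesgue" and f': "f' \<in> borel_measurable borel" and ae: "AE x in lborel. f x = f' x"
  shows "integral\<^sup>L lebesgue f = integral\<^sup>L lborel f'" and "integrable lebesgue f \<longleftrightarrow> integrable lborel f'"
proof -
  have ae': "AE x in lebesgue. f x = f' x" using ae by (rule AE_completion)
  have f'l: "f' \<in> borel_measurable lebesgue" "f' \<in> borel_measurable lborel"
    using f' by (auto intro: measurable_completion)
  have "integral\<^sup>L lebesgue f = integral\<^sup>L lebesgue f'"
    by (rule integral_cong_AE[OF f f'l(1) ae'])
  also have "\<dots> = integral\<^sup>L lborel f'" by (rule integral_completion[OF f'l(2)])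
  finally show "integral\<^sup>L lebesgue f = integral\<^sup>L lborel f'" .
  have "integrable lebesgue f \<longleftrightarrow> integrable lebesgue f'"
    by (rule integrable_cong_AE[OF f f'l(1) ae'])
  also have "\<dots> \<longleftrightarrow> integrable lborel f'" by (rule integrable_completion[OF f'l(2)])
  finally show "integrable lebesgue f \<longleftrightarrow> integrable lborel f'" .
qed

lemma borel_measurable_lebesgueI: "f \<in> borel_measurable borel \<Longrightarrow> f \<in> borel_measurable (lebesgue :: 'a::euclidean_space measure)"
  by (rule measurable_completion) simp

lemma test_function_smooth: "\<phi> \<in> test_functions \<Longrightarrow> smooth \<phi>"
  by (simp add: test_functions_def)

lemma has_weak_gradient_weak_grad: "weakly_differentiable u \<Longrightarrow> has_weak_gradient u (weak_grad u)"
  unfolding weakly_differentiable_def weak_grad_def by (rule someI_ex[of "has_weak_gradient u"])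

lemma Lp_loc_component:
  fixes f :: "'a::euclidean_space \<Rightarrow> 'b::euclidean_space"
  assumes "f \<in> Lp_loc q" "0 \<le> q" "b \<in> Basis" and f': "f' \<in> borel_measurable borel" "AE x in lborel. f x \<bullet> b = f' x"
  shows "integrable lborel (\<lambda>x. indicator (cball 0 R) x * \<bar>f' x\<bar> powr q)"
proof -
  have fm: "f \<in> borel_measurable lebesgue" and fi: "set_integrable lebesgue (cball 0 R) (\<lambda>x. norm (f x) powr q)"
    using assms(1) by (auto simp: Lp_loc_def)
  have cm: "(indicator (cball 0 R) :: 'a \<Rightarrow> real) \<in> borel_measurable borel" by (rule indicator_cball_measurable)
  have fbm: "(\<lambda>x. \<bar>f x \<bullet> b\<bar> powr q) \<in> borel_measurable lebesgue" using fm by measurable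
  have m1: "(\<lambda>x. indicator (cball 0 R) x * \<bar>f x \<bullet> b\<bar> powr q) \<in> borel_measurable lebesgue"
    by (intro borel_measurable_times fbm borel_measurable_lebesgueI[OF cm])
  have m2: "(\<lambda>x. indicator (cball 0 R) x * \<bar>f' x\<bar> powr q) \<in> borel_measurable borel"
  proof (intro borel_measurable_times cm)
    show "(\<lambda>x. \<bar>f' x\<bar> powr q) \<in> borel_measurable borel" using f'(1) by measurable
  qed
  have "integrable lebesgue (\<lambda>x. indicator (cball 0 R) x * \<bar>f x \<bullet> b\<bar> powr q)"
  proof (rule Bochner_Integration.integrable_bound[OF fi[unfolded set_integrable_def] m1])
    show "AE x in lebesgue. norm (indicator (cball 0 R) x * \<bar>f x \<bullet> b\<bar> powr q)
        \<le> norm (indicator (cball 0 R) x *\<^sub>R norm (f x) powr q)"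
      using assms(2,3) Basis_le_norm by (intro AE_I2) (auto simp: indicator_def intro!: powr_mono2)
  qed
  moreover have "AE x in lborel. indicator (cball 0 R) x * \<bar>f x \<bullet> b\<bar> powr q = indicator (cball 0 R) x * \<bar>f' x\<bar> powr q"
    using f'(2) by eventually_elim simp
  ultimately show ?thesis using lebesgue_representative(2)[OF m1 m2] by simp
qed

lemma Lp_component:
  fixes f :: "'a::euclidean_space \<Rightarrow> 'b::euclidean_space"
  assumes "f \<in> Lp q" "0 \<le> q" "b \<in> Basis" and f': "f' \<in> borel_measurable borel" "AE x in lborel. f x \<bullet> b = f' x"
  shows "integrable lborel (\<lambda>x. \<bar>f' x\<bar> powr q)"
proof -
  have fm: "f \<in> borel_measurable lebesgue" and fi: "integrable lebesgue (\<lambda>x. norm (f x) powr q)"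
    using assms(1) by (auto simp: Lp_def)
  have m1: "(\<lambda>x. \<bar>f x \<bullet> b\<bar> powr q) \<in> borel_measurable lebesgue" using fm by measurable
  have m2: "(\<lambda>x. \<bar>f' x\<bar> powr q) \<in> borel_measurable borel" using f'(1) by measurable
  have "integrable lebesgue (\<lambda>x. \<bar>f x \<bullet> b\<bar> powr q)"
  proof (rule Bochner_Integration.integrable_bound[OF fi m1])
    show "AE x in lebesgue. norm (\<bar>f x \<bullet> b\<bar> powr q) \<le> norm (norm (f x) powr q)"
      using assms(2,3) Basis_le_norm by (intro AE_I2) (auto intro!: powr_mono2)
  qed
  moreover have "AE x in lborel. \<bar>f x \<bullet> b\<bar> powr q = \<bar>f' x\<bar> powr q"
    using f'(2) by eventually_elim simp
  ultimately show ?thesis using lebesgue_representative(2)[OF m1 m2] by simp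
qed

lemma weak_gradient_representative:
  assumes w: "has_weak_gradient u G" and b: "b \<in> Basis" and \<phi>: "\<phi> \<in> test_functions"
    and u': "u' \<in> borel_measurable borel" "AE x in lborel. u x = u' x"
    and g': "g' \<in> borel_measurable borel" "AE x in lborel. G x \<bullet> b = g' x"
  shows "(LBINT x. u' x * pd b \<phi> x) = - (LBINT x. g' x * \<phi> x)"
proof -
  note s = test_function_smooth[OF \<phi>]
  have um: "u \<in> borel_measurable lebesgue" and Gm: "G \<in> borel_measurable lebesgue"
    using w by (auto simp: has_weak_gradient_def Lp_loc_def)
  have pm: "pd b \<phi> \<in> borel_measurable borel" "\<phi> \<in> borel_measurable borel"
    using smooth_measurable[OF s] smooth_measurable[OF smooth_pd[OF s b]] by auto
  have "(\<integral>x. u x * (grad \<phi> x \<bullet> b) \<partial>lebesgue) = (LBINT x. u' x * pd b \<phi> x)"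
  proof (rule lebesgue_representative(1))
    show "(\<lambda>x. u x * (grad \<phi> x \<bullet> b)) \<in> borel_measurable lebesgue"
      unfolding grad_inner[OF b] by (intro borel_measurable_times um borel_measurable_lebesgueI[OF pm(1)])
    show "AE x in lborel. u x * (grad \<phi> x \<bullet> b) = u' x * pd b \<phi> x"
      using u'(2) by eventually_elim (simp add: grad_inner[OF b])
  qed (intro borel_measurable_times u' pm)
  moreover have "(\<integral>x. (G x \<bullet> b) * \<phi> x \<partial>lebesgue) = (LBINT x. g' x * \<phi> x)"
  proof (rule lebesgue_representative(1))
    have "(\<lambda>x. G x \<bullet> b) \<in> borel_measurable lebesgue" using Gm by measurable
    then show "(\<lambda>x. G x \<bullet> b * \<phi> x) \<in> borel_measurable lebesgue"
      by (intro borel_measurable_times borel_measurable_lebesgueI[OF pm(2)])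
    show "AE x in lborel. G x \<bullet> b * \<phi> x = g' x * \<phi> x" using g'(2) by eventually_elim simp
  qed (intro borel_measurable_times g' pm)
  ultimately show ?thesis using w \<phi> b by (simp add: has_weak_gradient_def)
qed

text \<open>The equality holds at every \<open>x\<close>, as altering \<open>u\<close> on a null set
  changes no inner integral.\<close>

lemma convolution_riesz_eq:
  fixes u u' :: "'a::euclidean_space \<Rightarrow> real"
  assumes u: "u \<in> borel_measurable lebesgue" and u': "u' \<in> borel_measurable borel" "AE x in lborel. u x = u' x"
  shows "convolution (riesz_potential \<alpha>) (\<lambda>y. \<bar>u y\<bar> powr p) x =
    Gamma ((real DIM('a) - \<alpha>) / 2) / (Gamma (\<alpha> / 2) * pi powr (real DIM('a) / 2) * 2 powr \<alpha>)
     * (LBINT y. norm (x - y) powr - (real DIM('a) - \<alpha>) * \<bar>u' y\<bar> powr p)" (is "_ = ?C * _")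
proof -
  \<comment> \<open>At the origin both sides are 0, the left by division by zero and the right
    because \<open>0 powr\<close> of anything is 0.\<close>
  have R: "riesz_potential \<alpha> z = ?C * norm z powr - (real DIM('a) - \<alpha>)" for z :: 'a
    unfolding riesz_potential_def powr_minus[of "norm z"]
    by (simp only: divide_inverse inverse_mult_distrib mult.assoc)
  have k: "(\<lambda>y. ?C * norm (x - y) powr - (real DIM('a) - \<alpha>)) \<in> borel_measurable (borel :: 'a measure)" by measurable
  have "convolution (riesz_potential \<alpha>) (\<lambda>y. \<bar>u y\<bar> powr p) x
      = (LBINT y. ?C * norm (x - y) powr - (real DIM('a) - \<alpha>) * \<bar>u' y\<bar> powr p)"
    unfolding convolution_def R
  proof (rule lebesgue_representative(1))
    have "(\<lambda>y. \<bar>u y\<bar> powr p) \<in> borel_measurable lebesgue" using u by measurable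
    then show "(\<lambda>y. ?C * norm (x - y) powr - (real DIM('a) - \<alpha>) * \<bar>u y\<bar> powr p) \<in> borel_measurable lebesgue"
      by (intro borel_measurable_times[OF borel_measurable_lebesgueI[OF k]])
    have "(\<lambda>y. \<bar>u' y\<bar> powr p) \<in> borel_measurable borel" using u'(1) by measurable
    then show "(\<lambda>y. ?C * norm (x - y) powr - (real DIM('a) - \<alpha>) * \<bar>u' y\<bar> powr p) \<in> borel_measurable borel"
      by (intro borel_measurable_times[OF k])
    show "AE y in lborel. ?C * norm (x - y) powr - (real DIM('a) - \<alpha>) * \<bar>u y\<bar> powr p
        = ?C * norm (x - y) powr - (real DIM('a) - \<alpha>) * \<bar>u' y\<bar> powr p"
      using u'(2) by eventually_elim simp
  qed
  then show ?thesis by (simp add: mult.assoc)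
qed

theorem theorem2:
  fixes u :: "real ^ 'n \<Rightarrow> real" and N :: nat and \<alpha> p :: real
  assumes "N = CARD('n)"
    and "0 < \<alpha>" and "\<alpha> < real N" and "1 < p"
    and "u \<in> W12 \<inter> Lp (2 * real N * p / (real N + \<alpha>))"
    and "weak_grad u \<in> W12_loc_field \<inter> Lp_loc (2 * real N * p / (real N + \<alpha>))"
    and "1 / p \<le> (real N - 2) / (real N + \<alpha>) \<or> 1 / p \<ge> real N / (real N + \<alpha>)"
    and "choquard_weak_solution \<alpha> p u"
  shows "AE x in lebesgue. u x = 0"
proof -
  have N: "real N = real DIM(real ^ 'n)" using assms(1) by simp
  define r where "r = 2 * real N * p / (real N + \<alpha>)"
  have r: "1 < r"
  proof -
    have "real N + \<alpha> < 2 * real N * 1" using assms(3) by simp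
    also have "\<dots> \<le> 2 * real N * p" using assms(4) by (intro mult_left_mono) auto
    finally show ?thesis using assms(2,3) by (simp add: r_def)
  qed
  let ?G = "weak_grad u"
  let ?H = "\<lambda>b. weak_grad (\<lambda>x. ?G x \<bullet> b)"
  have wu: "has_weak_gradient u ?G" and u2: "u \<in> Lp 2" and G2: "?G \<in> Lp 2" and ur: "u \<in> Lp r" and Gr: "?G \<in> Lp_loc r"
    using assms(5,6) has_weak_gradient_weak_grad[of u] by (auto simp: W12_def r_def)
  have wG: "has_weak_gradient (\<lambda>x. ?G x \<bullet> b) (?H b)" and H2: "?H b \<in> Lp_loc 2" if "b \<in> Basis" for b
    using assms(6) has_weak_gradient_weak_grad[of "\<lambda>x. ?G x \<bullet> b"] that by (auto simp: W12_loc_field_def W12_loc_def)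
  have um: "u \<in> borel_measurable lebesgue" using u2 by (simp add: Lp_def)
  have Gm: "?G \<in> borel_measurable lebesgue" using G2 by (simp add: Lp_def)
  obtain u' where u': "u' \<in> borel_measurable borel" "AE x in lborel. u x = u' x"
    using completion_ex_borel_measurable_real[OF um] by auto
  have "\<exists>g'\<in>borel_measurable borel. AE x in lborel. ?G x \<bullet> b = g' x" for b
    using completion_ex_borel_measurable_real[of "\<lambda>x. ?G x \<bullet> b" lborel] Gm by auto
  then obtain g where g: "\<And>b. g b \<in> borel_measurable borel" "\<And>b. AE x in lborel. ?G x \<bullet> b = g b x" by metis
  let ?P = "\<lambda>b c h'. h' \<in> borel_measurable borel \<and> (AE x in lborel. ?H b x \<bullet> c = h' x)"
  have ex_h: "\<exists>h'. ?P b c h'" if "b \<in> Basis" for b c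
    using completion_ex_borel_measurable_real[of "\<lambda>x. ?H b x \<bullet> c" lborel] H2[OF that] by (auto simp: Lp_loc_def)
  \<comment> \<open>Representatives are known to exist only for \<open>b\<close> in
    \<open>Basis\<close>; choosing by \<open>SOME\<close> gives a total \<open>h\<close> and leaves
    that restriction to its properties.\<close>
  define h where "h b c = (SOME h'. ?P b c h')" for b c
  have "?P b c (h b c)" if "b \<in> Basis" for b c
    unfolding h_def by (rule someI_ex[OF ex_h[OF that]])
  then have h: "\<And>b c. b \<in> Basis \<Longrightarrow> h b c \<in> borel_measurable borel"
      "\<And>b c. b \<in> Basis \<Longrightarrow> AE x in lborel. ?H b x \<bullet> c = h b c x" by auto
  define C where "C = Gamma ((real N - \<alpha>) / 2) / (Gamma (\<alpha> / 2) * pi powr (real N / 2) * 2 powr \<alpha>)"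
  have sq: "\<bar>t\<bar> powr 2 = t\<^sup>2" for t :: real by (simp add: powr_numeral)
  \<comment> \<open>The real line is a Euclidean space with basis element 1, so
    \<open>Lp_component\<close> also covers scalar functions.\<close>
  have u1: "AE x in lborel. u x \<bullet> 1 = u' x" using u'(2) by simp
  have ae_g: "AE x in lborel. \<forall>b\<in>Basis. ?G x \<bullet> b = g b x"
    by (intro AE_finite_allI finite_Basis g)
  interpret choquard_data u' g h r \<alpha> p C
  proof unfold_locales
    show "integrable lborel (\<lambda>x. (u' x)\<^sup>2)" using Lp_component[OF u2 _ _ u'(1) u1] by (simp add: sq)
    show "integrable lborel (\<lambda>x. \<bar>u' x\<bar> powr r)" using Lp_component[OF ur _ _ u'(1) u1] r by simp
    show "integrable lborel (\<lambda>x. (g b x)\<^sup>2)" if "b \<in> Basis" for b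
      using Lp_component[OF G2 _ that g] by (simp add: sq)
    show "integrable lborel (\<lambda>x. indicator (cball 0 R) x * \<bar>g b x\<bar> powr r)" if "b \<in> Basis" for b R
      using Lp_loc_component[OF Gr _ that g] r by simp
    show "integrable lborel (\<lambda>x. indicator (cball 0 R) x * (h b c x)\<^sup>2)" if "b \<in> Basis" "c \<in> Basis" for b c R
      using Lp_loc_component[OF H2[OF that(1)] _ that(2) h[OF that(1)]] by (simp add: sq)
    show "(LBINT x. u' x * pd b \<phi> x) = - (LBINT x. g b x * \<phi> x)"
      if "\<phi> \<in> test_functions" "b \<in> Basis" for \<phi> b
      by (rule weak_gradient_representative[OF wu that(2,1) u' g])
    show "(LBINT x. g b x * pd c \<phi> x) = - (LBINT x. h b c x * \<phi> x)"
      if "\<phi> \<in> test_functions" "b \<in> Basis" "c \<in> Basis" for \<phi> b c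
      by (rule weak_gradient_representative[OF wG[OF that(2)] that(3,1) g h[OF that(2)]])
    show "r = 2 * real DIM(real ^ 'n) * p / (real DIM(real ^ 'n) + \<alpha>)" using N by (simp add: r_def)
    show "\<alpha> < real DIM(real ^ 'n)" using N assms(3) by simp
    fix \<phi> :: "real ^ 'n \<Rightarrow> real" assume \<phi>: "\<phi> \<in> test_functions"
    note s = test_function_smooth[OF \<phi>]
    have pm: "\<phi> \<in> borel_measurable borel" "\<And>b. b \<in> Basis \<Longrightarrow> pd b \<phi> \<in> borel_measurable borel"
      using smooth_measurable[OF s] smooth_measurable[OF smooth_pd[OF s]] by auto
    let ?V = "\<lambda>x. LBINT y. norm (x - y) powr - (real DIM(real ^ 'n) - \<alpha>) * \<bar>u' y\<bar> powr p"
    have lhs: "?G x \<bullet> grad \<phi> x + u x * \<phi> x = (\<Sum>j\<in>Basis. (?G x \<bullet> j) * pd j \<phi> x) + u x * \<phi> x" for x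
      by (subst euclidean_inner) (simp add: grad_inner)
    have "(\<integral>x. ?G x \<bullet> grad \<phi> x + u x * \<phi> x \<partial>lebesgue) = (LBINT x. (\<Sum>j\<in>Basis. g j x * pd j \<phi> x) + u' x * \<phi> x)"
      unfolding lhs
    proof (rule lebesgue_representative(1))
      have Gb: "(\<lambda>x. ?G x \<bullet> b) \<in> borel_measurable lebesgue" for b using Gm by measurable
      show "(\<lambda>x. (\<Sum>j\<in>Basis. ?G x \<bullet> j * pd j \<phi> x) + u x * \<phi> x) \<in> borel_measurable lebesgue"
        by (intro borel_measurable_add borel_measurable_sum borel_measurable_times Gb um
            borel_measurable_lebesgueI[OF pm(1)] borel_measurable_lebesgueI[OF pm(2)])
      show "(\<lambda>x. (\<Sum>j\<in>Basis. g j x * pd j \<phi> x) + u' x * \<phi> x) \<in> borel_measurable borel"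
        by (intro borel_measurable_add borel_measurable_sum borel_measurable_times g u' pm)
      show "AE x in lborel. (\<Sum>j\<in>Basis. ?G x \<bullet> j * pd j \<phi> x) + u x * \<phi> x = (\<Sum>j\<in>Basis. g j x * pd j \<phi> x) + u' x * \<phi> x"
        using u'(2) ae_g by eventually_elim simp
    qed
    moreover have "(\<integral>x. convolution (riesz_potential \<alpha>) (\<lambda>y. \<bar>u y\<bar> powr p) x * (\<bar>u x\<bar> powr (p - 2) * u x) * \<phi> x \<partial>lebesgue)
        = (LBINT x. C * ?V x * (\<bar>u' x\<bar> powr (p - 2) * u' x) * \<phi> x)"
      unfolding convolution_riesz_eq[OF um u'] C_def N
    proof (rule lebesgue_representative(1))
      let ?C = "Gamma ((real DIM(real ^ 'n) - \<alpha>) / 2) / (Gamma (\<alpha> / 2) * pi powr (real DIM(real ^ 'n) / 2) * 2 powr \<alpha>)"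
      have Vm: "(\<lambda>x. ?C * ?V x) \<in> borel_measurable borel" using u'(1) by measurable
      have "(\<lambda>x. \<bar>u x\<bar> powr (p - 2) * u x) \<in> borel_measurable lebesgue" using um by measurable
      then show "(\<lambda>x. ?C * ?V x * (\<bar>u x\<bar> powr (p - 2) * u x) * \<phi> x) \<in> borel_measurable lebesgue"
        by (intro borel_measurable_times[OF borel_measurable_times[OF borel_measurable_lebesgueI[OF Vm]] borel_measurable_lebesgueI[OF pm(1)]])
      have "(\<lambda>x. \<bar>u' x\<bar> powr (p - 2) * u' x) \<in> borel_measurable borel" using u'(1) by measurable
      then show "(\<lambda>x. ?C * ?V x * (\<bar>u' x\<bar> powr (p - 2) * u' x) * \<phi> x) \<in> borel_measurable borel"
        by (intro borel_measurable_times[OF borel_measurable_times[OF Vm] pm(1)])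
      show "AE x in lborel. ?C * ?V x * (\<bar>u x\<bar> powr (p - 2) * u x) * \<phi> x = ?C * ?V x * (\<bar>u' x\<bar> powr (p - 2) * u' x) * \<phi> x"
        using u'(2) by eventually_elim simp
    qed
    ultimately show "(LBINT x. (\<Sum>j\<in>Basis. g j x * pd j \<phi> x) + u' x * \<phi> x)
        = C * (LBINT x. ?V x * (\<bar>u' x\<bar> powr (p - 2) * u' x) * \<phi> x)"
      using assms(8) \<phi> by (simp add: choquard_weak_solution_def mult.assoc)
  qed (use r u' g h assms in auto)
  have "AE x in lborel. u' x = 0" by (rule u_eq_0) (use assms(7) N in simp)
  with u'(2) have "AE x in lborel. u x = 0" by eventually_elim simp
  then show ?thesis by (rule AE_completion)
qed

end
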